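(* Let $p\ge 3$ be an odd prime and $q=2$. Let $F\subset K$, $F\subset L$ be number fields with $[K:F]=2$, $[L:F]=p$, and $N=L\cdot K$ with $[N:K]=p$, $[N:L]=2$, $F=L\cap K$. Among the prime ideals of $L$ which are totally ramified over $F$, denote by $\mathfrak{p}_1,\ldots,\mathfrak{p}_s$ those which split in $N$, $\mathfrak{p}_i\mathcal{O}_N=\mathfrak{P}_i\mathfrak{P}_i'$ ($1\le i\le s$), and by $\mathfrak{q}_1,\ldots,\mathfrak{q}_n$ those which remain inert in $N$, $\mathfrak{q}_j\mathcal{O}_N=\mathfrak{Q}_j$ ($1\le j\le n$). Then $\mathcal{I}_{N/K}/\mathcal{I}_K$ is the direct product of the subspace $\mathcal{I}_{L/F}/\mathcal{I}_F$ (absolute differential factors) and the subspace $\ker(\overline{N}_{N/L})$ (relative differential factors), where \[ \mathcal{I}_{L/F}/\mathcal{I}_F\simeq\prod_{i=1}^s(\langle\mathfrak{p}_i\rangle/\langle\mathfrak{p}_i^p\rangle)\times\prod_{j=1}^n(\langle\mathfrak{q}_j\rangle/\langle\mathfrak{q}_j^p\rangle)\simeq\mathbb{F}_p^{s+n},\quad \dim_{\mathbb{F}_p}(\mathcal{I}_{L/F}/\mathcal{I}_F)=s+n, \] \[ \ker(\overline{N}_{N/L})\simeq\prod_{i=1}^s\Bigl(\langle\mathfrak{P}_i(\mathfrak{P}_i')^{p-1}\rangle/\langle(\mathfrak{P}_i(\mathfrak{P}_i')^{p-1})^p\rangle\Bigr)\simeq\mathbb{F}_p^s,\quad \dim_{\mathbb{F}_p}\ker(\overline{N}_{N/L})=s.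 \] Consequently $\dim_{\mathbb{F}_p}(\mathcal{I}_{N/K}/\mathcal{I}_K)=n+2s$.
   Context: For a number field $E$, $\mathcal{I}_E$ is its group of fractional ideals; ideals of subfields are identified with their extensions. For an extension $E/E_0$ of degree $p$, $\mathcal{I}_{E/E_0}:=\{\mathfrak{A}\in\mathcal{I}_E\mid \mathfrak{A}^p\in\mathcal{I}_{E_0}\}$. $\overline{N}_{N/L}:\mathcal{I}_{N/K}/\mathcal{I}_K\to\mathcal{I}_{L/F}/\mathcal{I}_F$ denotes the homomorphism induced by the relative norm from $N$ to $L$.
   Formalization: The description and dimension of I_{L/F}/I_F and the total dimension n+2s are stated only when every totally ramified prime of L splits or is inert in N; a prime ramifying in N breaks them (F=Q, K=Q(√-3), L=Q(∛2), p=3: s+n=1 but the dimension is 2). *)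

theory Defs
  imports
    "HOL-Computational_Algebra.Polynomial"
    "HOL-Number_Theory.Residues"
    "HOL-Algebra.Algebra"
    "HOL-Algebra.Algebraic_Closure_Type"
    "Jordan_Normal_Form.Missing_VectorSpace"
begin

text \<open>Number fields are the subfields of the complex numbers of finite degree over \<open>\<rat>\<close>.\<close>

abbreviation complex_ring :: "complex ring" where
  "complex_ring \<equiv> ring_of_type_algebra"

definition number_field :: "complex set \<Rightarrow> bool" where
  "number_field E \<longleftrightarrow> subfield E complex_ring \<and> ring.finite_dimension complex_ring \<rat> E"

text \<open>\<open>has_degree E0 E n\<close> means \<open>[E : E0] = n\<close>.\<close>

definition has_degree :: "complex set \<Rightarrow> complex set \<Rightarrow> nat \<Rightarrow> bool" where
  "has_degree E0 E n \<longleftrightarrow> ring.dimension complex_ring n E0 E"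

definition compositum :: "complex set \<Rightarrow> complex set \<Rightarrow> complex set" where
  "compositum L K = generate_field complex_ring (L \<union> K)"

definition integers_of :: "complex set \<Rightarrow> complex set" where
  "integers_of E = {x \<in> E. algebraic_int x}"

definition integer_ring :: "complex set \<Rightarrow> complex ring" where
  "integer_ring E = complex_ring\<lparr>carrier := integers_of E\<rparr>"

definition prime_ideals :: "complex set \<Rightarrow> complex set set" where
  "prime_ideals E = {P. primeideal P (integer_ring E) \<and> P \<noteq> {0}}"


subsection \<open>Fractional ideals\<close>

definition fractional_ideals :: "complex set \<Rightarrow> complex set set" where
  "fractional_ideals E =
     {(\<lambda>x. a * x) ` I | a I. a \<in> E \<and> a \<noteq> 0 \<and> ideal I (integer_ring E) \<and> I \<noteq> {0}}"

text \<open>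
  \<^const>\<open>ideal_prod\<close> forms the set of all finite sums of products \<open>a * b\<close> with \<open>a \<in> A\<close>, \<open>b \<in> B\<close>;
  taken in the ring of complex numbers it also makes sense for fractional ideals, and for arbitrary
  sets of generators in place of \<open>A\<close>.
\<close>

definition ideal_group :: "complex set \<Rightarrow> complex set monoid" where
  "ideal_group E =
     \<lparr>carrier = fractional_ideals E, monoid.mult = ideal_prod complex_ring, one = integers_of E\<rparr>"

text \<open>The extension \<open>A O\<^sub>E\<close> of an ideal \<open>A\<close> of a subfield of \<open>E\<close>.\<close>

definition extend_ideal :: "complex set \<Rightarrow> complex set \<Rightarrow> complex set" where
  "extend_ideal E A = ideal_prod complex_ring A (integers_of E)"

text \<open>The group of fractional ideals of \<open>E0\<close>, regarded as a group of fractional ideals of \<open>E\<close>.\<close>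

definition extended_ideals :: "complex set \<Rightarrow> complex set \<Rightarrow> complex set set" where
  "extended_ideals E0 E = extend_ideal E ` carrier (ideal_group E0)"

text \<open>\<open>I\<^bsub>E/E0\<^esub>\<close> and the quotient \<open>I\<^bsub>E/E0\<^esub> / I\<^bsub>E0\<^esub>\<close> for an extension of degree \<open>p\<close>.\<close>

definition differential_ideals :: "nat \<Rightarrow> complex set \<Rightarrow> complex set \<Rightarrow> complex set set" where
  "differential_ideals p E0 E =
     {A \<in> carrier (ideal_group E). A [^]\<^bsub>ideal_group E\<^esub> p \<in> extended_ideals E0 E}"

definition differential_group :: "nat \<Rightarrow> complex set \<Rightarrow> complex set \<Rightarrow> complex set set monoid" where
  "differential_group p E0 E =
     (ideal_group E)\<lparr>carrier := differential_ideals p E0 E\<rparr> Mod extended_ideals E0 E"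


subsection \<open>Decomposition of prime ideals\<close>

definition totally_ramified :: "complex set \<Rightarrow> complex set \<Rightarrow> complex set \<Rightarrow> bool" where
  "totally_ramified F L P \<longleftrightarrow>
     P \<in> prime_ideals L \<and>
     (\<exists>n. has_degree F L n \<and> extend_ideal L (P \<inter> integers_of F) = P [^]\<^bsub>ideal_group L\<^esub> n)"

text \<open>Only for a quadratic extension \<open>N\<close> of the field to which the prime ideal \<open>P\<close> belongs.\<close>

definition splits_in :: "complex set \<Rightarrow> complex set \<Rightarrow> bool" where
  "splits_in N P \<longleftrightarrow>
     (\<exists>Q \<in> prime_ideals N. \<exists>Q' \<in> prime_ideals N.
        Q \<noteq> Q' \<and> extend_ideal N P = Q \<otimes>\<^bsub>ideal_group N\<^esub> Q')"

definition inert_in :: "complex set \<Rightarrow> complex set \<Rightarrow> bool" where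
  "inert_in N P \<longleftrightarrow> extend_ideal N P \<in> prime_ideals N"


subsection \<open>Relative norms\<close>

text \<open>
  The norm of an element is the product of its images under the embeddings of \<open>N\<close> into the complex
  numbers that fix \<open>L\<close> pointwise. Restricting to extensional functions makes each embedding of \<open>N\<close>
  occur exactly once.
\<close>

definition embeddings :: "complex set \<Rightarrow> complex set \<Rightarrow> (complex \<Rightarrow> complex) set" where
  "embeddings L N =
     {\<sigma> \<in> ring_hom (complex_ring\<lparr>carrier := N\<rparr>) complex_ring \<inter> extensional N. \<forall>x\<in>L. \<sigma> x = x}"

definition rel_norm :: "complex set \<Rightarrow> complex set \<Rightarrow> complex \<Rightarrow> complex" where
  "rel_norm L N x = (\<Prod>\<sigma>\<in>embeddings L N. \<sigma> x)"

text \<open>The norm of an ideal is generated over \<open>O\<^sub>L\<close> by the norms of its elements.\<close>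

definition ideal_norm :: "complex set \<Rightarrow> complex set \<Rightarrow> complex set \<Rightarrow> complex set" where
  "ideal_norm L N A = ideal_prod complex_ring (rel_norm L N ` A) (integers_of L)"


subsection \<open>Induced maps between the quotients\<close>

text \<open>
  If \<open>f\<close> induces a map into \<open>G / H\<close> that is constant on the coset \<open>C\<close>, then the union below is that
  constant value, a single coset of \<open>H\<close>.
\<close>

definition induced_map :: "('b, 'm) monoid_scheme \<Rightarrow> 'b set \<Rightarrow> ('a \<Rightarrow> 'b) \<Rightarrow> 'a set \<Rightarrow> 'b set" where
  "induced_map G H f C = (\<Union>A\<in>C. H #>\<^bsub>G\<^esub> f A)"

text \<open>The map \<open>I\<^bsub>L/F\<^esub> / I\<^sub>F \<rightarrow> I\<^bsub>N/K\<^esub> / I\<^sub>K\<close> induced by extension of ideals.\<close>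

definition ext_bar :: "complex set \<Rightarrow> complex set \<Rightarrow> complex set set \<Rightarrow> complex set set" where
  "ext_bar K N = induced_map (ideal_group N) (extended_ideals K N) (extend_ideal N)"

text \<open>The map \<open>I\<^bsub>N/K\<^esub> / I\<^sub>K \<rightarrow> I\<^bsub>L/F\<^esub> / I\<^sub>F\<close> induced by the relative norm.\<close>

definition norm_bar ::
  "complex set \<Rightarrow> complex set \<Rightarrow> complex set \<Rightarrow> complex set set \<Rightarrow> complex set set" where
  "norm_bar F L N = induced_map (ideal_group L) (extended_ideals F L) (ideal_norm L N)"

definition absolute_factors ::
  "nat \<Rightarrow> complex set \<Rightarrow> complex set \<Rightarrow> complex set \<Rightarrow> complex set \<Rightarrow> complex set set set" where
  "absolute_factors p F K L N = ext_bar K N ` carrier (differential_group p F L)"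

definition relative_factors ::
  "nat \<Rightarrow> complex set \<Rightarrow> complex set \<Rightarrow> complex set \<Rightarrow> complex set \<Rightarrow> complex set set set" where
  "relative_factors p F K L N =
     kernel (differential_group p K N) (differential_group p F L) (norm_bar F L N)"


subsection \<open>Groups as vector spaces over the prime field\<close>

definition subgroup_of :: "('a, 'm) monoid_scheme \<Rightarrow> 'a set \<Rightarrow> ('a, 'm) monoid_scheme" where
  "subgroup_of G H = G\<lparr>carrier := H\<rparr>"

definition cyclic_quotient :: "('a, 'm) monoid_scheme \<Rightarrow> nat \<Rightarrow> 'a \<Rightarrow> 'a set monoid" where
  "cyclic_quotient G p x =
     subgroup_of G (generate G {x}) Mod generate G {x [^]\<^bsub>G\<^esub> p}"

text \<open>The additive group of the vector space of dimension \<open>m\<close> over the field with \<open>p\<close> elements.\<close>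

definition Fp_power :: "nat \<Rightarrow> nat \<Rightarrow> (nat \<Rightarrow> int) monoid" where
  "Fp_power p m = product_group {1..m} (\<lambda>_. add_monoid (residue_ring (int p)))"

text \<open>
  A multiplicative group with scalar multiplication given by taking powers. The ring
  multiplication and its unit, which the module record inherits, play no role.
\<close>

definition power_module :: "('a, 'm) monoid_scheme \<Rightarrow> (int, 'a) module" where
  "power_module G =
     \<lparr>carrier = carrier G, monoid.mult = undefined, one = undefined,
      ring.zero = \<one>\<^bsub>G\<^esub>, ring.add = (\<lambda>x y. x \<otimes>\<^bsub>G\<^esub> y), module.smult = (\<lambda>k x. x [^]\<^bsub>G\<^esub> k)\<rparr>"

definition has_Fp_dim :: "nat \<Rightarrow> ('a, 'm) monoid_scheme \<Rightarrow> nat \<Rightarrow> bool" where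
  "has_Fp_dim p G d \<longleftrightarrow>
     vectorspace (residue_ring (int p)) (power_module G) \<and>
     vectorspace.fin_dim (residue_ring (int p)) (power_module G) \<and>
     vectorspace.dim (residue_ring (int p)) (power_module G) = d"

end

theory Submission
  imports Defs "Jordan_Normal_Form.Char_Poly"
begin

text \<open>
  The group \<open>I\<^bsub>E/E0\<^esub> / I\<^bsub>E0\<^esub>\<close> of an extension of prime degree \<open>p\<close> is an \<open>F\<^sub>p\<close>-vector space
  with the classes of the totally ramified primes as a basis: if \<open>A\<^sup>p\<close> is extended from \<open>B\<close> and \<open>p\<close> does not divide
  the exponent of a prime \<open>\<pp>\<close> in \<open>B\<close>, then \<open>p\<close> divides all ramification indices above \<open>\<pp>\<close>, so that
  \<open>\<pp>\<close> is totally ramified. Since \<open>N/L\<close> is quadratic with conjugation \<open>\<tau>\<close>, the norm of an ideal \<open>A\<close> extends to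
  \<open>A \<tau>(A)\<close>. Hence the norm restricted to extended ideals is squaring, which is invertible as \<open>p\<close> is odd, and this splits
  \<open>I\<^bsub>N/K\<^esub> / I\<^sub>K\<close>. On the kernel of the norm \<open>\<tau>\<close> acts as \<open>-1\<close>, and this part is spanned by the quotients
  \<open>\<PP> / \<tau>(\<PP>)\<close>, which are nontrivial for the primes \<open>\<PP>\<close> above the split \<open>\<pp>\<close>.
\<close>

section \<open>Algebraic integers form a ring\<close>

text \<open>All ideals are sets of complex numbers, but ideals of different fields remain different
  sets. Their identification is replaced by extension to a common field: extension is multiplicative
  and injective, so identities between ideals of F, K and L can be verified in N, where the norm
  becomes A \<tau>(A). The hypothesis F = L \<inter> K enters through a square root \<theta> that
  generates K/F: it stays outside L, so it generates N/L as well, and the conjugations of K/F and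
  N/L agree on K. This is why the norm takes ideals of K to ideals of F and induces a map of the
  quotients. Independence in both bases is tested by valuations: at a prime of ramification index p
  every ideal extended from below has valuation divisible by p. The exponent p - 1 in the relative
  generators replaces -1. The ideal \<PP> \<PP>'^(p-1) is \<PP> / \<PP>' times the p-th power of
  \<PP>', and this power comes from K, because \<PP>' is totally ramified over K. Hence both
  represent the same class.\<close>

definition zspan :: "('i \<Rightarrow> 'a::field_char_0) \<Rightarrow> 'i set \<Rightarrow> 'a set" where
  "zspan v S = {\<Sum>s\<in>S. of_int (c s) * v s | c. True}"

lemma zspan_add: "x \<in> zspan v S \<Longrightarrow> y \<in> zspan v S \<Longrightarrow> x + y \<in> zspan v S"
proof -
  assume "x \<in> zspan v S" "y \<in> zspan v S"
  then obtain c d where "x = (\<Sum>s\<in>S. of_int (c s) * v s)" "y = (\<Sum>s\<in>S. of_int (d s) * v s)"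
    unfolding zspan_def by blast
  then have "x + y = (\<Sum>s\<in>S. of_int (c s + d s) * v s)"
    by (simp add: sum.distrib algebra_simps)
  then show ?thesis unfolding zspan_def by (intro CollectI exI[of _ "\<lambda>s. c s + d s"]) auto
qed

lemma zspan_int_mult: "x \<in> zspan v S \<Longrightarrow> of_int k * x \<in> zspan v S"
proof -
  assume "x \<in> zspan v S"
  then obtain c where "x = (\<Sum>s\<in>S. of_int (c s) * v s)"
    unfolding zspan_def by blast
  then have "of_int k * x = (\<Sum>s\<in>S. of_int (k * c s) * v s)"
    by (simp add: sum_distrib_left algebra_simps)
  then show ?thesis unfolding zspan_def by (intro CollectI exI[of _ "\<lambda>s. k * c s"]) auto
qed

lemma zspan_zero: "0 \<in> zspan v S"
  unfolding zspan_def by (intro CollectI exI[of _ "\<lambda>s. 0"]) auto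

lemma zspan_sum: "(\<And>i. i \<in> T \<Longrightarrow> f i \<in> zspan v S) \<Longrightarrow> sum f T \<in> zspan v S"
  by (induction T rule: infinite_finite_induct) (auto intro: zspan_add zspan_zero)

lemma zspan_base: "finite S \<Longrightarrow> s \<in> S \<Longrightarrow> v s \<in> zspan v S"
  unfolding zspan_def by (intro CollectI exI[of _ "\<lambda>t. if t = s then 1 else 0"])
    (auto simp: if_distrib if_distribR sum.delta cong: if_cong)

lemma zspan_mult_stable:
  assumes "\<And>s. s \<in> S \<Longrightarrow> x * v s \<in> zspan v S" "y \<in> zspan v S"
  shows "x * y \<in> zspan v S"
proof -
  obtain c where c: "y = (\<Sum>s\<in>S. of_int (c s) * v s)" using assms(2) unfolding zspan_def by blast
  have "x * y = (\<Sum>s\<in>S. of_int (c s) * (x * v s))"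
    unfolding c by (simp add: sum_distrib_left algebra_simps)
  then show ?thesis using assms(1) by (auto intro!: zspan_sum zspan_int_mult)
qed

text \<open>The multiplier is an eigenvalue of an integer matrix.\<close>

lemma algebraic_int_if_zspan_stable:
  fixes v :: "'i \<Rightarrow> 'a::field_char_0"
  assumes fin: "finite S" and nz: "s0 \<in> S" "v s0 \<noteq> 0"
    and stable: "\<And>s. s \<in> S \<Longrightarrow> x * v s \<in> zspan v S"
  shows "algebraic_int x"
proof -
  define m where "m = card S"
  obtain e where e: "bij_betw e {0..<m} S"
    using fin unfolding m_def by (metis ex_bij_betw_nat_finite)
  have "\<forall>s\<in>S. \<exists>c. x * v s = (\<Sum>t\<in>S. of_int (c t) * v t)"
    using stable unfolding zspan_def by blast
  then obtain c where c: "\<And>s. s \<in> S \<Longrightarrow> x * v s = (\<Sum>t\<in>S. of_int (c s t) * v t)"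
    by metis
  define A :: "int mat" where "A = mat m m (\<lambda>(i,j). c (e i) (e j))"
  define w where "w = vec m (\<lambda>i. v (e i))"
  have A: "A \<in> carrier_mat m m" unfolding A_def by simp
  have eS: "e i \<in> S" if "i < m" for i using e that by (auto simp: bij_betw_def)
  have ev: "eigenvector (map_mat of_int A) w x"
    unfolding eigenvector_def
  proof (intro conjI)
    show "w \<in> carrier_vec (dim_row (map_mat of_int A))" unfolding w_def A_def by simp
    obtain i where "i < m" "e i = s0" using e nz(1) by (auto simp: bij_betw_def)
    then have "w $ i \<noteq> 0" using nz unfolding w_def by simp
    then show "w \<noteq> 0\<^sub>v (dim_row (map_mat of_int A))" using \<open>i < m\<close> unfolding A_def by auto
    show "map_mat of_int A *\<^sub>v w = x \<cdot>\<^sub>v w"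
    proof (rule eq_vecI)
      fix i assume "i < dim_vec (x \<cdot>\<^sub>v w)"
      then have i: "i < m" unfolding w_def by simp
      have "(map_mat of_int A *\<^sub>v w) $ i = (\<Sum>j\<in>{0..<m}. of_int (c (e i) (e j)) * v (e j))"
        using i unfolding A_def w_def by (simp add: scalar_prod_def)
      also have "\<dots> = (\<Sum>t\<in>S. of_int (c (e i) t) * v t)"
        by (rule sum.reindex_bij_betw[OF e])
      also have "\<dots> = x * v (e i)" using c[OF eS[OF i]] by simp
      finally show "(map_mat of_int A *\<^sub>v w) $ i = (x \<cdot>\<^sub>v w) $ i" using i unfolding w_def by simp
    qed (simp add: A_def w_def)
  qed
  have "poly (char_poly (map_mat of_int A)) x = 0"
    using eigenvalue_root_char_poly[of "map_mat of_int A" m x] ev A unfolding eigenvalue_def by auto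
  then have "poly (map_poly of_int (char_poly A)) x = 0"
    by (simp add: of_int_hom.char_poly_hom[OF A])
  moreover have "lead_coeff (char_poly A) = 1" using degree_monic_char_poly[OF A] by simp
  ultimately show ?thesis unfolding algebraic_int_altdef_ipoly by blast
qed

lemma algebraic_int_power_in_zspan:
  fixes x :: "'a::field_char_0"
  assumes "algebraic_int x"
  obtains a where "a > 0" "x ^ a \<in> zspan (\<lambda>i. x ^ i) {..<a}"
proof -
  obtain p where p: "poly (map_poly of_int p) x = 0" "lead_coeff p = 1"
    using assms unfolding algebraic_int_altdef_ipoly by auto
  define a where "a = degree p"
  have "(\<Sum>i\<le>a. of_int (coeff p i) * x ^ i) = 0"
    using p(1) by (simp add: poly_altdef a_def coeff_map_poly)
  then have sm: "(\<Sum>i<a. of_int (coeff p i) * x ^ i) + x ^ a = 0"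
    using p(2) by (simp add: a_def lessThan_Suc_atMost[symmetric])
  then have "x ^ a = (\<Sum>i<a. of_int (- coeff p i) * x ^ i)"
    by (simp add: sum_negf eq_neg_iff_add_eq_0 add.commute)
  then have "x ^ a \<in> zspan (\<lambda>i. x ^ i) {..<a}"
    unfolding zspan_def by (intro CollectI exI[of _ "\<lambda>i. - coeff p i"] conjI) auto
  \<comment> \<open>For a = 0 the relation would read 1 = 0.\<close>
  moreover have "a > 0" using sm by (cases a) auto
  ultimately show ?thesis using that by blast
qed

text \<open>The monomials x^i y^j with i < a and j < b span \<int>[x,y], where a and b are the
  degrees of monic relations for x and y. One module that is stable under both numbers serves for
  sums and products alike; its nonzero entry is 1, at (0,0).\<close>

lemma algebraic_int_stable_pair:
  fixes x y :: "'a::field_char_0"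
  assumes "algebraic_int x" "algebraic_int y"
  obtains S and v :: "nat \<times> nat \<Rightarrow> 'a" and s0
  where "finite S" "s0 \<in> S" "v s0 \<noteq> 0"
    "\<And>z. z \<in> zspan v S \<Longrightarrow> x * z \<in> zspan v S" "\<And>z. z \<in> zspan v S \<Longrightarrow> y * z \<in> zspan v S"
proof -
  obtain a where a: "a > 0" "x ^ a \<in> zspan (\<lambda>i. x ^ i) {..<a}"
    using algebraic_int_power_in_zspan[OF assms(1)] .
  obtain b where b: "b > 0" "y ^ b \<in> zspan (\<lambda>i. y ^ i) {..<b}"
    using algebraic_int_power_in_zspan[OF assms(2)] .
  define S where "S = {..<a} \<times> {..<b}"
  define v where "v = (\<lambda>(i,j). x ^ i * y ^ j)"
  have fin: "finite S" unfolding S_def by simp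
  obtain c where c: "x ^ a = (\<Sum>i<a. of_int (c i) * x ^ i)" using a(2) unfolding zspan_def by blast
  obtain d where d: "y ^ b = (\<Sum>i<b. of_int (d i) * y ^ i)" using b(2) unfolding zspan_def by blast
  have B: "x ^ i * y ^ j \<in> zspan v S" if "i < a" "j < b" for i j
    using zspan_base[OF fin, of "(i,j)" v] that unfolding v_def S_def by simp
  have X: "x * v s \<in> zspan v S" if "s \<in> S" for s
  proof -
    obtain i j where s: "s = (i,j)" "i < a" "j < b" using \<open>s \<in> S\<close> S_def by auto
    show ?thesis
    proof (cases "Suc i < a")
      case True then show ?thesis using B[of "Suc i" j] s unfolding v_def by (simp add: mult.assoc)
    next
      case False
      then have "Suc i = a" using s by simp
      then have "x * v s = x ^ a * y ^ j" unfolding v_def s(1) by (simp add: mult.assoc flip: power_Suc)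
      also have "\<dots> = (\<Sum>i<a. of_int (c i) * (x ^ i * y ^ j))"
        unfolding c by (simp add: sum_distrib_right mult.assoc)
      also have "\<dots> \<in> zspan v S" using B s by (auto intro!: zspan_sum zspan_int_mult)
      finally show ?thesis .
    qed
  qed
  have Y: "y * v s \<in> zspan v S" if "s \<in> S" for s
  proof -
    obtain i j where s: "s = (i,j)" "i < a" "j < b" using \<open>s \<in> S\<close> S_def by auto
    show ?thesis
    proof (cases "Suc j < b")
      case True then show ?thesis using B[of i "Suc j"] s unfolding v_def by (simp add: ac_simps)
    next
      case False
      then have "Suc j = b" using s by simp
      then have "y * v s = x ^ i * y ^ b" unfolding v_def s(1) by (auto simp: ac_simps)
      also have "\<dots> = (\<Sum>j<b. of_int (d j) * (x ^ i * y ^ j))"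
        unfolding d by (simp add: sum_distrib_left ac_simps)
      also have "\<dots> \<in> zspan v S" using B s by (auto intro!: zspan_sum zspan_int_mult)
      finally show ?thesis .
    qed
  qed
  show ?thesis
  proof
    show "finite S" by (rule fin)
    show "(0,0) \<in> S" using a b S_def by auto
    show "v (0,0) \<noteq> 0" unfolding v_def by simp
  qed (auto intro: zspan_mult_stable X Y)
qed

lemma algebraic_int_add [intro]:
  fixes x y :: "'a::field_char_0"
  assumes "algebraic_int x" "algebraic_int y"
  shows "algebraic_int (x + y)"
proof -
  obtain S and v :: "nat \<times> nat \<Rightarrow> 'a" and s0 where S: "finite S" "s0 \<in> S" "v s0 \<noteq> 0"
    "\<And>z. z \<in> zspan v S \<Longrightarrow> x * z \<in> zspan v S" "\<And>z. z \<in> zspan v S \<Longrightarrow> y * z \<in> zspan v S"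
    using algebraic_int_stable_pair[OF assms] by metis
  show ?thesis
    by (rule algebraic_int_if_zspan_stable[of S s0 v])
      (use S in \<open>auto simp: distrib_right intro!: zspan_add zspan_base\<close>)
qed

lemma algebraic_int_mult [intro]:
  fixes x y :: "'a::field_char_0"
  assumes "algebraic_int x" "algebraic_int y"
  shows "algebraic_int (x * y)"
proof -
  obtain S and v :: "nat \<times> nat \<Rightarrow> 'a" and s0 where S: "finite S" "s0 \<in> S" "v s0 \<noteq> 0"
    "\<And>z. z \<in> zspan v S \<Longrightarrow> x * z \<in> zspan v S" "\<And>z. z \<in> zspan v S \<Longrightarrow> y * z \<in> zspan v S"
    using algebraic_int_stable_pair[OF assms] by metis
  show ?thesis
    by (rule algebraic_int_if_zspan_stable[of S s0 v])
      (use S in \<open>auto simp: mult.assoc intro!: zspan_base\<close>)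
qed

lemma algebraic_int_diff [intro]:
  fixes x y :: "'a::field_char_0"
  assumes "algebraic_int x" "algebraic_int y"
  shows "algebraic_int (x - y)"
  using algebraic_int_add[OF assms(1) algebraic_int_minus[OF assms(2)]] by simp

text \<open>Substituting X^k - X^j, which is monic of degree k as j < k, into a monic polynomial
  leaves it monic. The pigeonhole argument of \<open>mult_stable_integral\<close> ends with such a
  difference.\<close>

lemma algebraic_int_if_power_diff:
  fixes x :: "'a::field_char_0"
  assumes "algebraic_int (x ^ k - x ^ j)" "j < k"
  shows "algebraic_int x"
proof -
  obtain p where p: "lead_coeff p = 1" "\<forall>i. coeff p i \<in> \<int>" "poly p (x ^ k - x ^ j) = 0"
    using assms(1) by (auto elim: algebraic_int.cases)
  obtain f :: "int poly" where f: "poly (map_poly of_int f) (x ^ k - x ^ j) = 0" "lead_coeff f = 1"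
    using assms(1) unfolding algebraic_int_altdef_ipoly by auto
  define g :: "int poly" where "g = monom 1 k - monom 1 j"
  have cg: "coeff g k = 1" unfolding g_def using assms(2) by simp
  have "degree g \<le> k"
    unfolding g_def using assms(2) by (intro degree_diff_le) (auto intro: order_trans[OF degree_monom_le])
  moreover have "k \<le> degree g" using cg by (intro le_degree) simp
  ultimately have dg: "degree g = k" "coeff g k = 1" using cg by auto
  have "poly (map_poly of_int (pcompose f g)) x = poly (map_poly of_int f) (x ^ k - x ^ j)"
    unfolding of_int_hom.map_poly_pcompose poly_pcompose g_def by (simp add: hom_distribs poly_monom map_poly_monom)
  moreover have "lead_coeff (pcompose f g) = 1"
    using lead_coeff_comp[of g f] dg f(2) assms(2) by auto
  ultimately show ?thesis unfolding algebraic_int_altdef_ipoly using f(1) by auto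
qed

section \<open>Number fields\<close>

lemma complex_ring_simps [simp]:
  "carrier complex_ring = UNIV" "x \<otimes>\<^bsub>complex_ring\<^esub> y = x * y" "x \<oplus>\<^bsub>complex_ring\<^esub> y = x + y"
  "\<one>\<^bsub>complex_ring\<^esub> = 1" "\<zero>\<^bsub>complex_ring\<^esub> = 0"
  by (simp_all add: ring_of_type_algebra_def)

lemma complex_ring_field: "field complex_ring"
  by (rule field_from_type_algebra)

interpretation CR: ring complex_ring
  by (rule ring_from_type_algebra)

lemma complex_ring_a_inv [simp]: "\<ominus>\<^bsub>complex_ring\<^esub> x = - x"
  using CR.l_neg[of x] by (simp add: add_eq_0_iff2)

lemma complex_ring_m_inv: "x \<noteq> 0 \<Longrightarrow> inv\<^bsub>complex_ring\<^esub> x = inverse x"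
  by (rule CR.inv_unique'[symmetric]) auto

lemma subfield_Rats: "subfield \<rat> complex_ring"
  by (rule field.subfieldI'[OF complex_ring_field], rule CR.subringI) (auto simp: complex_ring_m_inv)

lemma combine_eq_sum:
  "length cs = length us \<Longrightarrow> CR.combine cs us = (\<Sum>i<length us. cs ! i * us ! i)"
  by (induction cs us rule: list_induct2) (auto simp: sum.lessThan_Suc_shift simp del: sum.lessThan_Suc)

text \<open>Formulated for families, so that repeated members are harmless: a list with repeated
  entries also counts as dependent.\<close>

lemma dependence_if_dimension_less:
  assumes K: "subfield K complex_ring" and dim: "CR.dimension n K E"
    and f: "\<And>i. i < m \<Longrightarrow> f i \<in> E" and nm: "n < m"
  obtains c where "\<forall>i<m. c i \<in> K" "\<exists>i<m. c i \<noteq> 0" "(\<Sum>i<m. c i * f i) = 0"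
proof -
  define us where "us = map f [0..<m]"
  have us: "set us \<subseteq> E" "length us = m" using f unfolding us_def by auto
  have "\<not> CR.independent K us"
    using CR.independent_length_le_dimension[OF K dim _ us(1)] us(2) nm by linarith
  then obtain cs where cs: "length cs = length us" "CR.combine cs us = 0" "set cs \<subseteq> K" "set cs \<noteq> {0}"
    using CR.dependent_imp_non_trivial_combine[OF K, of us] by auto
  show ?thesis
  proof (rule that[of "\<lambda>i. cs ! i"])
    show "\<forall>i<m. cs ! i \<in> K" using cs us(2) by (metis nth_mem subsetD)
    have "set cs \<noteq> {}" using cs(1) us(2) nm by auto
    then show "\<exists>i<m. cs ! i \<noteq> 0" using cs(1,4) us(2) by (auto simp: set_conv_nth)
    show "(\<Sum>i<m. cs ! i * f i) = 0"
      using cs(2) combine_eq_sum[OF cs(1)] us(2) unfolding us_def by simp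
  qed
qed

lemma common_denominator:
  fixes c :: "'i \<Rightarrow> 'a::field_char_0"
  assumes "finite S" "\<And>i. i \<in> S \<Longrightarrow> c i \<in> \<rat>"
  obtains d :: int where "d > 0" "\<forall>i\<in>S. of_int d * c i \<in> \<int>"
  using assms
proof (induction S arbitrary: thesis rule: finite_induct)
  case empty
  show ?case by (rule empty(1)[of 1]) auto
next
  case (insert x S)
  obtain d where d: "d > 0" "\<forall>i\<in>S. of_int d * c i \<in> \<int>"
    using insert.IH insert.prems(2) by blast
  obtain a b :: int where ab: "b > 0" "c x = of_int a / of_int b"
    using insert.prems(2)[of x] by (auto elim: Rats_cases')
  show ?case
  proof (rule insert.prems(1)[of "d * b"])
    show "d * b > 0" using d ab by simp
    show "\<forall>i\<in>insert x S. of_int (d * b) * c i \<in> \<int>"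
    proof
      fix i assume i: "i \<in> insert x S"
      show "of_int (d * b) * c i \<in> \<int>"
      proof (cases "i = x")
        case True
        then have "of_int (d * b) * c i = of_int (d * a)" using ab by simp
        then show ?thesis by (metis Ints_of_int)
      next
        case False
        have "of_int b * (of_int d * c i) \<in> \<int>"
          by (rule Ints_mult[OF Ints_of_int]) (use d(2) i False in blast)
        moreover have "of_int (d * b) * c i = of_int b * (of_int d * c i)" by (simp only: of_int_mult ac_simps)
        ultimately show ?thesis by metis
      qed
    qed
  qed
qed

lemma integer_dependence:
  assumes dim: "CR.dimension n \<rat> E" and f: "\<And>i. i < m \<Longrightarrow> f i \<in> E" and nm: "n < m"
  obtains c :: "nat \<Rightarrow> int" where "\<exists>i<m. c i \<noteq> 0" "(\<Sum>i<m. of_int (c i) * f i) = 0"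
proof -
  obtain c where c: "\<forall>i<m. c i \<in> \<rat>" "\<exists>i<m. c i \<noteq> 0" "(\<Sum>i<m. c i * f i) = 0"
    by (rule dependence_if_dimension_less[OF subfield_Rats dim, of m f], erule f, rule nm, rule that)
  have cS: "c i \<in> \<rat>" if "i \<in> {..<m}" for i using c(1) that by simp
  obtain d :: int where d: "d > 0" "\<forall>i\<in>{..<m}. of_int d * c i \<in> \<int>"
    by (rule common_denominator[of "{..<m}" c], rule finite_lessThan, erule cS, rule that)
  \<comment> \<open>Floor and real part only convert complex numbers that are known to be integers
    to the type \<open>int\<close>.\<close>
  define z where "z = (\<lambda>i. \<lfloor>Re (of_int d * c i)\<rfloor>)"
  have z: "of_int (z i) = of_int d * c i" if "i < m" for i
  proof -
    have "of_int d * c i \<in> \<int>" using d(2) that by blast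
    then obtain k where "of_int d * c i = of_int k" by (rule Ints_cases)
    then show ?thesis unfolding z_def by simp
  qed
  show ?thesis
  proof (rule that[of z])
    obtain i where i: "i < m" "c i \<noteq> 0" using c(2) by blast
    then have "of_int (z i) \<noteq> (0::complex)" using z[OF i(1)] d(1) by simp
    then show "\<exists>i<m. z i \<noteq> 0" using i(1) by (intro exI[of _ i]) auto
    have "(\<Sum>i<m. of_int (z i) * f i) = of_int d * (\<Sum>i<m. c i * f i)"
      unfolding sum_distrib_left by (intro sum.cong) (simp_all add: z)
    then show "(\<Sum>i<m. of_int (z i) * f i) = 0" using c(3) by simp
  qed
qed

text \<open>With a the leading coefficient and y = a x, multiplication by a^(m-1) turns the relation
  into a monic one for y with integer coefficients c i * a^(m-1-i). Hence 1, y, ..., y^(m-1) span a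
  module stable under y.\<close>

lemma algebraic_int_multiple_of_root:
  fixes x :: "'a::field_char_0" and c :: "nat \<Rightarrow> int"
  assumes "(\<Sum>i\<le>m. of_int (c i) * x ^ i) = 0" "c m \<noteq> 0"
  shows "algebraic_int (of_int (c m) * x)"
proof (cases "m = 0")
  case True then show ?thesis using assms by simp
next
  case False
  define a y where "a = c m" and "y = of_int (c m) * x"
  define v where "v = (\<lambda>i. y ^ i)"
  have B: "v i \<in> zspan v {..<m}" if "i < m" for i using that by (intro zspan_base) auto
  have "of_int (c m) * x ^ m = - (\<Sum>i<m. of_int (c i) * x ^ i)"
    using assms(1) by (simp add: lessThan_Suc_atMost[symmetric] eq_neg_iff_add_eq_0 add.commute)
  then have "of_int (a ^ (m - 1)) * (of_int (c m) * x ^ m) = (\<Sum>i<m. - of_int (c i * a ^ (m - 1)) * x ^ i)"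
    by (simp add: sum_distrib_left sum_negf ac_simps)
  moreover have "of_int (a ^ (m - 1)) * (of_int (c m) * x ^ m) = y ^ m"
    using False unfolding y_def a_def by (cases m) (auto simp: power_mult_distrib ac_simps)
  moreover have "- of_int (c i * a ^ (m - 1)) * x ^ i = of_int (- c i * a ^ (m - 1 - i)) * v i" if "i < m" for i
  proof -
    have "a ^ (m - 1) = a ^ (m - 1 - i) * a ^ i" using that by (simp flip: power_add)
    then show ?thesis unfolding v_def y_def a_def by (simp add: power_mult_distrib ac_simps)
  qed
  ultimately have ym: "y ^ m = (\<Sum>i<m. of_int (- c i * a ^ (m - 1 - i)) * v i)"
    by (metis (no_types, lifting) lessThan_iff sum.cong)
  have "algebraic_int y"
  proof (rule algebraic_int_if_zspan_stable[of "{..<m}" 0 v])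
    fix s assume s: "s \<in> {..<m}"
    show "y * v s \<in> zspan v {..<m}"
    proof (cases "Suc s < m")
      case True then show ?thesis using B[OF True] unfolding v_def by simp
    next
      case False
      then have "Suc s = m" using s by simp
      then have "y * v s = y ^ m" unfolding v_def by auto
      also have "\<dots> \<in> zspan v {..<m}" unfolding ym using B by (intro zspan_sum zspan_int_mult) auto
      finally show ?thesis .
    qed
  qed (use False in \<open>auto simp: v_def\<close>)
  then show ?thesis unfolding y_def .
qed

section \<open>Arithmetic of a number field and of its ring of integers\<close>

locale nf =
  fixes E :: "complex set"
  assumes number_field: "number_field E"
begin

abbreviation ints (\<open>\<O>\<close>) where "\<O> \<equiv> integers_of E"

lemma subfield: "subfield E complex_ring" and finite_dim: "CR.finite_dimension \<rat> E"
  using number_field unfolding number_field_def by auto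

lemmas subring = subfieldE(1)[OF subfield]

lemma E_zero [simp]: "0 \<in> E" and E_one [simp]: "1 \<in> E"
  and E_add: "x \<in> E \<Longrightarrow> y \<in> E \<Longrightarrow> x + y \<in> E"
  and E_mult: "x \<in> E \<Longrightarrow> y \<in> E \<Longrightarrow> x * y \<in> E"
  and E_uminus: "x \<in> E \<Longrightarrow> - x \<in> E"
  using subringE[OF subring] by auto

lemma E_diff: "x \<in> E \<Longrightarrow> y \<in> E \<Longrightarrow> x - y \<in> E"
  using E_add[of x "- y"] E_uminus[of y] by simp

lemma E_inverse: "x \<in> E \<Longrightarrow> inverse x \<in> E"
  using CR.subfield_m_inv(1)[OF subfield, of x] by (cases "x = 0") (auto simp: complex_ring_m_inv)

lemma E_divide: "x \<in> E \<Longrightarrow> y \<in> E \<Longrightarrow> x / y \<in> E"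
  by (simp add: divide_inverse E_mult E_inverse)

lemma E_power: "x \<in> E \<Longrightarrow> x ^ k \<in> E"
  by (induction k) (auto intro: E_mult)

lemma E_of_nat [simp]: "of_nat k \<in> E"
  by (induction k) (auto intro: E_add)

lemma E_of_int [simp]: "of_int k \<in> E"
  using E_of_nat[of "nat k"] E_uminus[OF E_of_nat[of "nat (- k)"]] by (cases "k \<ge> 0") auto

lemma E_sum: "(\<And>i. i \<in> S \<Longrightarrow> f i \<in> E) \<Longrightarrow> sum f S \<in> E"
  by (induction S rule: infinite_finite_induct) (auto intro: E_add)

lemma O_E: "x \<in> \<O> \<Longrightarrow> x \<in> E" and O_int: "x \<in> \<O> \<Longrightarrow> algebraic_int x"
  unfolding integers_of_def by auto

lemma O_I: "x \<in> E \<Longrightarrow> algebraic_int x \<Longrightarrow> x \<in> \<O>"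
  unfolding integers_of_def by auto

lemma O_zero [simp]: "0 \<in> \<O>" and O_one [simp]: "1 \<in> \<O>" and O_of_int [simp]: "of_int k \<in> \<O>"
  by (auto intro!: O_I int_imp_algebraic_int)

lemma O_add: "x \<in> \<O> \<Longrightarrow> y \<in> \<O> \<Longrightarrow> x + y \<in> \<O>"
  and O_mult: "x \<in> \<O> \<Longrightarrow> y \<in> \<O> \<Longrightarrow> x * y \<in> \<O>"
  and O_uminus: "x \<in> \<O> \<Longrightarrow> - x \<in> \<O>"
  and O_diff: "x \<in> \<O> \<Longrightarrow> y \<in> \<O> \<Longrightarrow> x - y \<in> \<O>"
  by (auto intro!: O_I dest: O_E O_int intro: E_add E_mult E_uminus E_diff)

lemma O_power: "x \<in> \<O> \<Longrightarrow> x ^ k \<in> \<O>"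
  by (induction k) (auto intro: O_mult)

lemma O_sum: "(\<And>i. i \<in> S \<Longrightarrow> f i \<in> \<O>) \<Longrightarrow> sum f S \<in> \<O>"
  by (induction S rule: infinite_finite_induct) (auto intro: O_add)

lemma integral_multiple:
  assumes "x \<in> E"
  obtains m :: int where "m \<noteq> 0" "of_int m * x \<in> \<O>"
proof -
  obtain n where n: "CR.dimension n \<rat> E" using finite_dim by (auto simp: CR.finite_dimension_def)
  obtain c :: "nat \<Rightarrow> int" where c: "\<exists>i<Suc n. c i \<noteq> 0" "(\<Sum>i<Suc n. of_int (c i) * x ^ i) = 0"
    using integer_dependence[OF n, of "Suc n" "\<lambda>i. x ^ i"] E_power[OF assms] by blast
  \<comment> \<open>The highest power of x that really occurs in a relation between 1, x, ..., x^n;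
    its coefficient clears the denominator of x.\<close>
  define m where "m = (GREATEST i. i < Suc n \<and> c i \<noteq> 0)"
  have m: "m < Suc n \<and> c m \<noteq> 0" unfolding m_def
    by (rule GreatestI_ex_nat[where b = "Suc n"]) (use c(1) in auto)
  have mx: "i \<le> m" if "i < Suc n" "c i \<noteq> 0" for i
    unfolding m_def by (rule Greatest_le_nat[where b = "Suc n"]) (use that in auto)
  have "(\<Sum>i\<le>m. of_int (c i) * x ^ i) = (\<Sum>i<Suc n. of_int (c i) * x ^ i)"
    using m mx by (intro sum.mono_neutral_left) force+
  then have "algebraic_int (of_int (c m) * x)"
    using algebraic_int_multiple_of_root[of c x m] c(2) m by simp
  then show ?thesis using that[of "c m"] m assms by (simp add: O_I E_mult)
qed

lemma divides_integer:
  assumes "x \<in> \<O>" "x \<noteq> 0"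
  obtains y and m :: int where "y \<in> \<O>" "m > 0" "x * y = of_int m"
proof -
  obtain m :: int where m: "m \<noteq> 0" "of_int m * inverse x \<in> \<O>"
    using integral_multiple[OF E_inverse[OF O_E[OF assms(1)]]] .
  \<comment> \<open>The sign makes x y the positive integer |m|.\<close>
  define y where "y = of_int (sgn m) * (of_int m * inverse x)"
  show ?thesis
  proof (rule that)
    show "y \<in> \<O>" unfolding y_def by (rule O_mult[OF O_of_int m(2)])
    show "\<bar>m\<bar> > 0" using m by simp
    show "x * y = of_int \<bar>m\<bar>" unfolding y_def using assms(2)
      by (simp add: abs_sgn field_simps)
  qed
qed

section \<open>Finiteness of the residue rings\<close>

text \<open>A family that is independent modulo \<open>q\<close> is independent over \<open>\<rat>\<close>, by infinite descent on the
  power of \<open>q\<close> dividing the coefficients of a relation.\<close>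

lemma residues_mod_prime_finite:
  fixes q :: int
  assumes q: "Factorial_Ring.prime q"
  obtains S where "finite S" "S \<subseteq> \<O>" "\<And>x. x \<in> \<O> \<Longrightarrow> \<exists>s\<in>S. \<exists>y\<in>\<O>. x = s + of_int q * y"
proof -
  obtain n where n: "CR.dimension n \<rat> E" using finite_dim by (auto simp: CR.finite_dimension_def)
  define indep where "indep = (\<lambda>(e :: nat \<Rightarrow> complex) k.
    (\<forall>i<k. e i \<in> \<O>) \<and> (\<forall>c :: nat \<Rightarrow> int. (\<exists>y\<in>\<O>. (\<Sum>i<k. of_int (c i) * e i) = of_int q * y) \<longrightarrow> (\<forall>i<k. q dvd c i)))"
  have q1: "q > 1" using q by (simp add: prime_gt_1_int)
  have indO: "e i \<in> \<O>" if "indep e k" "i < k" for e k i using that unfolding indep_def by blast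
  have indD: "\<forall>i<k. q dvd c i"
    if "indep e k" "y \<in> \<O>" "(\<Sum>i<k. of_int (c i) * e i) = of_int q * y" for e k y and c :: "nat \<Rightarrow> int"
    using that unfolding indep_def by blast
  have bound: "k \<le> n" if ind: "indep e k" for e k
  proof (rule ccontr)
    assume "\<not> k \<le> n"
    then have nk: "n < k" by simp
    have eE: "e i \<in> E" if "i < k" for i using indO[OF ind that] by (rule O_E)
    obtain c :: "nat \<Rightarrow> int" where c: "\<exists>i<k. c i \<noteq> 0" "(\<Sum>i<k. of_int (c i) * e i) = 0"
      by (rule integer_dependence[OF n, of k e], erule eE, rule nk, rule that)
    have desc: "\<forall>i<k. q ^ t dvd c i" if "(\<Sum>i<k. of_int (c i) * e i) = 0" for t and c :: "nat \<Rightarrow> int"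
      using that
    proof (induction t arbitrary: c)
      case (Suc t)
      have "\<forall>i<k. q dvd c i"
        using indD[OF ind, of 0 c] Suc.prems by simp
      then obtain d where d: "\<And>i. i < k \<Longrightarrow> c i = q * d i" unfolding dvd_def by metis
      have "of_int q * (\<Sum>i<k. of_int (d i) * e i) = (\<Sum>i<k. of_int (c i) * e i)"
        unfolding sum_distrib_left by (intro sum.cong) (auto simp: d)
      then have "(\<Sum>i<k. of_int (d i) * e i) = 0" using Suc.prems q1 by auto
      then show ?case using Suc.IH[of d] d by auto
    qed auto
    obtain i where i: "i < k" "c i \<noteq> 0" using c(1) by blast
    \<comment> \<open>Every power of q divides the nonzero number c i. The exponent t = |c i|
      already gives a contradiction, because q^t >= 2^t > t.\<close>
    have "q ^ nat \<bar>c i\<bar> \<le> \<bar>c i\<bar>" 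
      using dvd_imp_le_int[OF i(2), of "q ^ nat \<bar>c i\<bar>"] desc[OF c(2)] i(1) q1 by simp
    moreover have "int (nat \<bar>c i\<bar>) < q ^ nat \<bar>c i\<bar>"
      using of_nat_less_two_power[of "nat \<bar>c i\<bar>", where 'a = int] power_mono[of 2 q "nat \<bar>c i\<bar>"] q1 by linarith
    ultimately show False by simp
  qed
  have ex: "\<exists>e. indep e 0" unfolding indep_def by auto
  \<comment> \<open>A longest family that is independent modulo q; lengths are bounded by the degree
    of E. It spans \<O> modulo q, and combinations with coefficients in 0, ..., q - 1 are the
    representatives collected in S.\<close>
  define k where "k = (GREATEST k. \<exists>e. indep e k)"
  have "\<exists>e. indep e k" unfolding k_def
    by (rule GreatestI_nat[where b = n and k = 0]) (use ex bound in auto)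
  then obtain e where e: "indep e k" by blast
  have kmax: "k' \<le> k" if "indep e' k'" for e' k'
    unfolding k_def by (rule Greatest_le_nat[where b = n]) (use that bound in auto)
  define S where "S = (\<lambda>r. \<Sum>i<k. of_int (r i) * e i) ` ({..<k} \<rightarrow>\<^sub>E {0..<q})"
  have eO: "e i \<in> \<O>" if "i < k" for i using indO[OF e that] .
  show ?thesis
  proof (rule that[of S])
    show "finite S" unfolding S_def by (intro finite_imageI finite_PiE finite_lessThan) simp
    show "S \<subseteq> \<O>" unfolding S_def by (intro image_subsetI O_sum O_mult eO O_of_int) simp
    fix x assume x: "x \<in> \<O>"
    define e' where "e' = e(k := x)"
    \<comment> \<open>By maximality x satisfies a relation modulo q with the members of e. Its
      coefficient c k is prime to q, since otherwise e itself would be dependent modulo q, and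
      Bezout solves the relation for x.\<close>
    have "\<not> indep e' (Suc k)" using kmax[of e' "Suc k"] by auto
    moreover have "\<forall>i<Suc k. e' i \<in> \<O>" unfolding e'_def using eO x by (auto simp: less_Suc_eq)
    ultimately obtain c :: "nat \<Rightarrow> int" and y i where c: "y \<in> \<O>"
      "(\<Sum>i<Suc k. of_int (c i) * e' i) = of_int q * y" "i < Suc k" "\<not> q dvd c i"
      unfolding indep_def by blast
    have rel: "(\<Sum>i<k. of_int (c i) * e i) + of_int (c k) * x = of_int q * y"
      using c(2) unfolding e'_def by simp
    have "\<not> q dvd c k"
    proof
      assume "q dvd c k"
      then obtain d where "c k = q * d" by blast
      then have "(\<Sum>i<k. of_int (c i) * e i) = of_int q * (y - of_int d * x)"
        using rel by (simp add: algebra_simps)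
      moreover have "y - of_int d * x \<in> \<O>" using c(1) x by (intro O_diff O_mult) auto
      ultimately have "\<forall>i<k. q dvd c i" using indD[OF e] by blast
      then show False using c(3,4) \<open>q dvd c k\<close> by (auto simp: less_Suc_eq)
    qed
    then have "coprime (c k) q" using q by (simp add: prime_imp_coprime_int coprime_commute)
    then obtain u w where uw: "u * c k + w * q = 1"
      by (metis bezout_int coprime_imp_gcd_eq_1)
    define r where "r = (\<lambda>i\<in>{..<k}. (- u * c i) mod q)"
    define t where "t = (\<lambda>i. (- u * c i) div q)"
    have rt: "- u * c i = r i + q * t i" if "i < k" for i using that unfolding r_def t_def by simp
    define z where "z = (\<Sum>i<k. of_int (t i) * e i) + of_int u * y + of_int w * x"
    have "of_int (u * c k + w * q) * x = of_int u * (of_int (c k) * x) + of_int q * (of_int w * x)"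
      by (simp add: algebra_simps)
    also have "of_int (c k) * x = of_int q * y - (\<Sum>i<k. of_int (c i) * e i)"
      using rel by (simp add: algebra_simps)
    also have "of_int u * \<dots> = (\<Sum>i<k. of_int (- u * c i) * e i) + of_int q * (of_int u * y)"
      by (simp add: right_diff_distrib sum_distrib_left sum_negf algebra_simps)
    also have "(\<Sum>i<k. of_int (- u * c i) * e i) = (\<Sum>i<k. of_int (r i) * e i + of_int q * (of_int (t i) * e i))"
      by (intro sum.cong refl, subst rt) (auto simp: algebra_simps)
    also have "\<dots> = (\<Sum>i<k. of_int (r i) * e i) + of_int q * (\<Sum>i<k. of_int (t i) * e i)"
      by (simp add: sum.distrib sum_distrib_left)
    also have "\<dots> + of_int q * (of_int u * y) + of_int q * (of_int w * x) =
        (\<Sum>i<k. of_int (r i) * e i) + of_int q * z"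
      unfolding z_def by (simp add: algebra_simps)
    finally have "x = (\<Sum>i<k. of_int (r i) * e i) + of_int q * z"
      unfolding uw by simp
    moreover have "(\<Sum>i<k. of_int (r i) * e i) \<in> S"
      unfolding S_def r_def using q1 by (intro imageI) (auto simp: PiE_iff extensional_def)
    moreover have "z \<in> \<O>" unfolding z_def using c(1) x by (intro O_add O_sum O_mult eO) auto
    ultimately show "\<exists>s\<in>S. \<exists>y\<in>\<O>. x = s + of_int q * y" by blast
  qed
qed

text \<open>For m = q m' the sums s + q s', with s a representative modulo q and s' one modulo m',
  represent all classes modulo m. A finite covering set is all that the pigeonhole arguments ask
  for.\<close>

lemma residues_finite:
  fixes m :: nat
  assumes "m > 0"
  shows "\<exists>S. finite S \<and> S \<subseteq> \<O> \<and> (\<forall>x\<in>\<O>. \<exists>s\<in>S. \<exists>y\<in>\<O>. x = s + of_nat m * y)"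
  using assms
proof (induction m rule: less_induct)
  case (less m)
  show ?case
  proof (cases "m = 1")
    case True
    then show ?thesis by (intro exI[of _ "{0}"]) auto
  next
    case False
    then obtain q where q: "Factorial_Ring.prime q" "q dvd m" using prime_factor_nat by blast
    then obtain m' where m': "m = q * m'" by blast
    have "m' < m" "m' > 0" using m' less.prems prime_gt_1_nat[OF q(1)] by auto
    then obtain S' where S': "finite S'" "S' \<subseteq> \<O>" "\<And>x. x \<in> \<O> \<Longrightarrow> \<exists>s\<in>S'. \<exists>y\<in>\<O>. x = s + of_nat m' * y"
      using less.IH by meson
    obtain S where S: "finite S" "S \<subseteq> \<O>" "\<And>x. x \<in> \<O> \<Longrightarrow> \<exists>s\<in>S. \<exists>y\<in>\<O>. x = s + of_int (int q) * y"
      using residues_mod_prime_finite[of "int q"] q(1) by auto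
    define T where "T = (\<lambda>(s,s'). s + of_nat q * s') ` (S \<times> S')"
    have O_nat: "of_nat k \<in> \<O>" for k using O_of_int[of "int k"] by simp
    show ?thesis
    proof (intro exI[of _ T] conjI ballI)
      show "finite T" unfolding T_def using S S' by auto
      show "T \<subseteq> \<O>" unfolding T_def using S(2) S'(2) O_nat by (auto intro!: O_add O_mult)
      fix x assume "x \<in> \<O>"
      then obtain s y where y: "s \<in> S" "y \<in> \<O>" "x = s + of_nat q * y" using S(3) by fastforce
      then obtain s' z where z: "s' \<in> S'" "z \<in> \<O>" "y = s' + of_nat m' * z" using S'(3) by blast
      have "x = (s + of_nat q * s') + of_nat m * z" using y z m' by (simp add: algebra_simps)
      moreover have "s + of_nat q * s' \<in> T" unfolding T_def using y z by force
      ultimately show "\<exists>s\<in>T. \<exists>y\<in>\<O>. x = s + of_nat m * y" using z by blast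
    qed
  qed
qed

end

section \<open>Fractional ideals\<close>

abbreviation imul :: "complex set \<Rightarrow> complex set \<Rightarrow> complex set" (infixl \<open>\<star>\<close> 70) where
  "A \<star> B \<equiv> ideal_prod complex_ring A B"

lemma imulI: "a \<in> A \<Longrightarrow> b \<in> B \<Longrightarrow> a * b \<in> A \<star> B"
  using ideal_prod.prod[of a A b B complex_ring] by simp

lemma imul_add: "x \<in> A \<star> B \<Longrightarrow> y \<in> A \<star> B \<Longrightarrow> x + y \<in> A \<star> B"
  using ideal_prod.sum[of x complex_ring A B y] by simp

text \<open>\<open>ideal_prod\<close> is generated by products and sums alone, hence only these two
  closure conditions.\<close>

lemma imul_least:
  assumes "\<And>a b. a \<in> A \<Longrightarrow> b \<in> B \<Longrightarrow> a * b \<in> C" "\<And>x y. x \<in> C \<Longrightarrow> y \<in> C \<Longrightarrow> x + y \<in> C"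
  shows "A \<star> B \<subseteq> C"
proof
  fix x assume "x \<in> A \<star> B"
  then show "x \<in> C" by (induction rule: ideal_prod.induct) (use assms in auto)
qed

lemma imul_mono: "A \<subseteq> A' \<Longrightarrow> B \<subseteq> B' \<Longrightarrow> A \<star> B \<subseteq> A' \<star> B'"
  by (rule imul_least) (auto intro: imulI imul_add)

lemma imul_commute: "A \<star> B = B \<star> A"
proof -
  have "A \<star> B \<subseteq> B \<star> A" for A B
    by (rule imul_least) (auto intro: imul_add simp: mult.commute[of _ "_ :: complex"] imulI, metis imulI mult.commute)
  then show ?thesis by blast
qed

lemma imul_assoc: "(A \<star> B) \<star> C = A \<star> (B \<star> C)"
proof -
  have 1: "(A \<star> B) \<star> C \<subseteq> A \<star> (B \<star> C)" for A B C
  proof (rule imul_least)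
    fix x c assume "x \<in> A \<star> B" and c: "c \<in> C"
    have "A \<star> B \<subseteq> {x. x * c \<in> A \<star> (B \<star> C)}"
    proof (rule imul_least)
      fix a b assume "a \<in> A" "b \<in> B"
      then have "a * (b * c) \<in> A \<star> (B \<star> C)" using c by (intro imulI)
      then show "a * b \<in> {x. x * c \<in> A \<star> (B \<star> C)}" by (simp add: mult.assoc)
    qed (auto simp: distrib_right intro: imul_add)
    then show "x * c \<in> A \<star> (B \<star> C)" using \<open>x \<in> A \<star> B\<close> by blast
  qed (rule imul_add)
  have "A \<star> (B \<star> C) = (C \<star> B) \<star> A" by (simp only: imul_commute)
  also have "\<dots> \<subseteq> C \<star> (B \<star> A)" by (rule 1)
  also have "\<dots> = (A \<star> B) \<star> C" by (simp only: imul_commute)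
  finally show ?thesis using 1[of A B C] by blast
qed

context nf
begin

text \<open>An \<O>-submodule of the complex numbers; closure under negation follows from -1 in
  \<O>.\<close>

definition omod :: "complex set \<Rightarrow> bool" where
  "omod A \<longleftrightarrow> 0 \<in> A \<and> (\<forall>x\<in>A. \<forall>y\<in>A. x + y \<in> A) \<and> (\<forall>r\<in>\<O>. \<forall>x\<in>A. r * x \<in> A)"

text \<open>An intrinsic form of membership in \<open>fractional_ideals\<close>: a common
  denominator replaces the presentation as a multiple of an integral ideal. The agreement is
  \<open>fractional_ideals_iff\<close>.\<close>

definition is_frac :: "complex set \<Rightarrow> bool" where
  "is_frac A \<longleftrightarrow> omod A \<and> A \<noteq> {0} \<and> A \<subseteq> E \<and> (\<exists>d\<in>\<O>. d \<noteq> 0 \<and> (\<forall>x\<in>A. d * x \<in> \<O>))"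

definition iideal :: "complex set \<Rightarrow> bool" where
  "iideal I \<longleftrightarrow> omod I \<and> I \<subseteq> \<O> \<and> I \<noteq> {0}"

lemma omod_zero: "omod A \<Longrightarrow> 0 \<in> A"
  and omod_add: "omod A \<Longrightarrow> x \<in> A \<Longrightarrow> y \<in> A \<Longrightarrow> x + y \<in> A"
  and omod_mult: "omod A \<Longrightarrow> r \<in> \<O> \<Longrightarrow> x \<in> A \<Longrightarrow> r * x \<in> A"
  unfolding omod_def by auto

lemma omod_uminus: "omod A \<Longrightarrow> x \<in> A \<Longrightarrow> - x \<in> A"
  using omod_mult[of A "-1" x] O_uminus[OF O_one] by simp

lemma omod_diff: "omod A \<Longrightarrow> x \<in> A \<Longrightarrow> y \<in> A \<Longrightarrow> x - y \<in> A"
  using omod_add[of A x "- y"] omod_uminus[of A y] by simp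

lemma omod_sum: "omod A \<Longrightarrow> (\<And>i. i \<in> S \<Longrightarrow> f i \<in> A) \<Longrightarrow> sum f S \<in> A"
  by (induction S rule: infinite_finite_induct) (auto intro: omod_add omod_zero)

lemma omod_O: "omod \<O>"
  unfolding omod_def by (auto intro: O_add O_mult)

lemma omod_imul: "omod A \<Longrightarrow> b \<in> B \<Longrightarrow> omod (A \<star> B)"
  unfolding omod_def
proof (intro conjI ballI, goal_cases)
  case 1
  then show ?case using imulI[of 0 A b B] by simp
next
  case (2 x y)
  then show ?case by (rule_tac imul_add)
next
  case (3 r x)
  have "A \<star> B \<subseteq> {x. r * x \<in> A \<star> B}"
  proof (rule imul_least)
    fix a b assume "a \<in> A" "b \<in> B"
    then have "(r * a) * b \<in> A \<star> B" using 3 by (intro imulI) auto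
    then show "a * b \<in> {x. r * x \<in> A \<star> B}" by (simp add: mult.assoc)
  qed (auto simp: distrib_left intro: imul_add)
  then show ?case using 3 by blast
qed

lemma imul_O: "omod A \<Longrightarrow> A \<star> \<O> = A"
proof
  assume A: "omod A"
  show "A \<star> \<O> \<subseteq> A"
    by (rule imul_least) (use A in \<open>auto intro: omod_add omod_mult simp: mult.commute[of _ "_::complex"]\<close>,
      metis omod_mult mult.commute)
  show "A \<subseteq> A \<star> \<O>" using imulI[of _ A 1 \<O>] by auto
qed

lemma omod_nonzero: "omod A \<Longrightarrow> A \<noteq> {0} \<Longrightarrow> \<exists>x\<in>A. x \<noteq> 0"
  using omod_zero by blast

lemma omod_eq_O_iff: "omod I \<Longrightarrow> I \<subseteq> \<O> \<Longrightarrow> I = \<O> \<longleftrightarrow> 1 \<in> I"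
  using omod_mult[of I _ 1] by auto

lemma fracD: assumes "is_frac A" shows "omod A" "A \<subseteq> E" "A \<noteq> {0}" "A \<noteq> {}"
  using assms unfolding is_frac_def omod_def by auto

lemma iideal_frac: "iideal I \<longleftrightarrow> is_frac I \<and> I \<subseteq> \<O>"
  unfolding iideal_def is_frac_def by (auto intro: O_E intro!: bexI[of _ 1])

lemma iidealD: assumes "iideal I" shows "omod I" "I \<subseteq> \<O>" "I \<noteq> {0}" "is_frac I"
  using assms unfolding iideal_frac by (auto dest: fracD)

lemma iideal_O: "iideal \<O>"
  unfolding iideal_def using omod_O O_one by (metis order_refl singletonD zero_neq_one)

lemma frac_O: "is_frac \<O>"
  using iideal_O by (simp add: iideal_frac)

lemma frac_imul:
  assumes A: "is_frac A" and B: "is_frac B" shows "is_frac (A \<star> B)"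
proof -
  obtain a b where ab: "a \<in> A" "b \<in> B" "a \<noteq> 0" "b \<noteq> 0"
    using omod_nonzero fracD[OF A] fracD[OF B] by meson
  obtain d where d: "d \<in> \<O>" "d \<noteq> 0" "\<forall>x\<in>A. d * x \<in> \<O>" using A unfolding is_frac_def by blast
  obtain e where e: "e \<in> \<O>" "e \<noteq> 0" "\<forall>x\<in>B. e * x \<in> \<O>" using B unfolding is_frac_def by blast
  have "A \<star> B \<subseteq> {x\<in>E. d * e * x \<in> \<O>}"
  proof (rule imul_least)
    fix a b assume *: "a \<in> A" "b \<in> B"
    have "(d * a) * (e * b) \<in> \<O>" by (rule O_mult) (use * d e in auto)
    moreover have "a * b \<in> E" using * fracD(2)[OF A] fracD(2)[OF B] by (intro E_mult) auto
    ultimately show "a * b \<in> {x\<in>E. d * e * x \<in> \<O>}" by (simp add: ac_simps)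
  qed (auto simp: distrib_left intro: O_add E_add)
  moreover have "A \<star> B \<noteq> {0}" using imulI[OF ab(1,2)] ab(3,4) by (metis mult_eq_0_iff singletonD)
  moreover have "d * e \<in> \<O>" "d * e \<noteq> 0" using d e by (auto intro: O_mult)
  moreover have "omod (A \<star> B)" by (rule omod_imul[OF fracD(1)[OF A] ab(2)])
  ultimately show ?thesis
    unfolding is_frac_def by (intro conjI bexI[of _ "d * e"]) auto
qed

lemma frac_scale:
  assumes "omod I" "I \<subseteq> \<O>" "I \<noteq> {0}" "a \<in> E" "a \<noteq> 0"
  shows "is_frac ((\<lambda>x. a * x) ` I)"
proof -
  obtain m :: int where m: "m \<noteq> 0" "of_int m * a \<in> \<O>" using integral_multiple[OF assms(4)] .
  have "omod ((\<lambda>x. a * x) ` I)" unfolding omod_def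
  proof (intro conjI ballI)
    show "0 \<in> (\<lambda>x. a * x) ` I" using omod_zero[OF assms(1)] by force
    fix x y assume "x \<in> (\<lambda>x. a * x) ` I" "y \<in> (\<lambda>x. a * x) ` I"
    then show "x + y \<in> (\<lambda>x. a * x) ` I"
      using omod_add[OF assms(1)] by (force simp: distrib_left[symmetric])
  next
    fix r x assume "r \<in> \<O>" "x \<in> (\<lambda>x. a * x) ` I"
    then show "r * x \<in> (\<lambda>x. a * x) ` I"
      using omod_mult[OF assms(1)] by (force simp: mult.left_commute)
  qed
  moreover have "(\<lambda>x. a * x) ` I \<noteq> {0}"
    using omod_nonzero[OF assms(1,3)] assms(5) by (metis image_eqI mult_eq_0_iff singletonD)
  moreover have "(\<lambda>x. a * x) ` I \<subseteq> E" using assms(2,4) by (auto intro: E_mult dest: O_E)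
  moreover have "\<forall>x\<in>(\<lambda>x. a * x) ` I. of_int m * x \<in> \<O>"
    using m(2) assms(2) by (auto simp: mult.assoc[symmetric] intro: O_mult)
  ultimately show ?thesis unfolding is_frac_def using m(1) by (intro conjI bexI[of _ "of_int m"]) auto
qed

section \<open>Comparison with the ideals and prime ideals of \<open>integer_ring\<close>\<close>

lemma subring_O: "subring \<O> complex_ring"
  by (rule CR.subringI) (auto intro: O_add O_mult O_uminus)

lemma ring_integer_ring: "ring (integer_ring E)"
  unfolding integer_ring_def by (rule CR.subring_is_ring[OF subring_O])

lemma cring_integer_ring: "cring (integer_ring E)"
  unfolding integer_ring_def using CR.subcring_iff[of \<O>] CR.subcringI[OF subring_O] by (auto simp: mult.commute)

lemma integer_ring_simps [simp]:
  "carrier (integer_ring E) = \<O>" "x \<otimes>\<^bsub>integer_ring E\<^esub> y = x * y" "x \<oplus>\<^bsub>integer_ring E\<^esub> y = x + y"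
  "\<one>\<^bsub>integer_ring E\<^esub> = 1" "\<zero>\<^bsub>integer_ring E\<^esub> = 0"
  by (simp_all add: integer_ring_def)

lemma ideal_integer_ring_iff: "ideal I (integer_ring E) \<longleftrightarrow> omod I \<and> I \<subseteq> \<O>"
proof
  assume "ideal I (integer_ring E)"
  then interpret ideal I "integer_ring E" .
  show "omod I \<and> I \<subseteq> \<O>"
    using additive_subgroup.a_closed[OF additive_subgroup_axioms]
      additive_subgroup.zero_closed[OF additive_subgroup_axioms] I_l_closed a_subset
    unfolding omod_def by simp
next
  assume I: "omod I \<and> I \<subseteq> \<O>"
  interpret R: ring "integer_ring E" by (rule ring_integer_ring)
  have neg: "\<ominus>\<^bsub>integer_ring E\<^esub> x = - x" if "x \<in> \<O>" for x
    using R.minus_equality[of "- x" x] that O_uminus[OF that] by simp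
  show "ideal I (integer_ring E)"
  proof (rule idealI[OF ring_integer_ring])
    show "subgroup I (add_monoid (integer_ring E))"
      by (rule R.add.subgroupI)
        (use I neg omod_zero omod_add omod_uminus in \<open>auto simp flip: a_inv_def\<close>)
  next
    fix a x assume "a \<in> I" "x \<in> carrier (integer_ring E)"
    then have "x * a \<in> I" using I omod_mult[of I x a] by simp
    then show "x \<otimes>\<^bsub>integer_ring E\<^esub> a \<in> I" "a \<otimes>\<^bsub>integer_ring E\<^esub> x \<in> I" by (simp_all add: mult.commute)
  qed
qed

lemma fractional_ideals_iff: "A \<in> fractional_ideals E \<longleftrightarrow> is_frac A"
proof
  assume "A \<in> fractional_ideals E"
  then show "is_frac A" unfolding fractional_ideals_def using frac_scale by (auto simp: ideal_integer_ring_iff)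
next
  assume A: "is_frac A"
  then obtain d where d: "d \<in> \<O>" "d \<noteq> 0" "\<forall>x\<in>A. d * x \<in> \<O>" unfolding is_frac_def by blast
  define I where "I = (\<lambda>x. d * x) ` A"
  have "omod I" unfolding omod_def
  proof (intro conjI ballI)
    show "0 \<in> I" unfolding I_def using omod_zero fracD(1)[OF A] by force
    fix x y assume "x \<in> I" "y \<in> I"
    then show "x + y \<in> I" unfolding I_def
      using omod_add fracD(1)[OF A] by (force simp: distrib_left[symmetric])
  next
    fix r x assume "r \<in> \<O>" "x \<in> I"
    then show "r * x \<in> I" unfolding I_def
      using omod_mult fracD(1)[OF A] by (force simp: mult.left_commute)
  qed
  moreover have "I \<subseteq> \<O>" unfolding I_def using d by auto
  moreover have "I \<noteq> {0}"
    unfolding I_def using omod_nonzero[OF fracD(1,3)[OF A]] d(2) by (metis image_eqI mult_eq_0_iff singletonD)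
  moreover have "A = (\<lambda>x. inverse d * x) ` I"
    unfolding I_def image_image using d(2) by (simp flip: mult.assoc)
  ultimately show "A \<in> fractional_ideals E"
    unfolding fractional_ideals_def ideal_integer_ring_iff using d E_inverse[OF O_E[OF d(1)]]
    by (intro CollectI exI[of _ "inverse d"] exI[of _ I]) auto
qed

lemma prime_ideals_iff:
  "P \<in> prime_ideals E \<longleftrightarrow> iideal P \<and> 1 \<notin> P \<and> (\<forall>a\<in>\<O>. \<forall>b\<in>\<O>. a * b \<in> P \<longrightarrow> a \<in> P \<or> b \<in> P)"
proof
  assume P: "P \<in> prime_ideals E"
  then interpret primeideal P "integer_ring E" unfolding prime_ideals_def by simp
  have "omod P \<and> P \<subseteq> \<O>" using is_ideal ideal_integer_ring_iff by simp
  then show "iideal P \<and> 1 \<notin> P \<and> (\<forall>a\<in>\<O>. \<forall>b\<in>\<O>. a * b \<in> P \<longrightarrow> a \<in> P \<or> b \<in> P)"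
    using P I_notcarr I_prime omod_eq_O_iff[of P] unfolding iideal_def prime_ideals_def by auto
next
  assume P: "iideal P \<and> 1 \<notin> P \<and> (\<forall>a\<in>\<O>. \<forall>b\<in>\<O>. a * b \<in> P \<longrightarrow> a \<in> P \<or> b \<in> P)"
  have "primeideal P (integer_ring E)"
    by (rule primeidealI[OF _ cring_integer_ring]) (use P iidealD in \<open>auto simp: ideal_integer_ring_iff\<close>)
  then show "P \<in> prime_ideals E" using P unfolding prime_ideals_def iideal_def by simp
qed

lemma primeD:
  assumes "P \<in> prime_ideals E"
  shows "iideal P" "1 \<notin> P" "a \<in> \<O> \<Longrightarrow> b \<in> \<O> \<Longrightarrow> a * b \<in> P \<Longrightarrow> a \<in> P \<or> b \<in> P"
  using assms prime_ideals_iff by auto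

section \<open>Consequences of finiteness: integral closedness, chain condition, maximality of
  primes\<close>

lemma iideal_contains_nat:
  assumes "iideal I"
  obtains m :: nat where "m > 0" "of_nat m \<in> I"
proof -
  obtain x where x: "x \<in> I" "x \<noteq> 0" using omod_nonzero iidealD[OF assms] by blast
  then have "x \<in> \<O>" using iidealD(2)[OF assms] by blast
  then obtain y and m :: int where y: "y \<in> \<O>" "m > 0" "x * y = of_int m"
    using divides_integer x(2) by metis
  then have "of_int m \<in> I" using omod_mult[OF iidealD(1)[OF assms] y(1) x(1)] by (simp add: mult.commute)
  then show ?thesis using that[of "nat m"] y(2) by simp
qed

text \<open>Infinitely many indices meet finitely many classes modulo m. With powers in place of f
  this replaces Cayley-Hamilton in \<open>mult_stable_integral\<close> and the theorem on finite
  integral domains in \<open>prime_maximal\<close>.\<close>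

lemma residue_pigeonhole:
  fixes f :: "nat \<Rightarrow> complex"
  assumes "m > (0::nat)" "\<And>k. f k \<in> \<O>"
  obtains j k y where "j < k" "y \<in> \<O>" "f k - f j = of_nat m * y"
proof -
  obtain S where S: "finite S" "\<And>x. x \<in> \<O> \<Longrightarrow> \<exists>s\<in>S. \<exists>y\<in>\<O>. x = s + of_nat m * y"
    using residues_finite[OF assms(1)] by blast
  have "\<forall>k. \<exists>s y. s \<in> S \<and> y \<in> \<O> \<and> f k = s + of_nat m * y" using S(2)[OF assms(2)] by blast
  then obtain s y where s: "\<And>k. s k \<in> S" "\<And>k. y k \<in> \<O>" "\<And>k. f k = s k + of_nat m * y k" by metis
  have "\<not> inj s"
  proof
    assume "inj s"
    moreover have "finite (range s)" using S(1) s(1) by (meson finite_subset image_subsetI)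
    ultimately show False using finite_imageD infinite_UNIV_nat by blast
  qed
  then obtain j k where jk: "s j = s k" "j < k" unfolding inj_def by (metis linorder_neqE_nat)
  show ?thesis
    by (rule that[OF jk(2), of "y k - y j"]) (use s jk(1) in \<open>auto intro: O_diff simp: algebra_simps\<close>)
qed

text \<open>For a positive integer m in I all c^k m lie in I and hence in \<O>. Two of them are
  congruent modulo m, so that c^k - c^j is integral for some j < k, which suffices for c.\<close>

lemma mult_stable_integral:
  assumes I: "iideal I" and c: "c \<in> E" and st: "\<And>x. x \<in> I \<Longrightarrow> c * x \<in> I"
  shows "c \<in> \<O>"
proof -
  obtain m :: nat where m: "m > 0" "of_nat m \<in> I" using iideal_contains_nat[OF I] .
  have "c ^ k * of_nat m \<in> I" for k
    by (induction k) (use m(2) st in \<open>auto simp: mult.assoc\<close>)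
  then have "c ^ k * of_nat m \<in> \<O>" for k using iidealD(2)[OF I] by blast
  then obtain j k y where jk: "j < k" "y \<in> \<O>" "c ^ k * of_nat m - c ^ j * of_nat m = of_nat m * y"
    using residue_pigeonhole[OF m(1), of "\<lambda>k. c ^ k * of_nat m"] by blast
  then have "of_nat m * (c ^ k - c ^ j) = of_nat m * y" by (simp add: algebra_simps)
  then have "c ^ k - c ^ j = y" using m(1) by simp
  then have "algebraic_int c" using algebraic_int_if_power_diff[of c k j] jk O_int by blast
  then show ?thesis using c by (rule_tac O_I)
qed

text \<open>An ideal above I contains m \<O> for a positive integer m in I, so the representatives
  modulo m that belong to it determine it.\<close>

lemma finite_over:
  assumes "iideal I"
  shows "finite {J. iideal J \<and> I \<subseteq> J}"
proof -
  obtain m :: nat where m: "m > 0" "of_nat m \<in> I" using iideal_contains_nat[OF assms] .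
  obtain S where S: "finite S" "S \<subseteq> \<O>" "\<And>x. x \<in> \<O> \<Longrightarrow> \<exists>s\<in>S. \<exists>y\<in>\<O>. x = s + of_nat m * y"
    using residues_finite[OF m(1)] by blast
  have recon: "J = {s + of_nat m * y | s y. s \<in> J \<inter> S \<and> y \<in> \<O>}" if J: "iideal J" "I \<subseteq> J" for J
  proof -
    have my: "of_nat m * y \<in> J" if "y \<in> \<O>" for y :: complex
      using omod_mult[OF iidealD(1)[OF J(1)] that, of "of_nat m"] m(2) J(2) by (auto simp: mult.commute)
    show ?thesis
    proof (rule Set.set_eqI, rule iffI, goal_cases)
      case (1 x)
      then have x: "x \<in> J" .
      then obtain s y where s: "s \<in> S" "y \<in> \<O>" "x = s + of_nat m * y"
        using S(3) iidealD(2)[OF J(1)] by blast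
      then have "s \<in> J" using omod_diff[OF iidealD(1)[OF J(1)] x my[OF s(2)]] by simp
      then show "x \<in> {s + of_nat m * y | s y. s \<in> J \<inter> S \<and> y \<in> \<O>}" using s by blast
    next
      case (2 x)
      then show "x \<in> J" using my omod_add[OF iidealD(1)[OF J(1)]] by blast
    qed
  qed
  have "inj_on (\<lambda>J. J \<inter> S) {J. iideal J \<and> I \<subseteq> J}"
  proof (rule inj_onI)
    fix J J' assume "J \<in> {J. iideal J \<and> I \<subseteq> J}" "J' \<in> {J. iideal J \<and> I \<subseteq> J}" "J \<inter> S = J' \<inter> S"
    then show "J = J'" using recon[of J] recon[of J'] by simp
  qed
  moreover have "(\<lambda>J. J \<inter> S) ` {J. iideal J \<and> I \<subseteq> J} \<subseteq> Pow S" by blast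
  ultimately show ?thesis using S(1) by (meson finite_Pow_iff finite_imageD finite_subset)
qed

text \<open>The number of ideals above I is finite and drops when I grows strictly; it serves as the
  induction measure.\<close>

lemma iideal_noetherian_induct [consumes 1, case_names step]:
  assumes "iideal I"
    and step: "\<And>I. iideal I \<Longrightarrow> (\<And>J. iideal J \<Longrightarrow> I \<subset> J \<Longrightarrow> P J) \<Longrightarrow> P I"
  shows "P I"
  using assms(1)
proof (induction "card {J. iideal J \<and> I \<subseteq> J}" arbitrary: I rule: less_induct)
  case less
  show ?case
  proof (rule step[OF less.prems])
    fix J assume J: "iideal J" "I \<subset> J"
    have "{J'. iideal J' \<and> J \<subseteq> J'} \<subset> {J'. iideal J' \<and> I \<subseteq> J'}" using J less.prems by blast
    then show "P J" using less.hyps[OF psubset_card_mono[OF finite_over[OF less.prems]] J(1)] by blast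
  qed
qed

lemma iideal_adjoin:
  assumes "iideal I" "a \<in> \<O>"
  shows "iideal {r * a + x | r x. r \<in> \<O> \<and> x \<in> I}" (is "iideal ?J")
    and "a \<in> {r * a + x | r x. r \<in> \<O> \<and> x \<in> I}" and "I \<subseteq> {r * a + x | r x. r \<in> \<O> \<and> x \<in> I}"
proof -
  note I = iidealD[OF assms(1)]
  have "omod ?J" unfolding omod_def
  proof (intro conjI ballI)
    show "0 \<in> ?J" using omod_zero[OF I(1)] by (auto intro!: exI[of _ 0])
    fix x y assume "x \<in> ?J" "y \<in> ?J"
    then obtain r s u v where "x = r * a + u" "y = s * a + v" "r \<in> \<O>" "s \<in> \<O>" "u \<in> I" "v \<in> I" by blast
    then show "x + y \<in> ?J" using omod_add[OF I(1)] O_add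
      by (intro CollectI exI[of _ "r + s"] exI[of _ "u + v"]) (auto simp: algebra_simps)
  next
    fix t x assume "t \<in> \<O>" "x \<in> ?J"
    then obtain r u where "x = r * a + u" "r \<in> \<O>" "u \<in> I" by blast
    moreover have "t * (r * a + u) = (t * r) * a + t * u" by (simp add: algebra_simps)
    ultimately show "t * x \<in> ?J" using omod_mult[OF I(1) \<open>t \<in> \<O>\<close>] O_mult[OF \<open>t \<in> \<O>\<close>]
      by blast
  qed
  moreover have "?J \<subseteq> \<O>" using I(2) assms(2) by (auto intro!: O_add O_mult)
  moreover show IJ: "I \<subseteq> ?J" using O_zero by (metis (mono_tags, lifting) CollectI add_0 mult_zero_left subsetI)
  ultimately show "iideal ?J" unfolding iideal_def using omod_nonzero[OF I(1,3)] by blast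
  show "a \<in> ?J" using omod_zero[OF I(1)] by (intro CollectI exI[of _ 1] exI[of _ 0]) simp
qed

text \<open>Only finitely many proper ideals lie above I, so a maximal one exists without Zorn's
  lemma, and maximality makes it prime.\<close>

lemma iideal_in_prime:
  assumes I: "iideal I" "1 \<notin> I"
  obtains P where "P \<in> prime_ideals E" "I \<subseteq> P"
proof -
  define Ov where "Ov = {J. iideal J \<and> I \<subseteq> J \<and> 1 \<notin> J}"
  have "finite Ov" by (rule finite_subset[OF _ finite_over[OF I(1)]]) (auto simp: Ov_def)
  moreover have "I \<in> Ov" using I unfolding Ov_def by simp
  ultimately obtain P where P: "P \<in> Ov" "I \<subseteq> P" "\<forall>J\<in>Ov. P \<subseteq> J \<longrightarrow> P = J"
    using finite_has_maximal2[of Ov I] by blast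
  have "P \<in> prime_ideals E" unfolding prime_ideals_iff
  proof (intro conjI ballI impI)
    show "iideal P" "1 \<notin> P" using P(1) Ov_def by auto
    fix a b assume ab: "a \<in> \<O>" "b \<in> \<O>" "a * b \<in> P"
    show "a \<in> P \<or> b \<in> P"
    proof (rule ccontr)
      assume n: "\<not> (a \<in> P \<or> b \<in> P)"
      note J = iideal_adjoin[OF \<open>iideal P\<close> ab(1)]
      have "{r * a + x | r x. r \<in> \<O> \<and> x \<in> P} \<notin> Ov" using P(3) J n by blast
      then have "1 \<in> {r * a + x | r x. r \<in> \<O> \<and> x \<in> P}" using J P(2) unfolding Ov_def by blast
      then obtain r x where rx: "1 = r * a + x" "r \<in> \<O>" "x \<in> P" by blast
      have "b = (r * a + x) * b" using rx(1) by simp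
      also have "\<dots> = r * (a * b) + b * x" by (simp add: algebra_simps)
      also have "\<dots> \<in> P"
        using iidealD(1)[OF \<open>iideal P\<close>] rx(2,3) ab(2,3) by (simp add: omod_add omod_mult)
      finally show False using n by simp
    qed
  qed
  then show ?thesis using that P(2) by blast
qed

text \<open>For x outside P two powers of x are congruent modulo a positive integer in P, hence P
  contains x^j (x^(k-j) - 1). Primality leaves x^(k-j) congruent to 1, so x is a unit modulo P, and
  an ideal containing P and x contains 1.\<close>

lemma prime_maximal:
  assumes P: "P \<in> prime_ideals E" and J: "iideal J" "P \<subset> J"
  shows "1 \<in> J"
proof -
  note PI = primeD[OF P]
  obtain x where x: "x \<in> J" "x \<notin> P" using J(2) by blast
  have xO: "x \<in> \<O>" using x(1) iidealD(2)[OF J(1)] by blast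
  obtain m :: nat where m: "m > 0" "of_nat m \<in> P" using iideal_contains_nat[OF PI(1)] .
  obtain j k y where jk: "j < k" "y \<in> \<O>" "x ^ k - x ^ j = of_nat m * y"
    using residue_pigeonhole[OF m(1), of "\<lambda>k. x ^ k"] O_power[OF xO] by blast
  have "x ^ k = x ^ j * x ^ (k - j)" using jk(1) by (simp flip: power_add)
  then have "x ^ j * (x ^ (k - j) - 1) = y * of_nat m" using jk(3) by (simp add: algebra_simps)
  then have "x ^ j * (x ^ (k - j) - 1) \<in> P"
    using omod_mult[OF iidealD(1)[OF PI(1)] jk(2) m(2)] by simp
  moreover have "x ^ j \<notin> P" for j
    by (induction j) (use PI(2,3) x(2) xO O_power in auto)
  ultimately have "x ^ (k - j) - 1 \<in> P" 
    using PI(3)[OF O_power[OF xO] O_diff[OF O_power[OF xO] O_one]] by blast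
  then have 1: "x ^ (k - j) - 1 \<in> J" using J(2) by blast
  have "x ^ (k - j) = x ^ (k - j - 1) * x" using jk(1) by (metis Suc_diff_1 mult.commute power_Suc zero_less_diff)
  then have "x ^ (k - j) \<in> J" using omod_mult[OF iidealD(1)[OF J(1)] O_power[OF xO] x(1)] by simp
  then show ?thesis using omod_diff[OF iidealD(1)[OF J(1)] _ 1] by force
qed

text \<open>Among the ideals \<open>(a : b)\<close> inside \<open>P\<close> a maximal one is prime, hence equal to \<open>P\<close>, and \<open>b / a\<close>
  is as required.\<close>

lemma prime_inverse_nontrivial:
  assumes P: "P \<in> prime_ideals E"
  obtains c where "c \<in> E" "c \<notin> \<O>" "\<And>x. x \<in> P \<Longrightarrow> c * x \<in> \<O>"
proof -
  note PI = primeD[OF P]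
  obtain a where a: "a \<in> P" "a \<noteq> 0" using omod_nonzero iidealD[OF PI(1)] by blast
  have aO: "a \<in> \<O>" using a(1) iidealD(2)[OF PI(1)] by blast
  define Q where "Q = (\<lambda>b. {x \<in> \<O>. \<exists>y\<in>\<O>. x * b = a * y})"
  define I where "I = Q 1"
  have omQ: "omod (Q b)" for b unfolding omod_def
  proof (intro conjI ballI)
    show "0 \<in> Q b" unfolding Q_def by (auto intro!: bexI[of _ 0])
    fix x y assume "x \<in> Q b" "y \<in> Q b"
    then obtain u v where "u \<in> \<O>" "v \<in> \<O>" "x * b = a * u" "y * b = a * v" "x \<in> \<O>" "y \<in> \<O>"
      unfolding Q_def by blast
    then have "(x + y) * b = a * (u + v)" "x + y \<in> \<O>" "u + v \<in> \<O>"
      by (simp_all only: distrib_right distrib_left O_add)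
    then show "x + y \<in> Q b" unfolding Q_def by blast
  next
    fix r x assume "r \<in> \<O>" "x \<in> Q b"
    then obtain u where "u \<in> \<O>" "x * b = a * u" "x \<in> \<O>" unfolding Q_def by blast
    then have "(r * x) * b = a * (r * u)" "r * x \<in> \<O>" "r * u \<in> \<O>"
      using \<open>r \<in> \<O>\<close> by (simp_all only: mult.assoc mult.left_commute[of a] O_mult)
    then show "r * x \<in> Q b" unfolding Q_def by blast
  qed
  have aQ: "a \<in> Q b" if "b \<in> \<O>" for b using that aO unfolding Q_def by auto
  have iQ: "iideal (Q b)" if "b \<in> \<O>" for b
    unfolding iideal_def using omQ aQ[OF that] a(2) by (auto simp: Q_def)
  have I1: "x \<in> Q 1 \<Longrightarrow> x \<in> Q b" if "b \<in> \<O>" for x b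
    using that unfolding Q_def by (auto simp: mult.assoc intro: O_mult)
  \<comment> \<open>All ideals \<open>Q b\<close> with integral b contain \<open>Q 1\<close>, the
    principal ideal (a), so only finitely many occur and a maximal one exists. They are kept inside
    P so that this one can be compared with P.\<close>
  define Ov where "Ov = {J. \<exists>b\<in>\<O>. J = Q b \<and> Q b \<subseteq> P}"
  have "finite Ov"
    by (rule finite_subset[OF _ finite_over[OF iQ[OF O_one]]]) (use iQ I1 in \<open>auto simp: Ov_def\<close>)
  moreover have "Q 1 \<in> Ov" unfolding Ov_def
  proof (intro CollectI bexI conjI refl subsetI)
    fix x assume "x \<in> Q 1"
    then obtain y where "y \<in> \<O>" "x = y * a" unfolding Q_def by (auto simp: mult.commute)
    then show "x \<in> P" using omod_mult[OF iidealD(1)[OF PI(1)] _ a(1)] by simp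
  qed (simp_all add: O_one)
  ultimately obtain J where J: "J \<in> Ov" "\<forall>J'\<in>Ov. J \<subseteq> J' \<longrightarrow> J = J'"
    using finite_has_maximal[of Ov] by blast
  then obtain b where b: "b \<in> \<O>" "J = Q b" "Q b \<subseteq> P" unfolding Ov_def by blast
  have sub: "Q b \<subseteq> Q (b * s)" if "s \<in> \<O>" for s
  proof
    fix x assume "x \<in> Q b"
    then obtain y where "x \<in> \<O>" "y \<in> \<O>" "x * b = a * y" unfolding Q_def by blast
    then have "x * (b * s) = a * (y * s)" by (simp flip: mult.assoc)
    then show "x \<in> Q (b * s)" using O_mult[OF \<open>y \<in> \<O>\<close> that] \<open>x \<in> \<O>\<close> unfolding Q_def by blast
  qed
  have Qs: "x \<in> Q (b * s) \<longleftrightarrow> s * x \<in> Q b" if "s \<in> \<O>" "x \<in> \<O>" for s x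
    using that O_mult[OF that] unfolding Q_def by (auto simp: ac_simps)
  have prime: "Q b \<in> prime_ideals E" unfolding prime_ideals_iff
  proof (intro conjI ballI impI)
    show "iideal (Q b)" by (rule iQ[OF b(1)])
    show "1 \<notin> Q b" using b(3) PI(2) by blast
    fix x y assume xy: "x \<in> \<O>" "y \<in> \<O>" "x * y \<in> Q b"
    show "x \<in> Q b \<or> y \<in> Q b"
    proof (cases "Q (b * x) \<subseteq> P")
      case True
      then have "Q (b * x) \<in> Ov" unfolding Ov_def using O_mult[OF b(1) xy(1)] by blast
      then have "Q (b * x) = Q b" using J(2) b(2) sub[OF xy(1)] by blast
      then show ?thesis using Qs[OF xy(1,2)] xy(3) by blast
    next
      case False
      \<comment> \<open>Since x s lies in \<open>Q b\<close>, x lies in \<open>Q (b * s)\<close>.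
        This ideal is inside P, because s z in \<open>Q b\<close> with s outside P puts z into P; by
        maximality it equals \<open>Q b\<close>.\<close>
      then obtain s where s: "s \<in> Q (b * x)" "s \<notin> P" by blast
      then have sO: "s \<in> \<O>" unfolding Q_def by blast
      have "Q (b * s) \<subseteq> P"
      proof
        fix z assume z: "z \<in> Q (b * s)"
        then have "z \<in> \<O>" unfolding Q_def by blast
        then have "s * z \<in> P" using Qs[OF sO] z b(3) by blast
        then show "z \<in> P" using PI(3)[OF sO \<open>z \<in> \<O>\<close>] s(2) by blast
      qed
      then have "Q (b * s) \<in> Ov" unfolding Ov_def using O_mult[OF b(1) sO] by blast
      then have "Q (b * s) = Q b" using J(2) b(2) sub[OF sO] by blast
      moreover have "x \<in> Q (b * s)" using s(1) Qs[OF xy(1) sO] Qs[OF sO xy(1)] by (simp add: mult.commute)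
      ultimately show ?thesis by blast
    qed
  qed
  have "Q b = P"
    using prime_maximal[OF prime PI(1)] b(3) PI(2) by blast
  show ?thesis
  proof (rule that)
    show "b / a \<in> E" using b(1) aO by (intro E_divide O_E)
    show "b / a \<notin> \<O>"
    proof
      assume "b / a \<in> \<O>"
      then have "1 \<in> Q b" unfolding Q_def using a(2) by (auto intro!: bexI[of _ "b / a"])
      then show False using b(3) PI(2) by blast
    qed
    fix x assume "x \<in> P"
    then have "x \<in> Q b" using \<open>Q b = P\<close> by simp
    then obtain y where "y \<in> \<O>" "x * b = a * y" unfolding Q_def by blast
    then show "b / a * x \<in> \<O>" using a(2) by (simp add: field_simps)
  qed
qed

text \<open>A proper ideal I lies in a prime P. With a non-integral c such that c P is inside \<O>,
  and D = \<O> + c \<O>, the ideal I D is integral and strictly above I: equality would give c I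
  inside I and make c integral. An inverse of I D, known by induction, yields one of I, without a
  separate treatment of primes.\<close>

lemma iideal_invertible:
  assumes "iideal I"
  shows "\<exists>J. is_frac J \<and> I \<star> J = \<O>"
  using assms
proof (induction rule: iideal_noetherian_induct)
  case (step I)
  show ?case
  proof (cases "1 \<in> I")
    case True
    then have "I = \<O>" using omod_eq_O_iff iidealD[OF step.hyps] by blast
    then show ?thesis using imul_O[OF omod_O] frac_O by blast
  next
    case False
    then obtain P where P: "P \<in> prime_ideals E" "I \<subseteq> P" using iideal_in_prime step.hyps by metis
    obtain c where c: "c \<in> E" "c \<notin> \<O>" "\<And>x. x \<in> P \<Longrightarrow> c * x \<in> \<O>"
      using prime_inverse_nontrivial[OF P(1)] by metis
    note I = iidealD[OF step.hyps]
    define D where "D = {a + c * b | a b. a \<in> \<O> \<and> b \<in> \<O>}"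
    have "omod D" unfolding omod_def
    proof (intro conjI ballI)
      show "0 \<in> D" unfolding D_def by (force intro!: exI[of _ 0])
      fix x y assume "x \<in> D" "y \<in> D"
      then obtain r s u v where "x = r + c * u" "y = s + c * v" "r \<in> \<O>" "s \<in> \<O>" "u \<in> \<O>" "v \<in> \<O>"
        unfolding D_def by blast
      then show "x + y \<in> D" unfolding D_def using O_add
        by (intro CollectI exI[of _ "r + s"] exI[of _ "u + v"]) (auto simp: algebra_simps)
    next
      fix t x assume "t \<in> \<O>" "x \<in> D"
      then obtain r u where "x = r + c * u" "r \<in> \<O>" "u \<in> \<O>" unfolding D_def by blast
      moreover have "t * (r + c * u) = t * r + c * (t * u)" by (simp add: algebra_simps)
      ultimately show "t * x \<in> D" unfolding D_def using O_mult[OF \<open>t \<in> \<O>\<close>] by blast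
    qed
    obtain m :: int where m: "m \<noteq> 0" "of_int m * c \<in> \<O>" using integral_multiple[OF c(1)] .
    have 1: "1 \<in> D" unfolding D_def by (intro CollectI exI[of _ 1] exI[of _ 0]) simp
    have cD: "c \<in> D" unfolding D_def by (intro CollectI exI[of _ 0] exI[of _ 1]) simp
    have DE: "D \<subseteq> E" unfolding D_def using c(1) by (auto intro!: E_add E_mult dest: O_E)
    have mD: "\<forall>x\<in>D. of_int m * x \<in> \<O>"
    proof
      fix x assume "x \<in> D"
      then obtain a b where ab: "x = a + c * b" "a \<in> \<O>" "b \<in> \<O>" unfolding D_def by blast
      have "of_int m * a + (of_int m * c) * b \<in> \<O>"
        using O_add[OF O_mult[OF O_of_int ab(2)] O_mult[OF m(2) ab(3)]] .
      then show "of_int m * x \<in> \<O>" unfolding ab by (simp add: algebra_simps)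
    qed
    have "D \<noteq> {0}" using 1 by auto
    then have D: "is_frac D" unfolding is_frac_def using \<open>omod D\<close> DE mD m(1) by (auto intro!: bexI[of _ "of_int m"])
    have "I \<star> D \<subseteq> \<O>"
    proof (rule imul_least)
      fix x d assume "x \<in> I" "d \<in> D"
      then obtain a b where ab: "d = a + c * b" "a \<in> \<O>" "b \<in> \<O>" unfolding D_def by blast
      have "x * d = x * a + (c * x) * b" unfolding ab by (simp add: algebra_simps)
      moreover have "x \<in> \<O>" "c * x \<in> \<O>" using \<open>x \<in> I\<close> P(2) c(3) I(2) by auto
      then have "x * a + (c * x) * b \<in> \<O>" using ab(2,3) by (simp only: O_add O_mult)
      ultimately show "x * d \<in> \<O>" by simp
    qed (rule O_add)
    then have ID: "iideal (I \<star> D)" using frac_imul[OF I(4) D] by (simp add: iideal_frac)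
    have "I \<subseteq> I \<star> D" using imulI[OF _ 1, of _ I] by auto
    moreover have "I \<star> D \<noteq> I"
    proof
      assume "I \<star> D = I"
      then have "c * x \<in> I" if "x \<in> I" for x using imulI[OF that cD] by (simp add: mult.commute)
      then show False using mult_stable_integral[OF step.hyps c(1)] c(2) by blast
    qed
    ultimately obtain J where "is_frac J" "(I \<star> D) \<star> J = \<O>" using step.IH[OF ID] by blast
    then have "is_frac (D \<star> J)" "I \<star> (D \<star> J) = \<O>" using frac_imul[OF D] by (simp_all only: imul_assoc)
    then show ?thesis by blast
  qed
qed

lemma frac_invertible:
  assumes A: "is_frac A"
  obtains B where "is_frac B" "A \<star> B = \<O>"
proof -
  obtain d where d: "d \<in> \<O>" "d \<noteq> 0" "\<forall>x\<in>A. d * x \<in> \<O>" using A unfolding is_frac_def by blast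
  define D where "D = (\<lambda>x. d * x) ` \<O>"
  have D: "is_frac D" unfolding D_def
    using frac_scale[OF omod_O order_refl _ O_E[OF d(1)] d(2)] iidealD(3)[OF iideal_O] by blast
  have "A \<star> D \<subseteq> \<O>"
  proof (rule imul_least)
    fix a x assume "a \<in> A" "x \<in> D"
    then obtain r where r: "x = d * r" "r \<in> \<O>" unfolding D_def by blast
    have "(d * a) * r \<in> \<O>" by (rule O_mult) (use \<open>a \<in> A\<close> d(3) r in auto)
    then show "a * x \<in> \<O>" unfolding r by (simp add: ac_simps)
  qed (rule O_add)
  then have "iideal (A \<star> D)" using frac_imul[OF A D] by (simp add: iideal_frac)
  then obtain J where "is_frac J" "(A \<star> D) \<star> J = \<O>" using iideal_invertible by blast
  then show ?thesis using that[of "D \<star> J"] frac_imul[OF D] imul_assoc by metis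
qed

section \<open>The group of fractional ideals and divisibility\<close>

abbreviation ideals :: "complex set monoid" (\<open>\<I>\<close>) where "\<I> \<equiv> ideal_group E"

lemma ideal_group_simps [simp]:
  "carrier \<I> = Collect is_frac" "A \<otimes>\<^bsub>\<I>\<^esub> B = A \<star> B" "\<one>\<^bsub>\<I>\<^esub> = \<O>"
  unfolding ideal_group_def using fractional_ideals_iff by auto

lemma comm_group_ideals: "comm_group \<I>"
proof (rule comm_groupI)
  fix A assume "A \<in> carrier \<I>"
  then obtain B where "is_frac B" "A \<star> B = \<O>" using frac_invertible[of A] by auto
  then show "\<exists>B\<in>carrier \<I>. B \<otimes>\<^bsub>\<I>\<^esub> A = \<one>\<^bsub>\<I>\<^esub>" using imul_commute by auto
next
  fix A assume "A \<in> carrier \<I>"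
  then show "\<one>\<^bsub>\<I>\<^esub> \<otimes>\<^bsub>\<I>\<^esub> A = A" using imul_O[of A] imul_commute[of A \<O>] fracD(1)[of A] by simp
next
  fix A B assume "A \<in> carrier \<I>" "B \<in> carrier \<I>"
  show "A \<otimes>\<^bsub>\<I>\<^esub> B = B \<otimes>\<^bsub>\<I>\<^esub> A" using imul_commute by simp
qed (simp_all add: imul_assoc frac_imul frac_O)

end

lemma imul_left_commute: "A \<star> (B \<star> C) = B \<star> (A \<star> C)"
  using imul_assoc imul_commute by metis

lemmas imul_ac = imul_assoc imul_commute imul_left_commute

sublocale nf \<subseteq> G: comm_group "ideal_group E"
  by (rule comm_group_ideals)

context nf
begin

abbreviation ideal_inv :: "complex set \<Rightarrow> complex set" where "ideal_inv A \<equiv> inv\<^bsub>\<I>\<^esub> A"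

lemma frac_inv: "is_frac A \<Longrightarrow> is_frac (ideal_inv A)"
  using G.inv_closed[of A] by simp

lemma imul_inv: "is_frac A \<Longrightarrow> A \<star> ideal_inv A = \<O>" "is_frac A \<Longrightarrow> ideal_inv A \<star> A = \<O>"
  using G.r_inv[of A] G.l_inv[of A] by simp_all

lemma frac_nat_pow: "is_frac A \<Longrightarrow> is_frac (A [^]\<^bsub>\<I>\<^esub> (k::nat))"
  using G.nat_pow_closed[of A k] by simp

lemma frac_int_pow: "is_frac A \<Longrightarrow> is_frac (A [^]\<^bsub>\<I>\<^esub> (k::int))"
  using G.int_pow_closed[of A k] by simp

lemma imul_one: "is_frac A \<Longrightarrow> A \<star> \<O> = A" "is_frac A \<Longrightarrow> \<O> \<star> A = A"
  using G.r_one[of A] G.l_one[of A] by simp_all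

lemma inv_O: "ideal_inv \<O> = \<O>"
  using G.inv_one unfolding ideal_group_simps(3) .

lemma imul_cancel: "is_frac A \<Longrightarrow> is_frac B \<Longrightarrow> is_frac C \<Longrightarrow> A \<star> B = A \<star> C \<Longrightarrow> B = C"
  using G.l_cancel[of A B C] by simp

lemma imul_inv_cancel: "is_frac A \<Longrightarrow> is_frac B \<Longrightarrow> A \<star> B \<star> ideal_inv B = A"
  using imul_assoc imul_inv(1) imul_one(1) by simp

lemma imul_inv_cancel': "is_frac A \<Longrightarrow> is_frac B \<Longrightarrow> A \<star> ideal_inv B \<star> B = A"
  using imul_assoc imul_inv(2) imul_one(1) by simp

lemma iideal_imul: "iideal I \<Longrightarrow> iideal J \<Longrightarrow> iideal (I \<star> J)"
  using frac_imul imul_mono[of I \<O> J \<O>] imul_O[OF omod_O] unfolding iideal_frac by auto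

lemma imul_subset: "iideal I \<Longrightarrow> iideal J \<Longrightarrow> I \<star> J \<subseteq> I"
  using imul_mono[of I I J \<O>] imul_O[of I] iidealD by auto

lemma iideal_divide: "is_frac A \<Longrightarrow> is_frac B \<Longrightarrow> A \<subseteq> B \<Longrightarrow> iideal (A \<star> ideal_inv B)"
  using imul_mono[of A B "ideal_inv B" "ideal_inv B"] imul_inv(1)[of B] frac_imul frac_inv
  unfolding iideal_frac by auto

text \<open>J is the principal ideal of a common denominator. Facts on valuations of fractional
  ideals are reduced in this way to integral ones.\<close>

lemma frac_fraction:
  assumes A: "is_frac A"
  obtains I J where "iideal I" "iideal J" "A \<star> J = I"
proof -
  obtain d where d: "d \<in> \<O>" "d \<noteq> 0" "\<forall>x\<in>A. d * x \<in> \<O>" using A unfolding is_frac_def by blast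
  define D where "D = (\<lambda>x. d * x) ` \<O>"
  have D: "is_frac D" unfolding D_def
    using frac_scale[OF omod_O order_refl _ O_E[OF d(1)] d(2)] iidealD(3)[OF iideal_O] by blast
  moreover have "D \<subseteq> \<O>" unfolding D_def using O_mult[OF d(1)] by blast
  ultimately have "iideal D" by (simp add: iideal_frac)
  have "A \<star> D \<subseteq> \<O>"
  proof (rule imul_least)
    fix a x assume "a \<in> A" "x \<in> D"
    then obtain r where r: "x = d * r" "r \<in> \<O>" unfolding D_def by blast
    have "(d * a) * r \<in> \<O>" by (rule O_mult) (use \<open>a \<in> A\<close> d(3) r in auto)
    then show "a * x \<in> \<O>" unfolding r by (simp add: ac_simps)
  qed (rule O_add)
  then have "iideal (A \<star> D)" using frac_imul[OF A D] by (simp add: iideal_frac)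
  then show ?thesis using that \<open>iideal D\<close> by blast
qed

lemma prime_frac: "P \<in> prime_ideals E \<Longrightarrow> is_frac P"
  using primeD(1) iidealD(4) by blast

lemma prime_imul:
  assumes P: "P \<in> prime_ideals E" and IJ: "iideal I" "iideal J" "I \<star> J \<subseteq> P"
  shows "I \<subseteq> P \<or> J \<subseteq> P"
proof (rule ccontr)
  assume "\<not> (I \<subseteq> P \<or> J \<subseteq> P)"
  then obtain a b where ab: "a \<in> I" "a \<notin> P" "b \<in> J" "b \<notin> P" by blast
  then have "a * b \<in> P" using imulI[OF ab(1,3)] IJ(3) by blast
  then show False using primeD(3)[OF P, of a b] ab iidealD(2)[OF IJ(1)] iidealD(2)[OF IJ(2)] by blast
qed

lemma prime_not_O: "P \<in> prime_ideals E \<Longrightarrow> \<not> \<O> \<subseteq> P"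
  using primeD(2) O_one by blast

lemma prime_subset_eq: "P \<in> prime_ideals E \<Longrightarrow> Q \<in> prime_ideals E \<Longrightarrow> P \<subseteq> Q \<Longrightarrow> P = Q"
  using prime_maximal[of P Q] primeD by blast

subsection \<open>Valuations\<close>

text \<open>The units of the localization at \<open>P\<close>, on the level of ideals.\<close>

definition coprime_to :: "complex set \<Rightarrow> complex set \<Rightarrow> bool" where
  "coprime_to P U \<longleftrightarrow> is_frac U \<and> (\<exists>I J. iideal I \<and> iideal J \<and> \<not> I \<subseteq> P \<and> \<not> J \<subseteq> P \<and> U \<star> J = I)"

text \<open>The exponent of P in A is read off from A = P^k U with U a unit at P, so that additivity
  needs no full prime factorization. Existence of k is \<open>val_decomp\<close>, uniqueness is
  \<open>val_unique\<close>.\<close>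

definition val :: "complex set \<Rightarrow> complex set \<Rightarrow> int" where
  "val P A = (THE k. \<exists>U. coprime_to P U \<and> A = P [^]\<^bsub>\<I>\<^esub> k \<star> U)"

lemma coprime_frac: "coprime_to P U \<Longrightarrow> is_frac U"
  unfolding coprime_to_def by blast

lemma coprime_iideal: "P \<in> prime_ideals E \<Longrightarrow> iideal I \<Longrightarrow> \<not> I \<subseteq> P \<Longrightarrow> coprime_to P I"
  unfolding coprime_to_def
  using iidealD(4)[of I] iideal_O prime_not_O[of P] imul_one(1)[of I]
  by (intro conjI exI[of _ I] exI[of _ \<O>]) simp_all

lemma coprime_imul:
  assumes P: "P \<in> prime_ideals E" and U: "coprime_to P U" and V: "coprime_to P V"
  shows "coprime_to P (U \<star> V)"
proof -
  obtain I J where 1: "iideal I" "iideal J" "\<not> I \<subseteq> P" "\<not> J \<subseteq> P" "U \<star> J = I"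
    using U unfolding coprime_to_def by blast
  obtain I' J' where 2: "iideal I'" "iideal J'" "\<not> I' \<subseteq> P" "\<not> J' \<subseteq> P" "V \<star> J' = I'"
    using V unfolding coprime_to_def by blast
  have "(U \<star> V) \<star> (J \<star> J') = (U \<star> J) \<star> (V \<star> J')"
    by (simp only: imul_ac)
  then have "(U \<star> V) \<star> (J \<star> J') = I \<star> I'" using 1(5) 2(5) by simp
  moreover have "\<not> I \<star> I' \<subseteq> P" "\<not> J \<star> J' \<subseteq> P"
    using prime_imul[OF P 1(1) 2(1)] prime_imul[OF P 1(2) 2(2)] 1(3,4) 2(3,4) by blast+
  ultimately show ?thesis
    unfolding coprime_to_def using frac_imul[OF coprime_frac[OF U] coprime_frac[OF V]]
      iideal_imul[OF 1(1) 2(1)] iideal_imul[OF 1(2) 2(2)] by blast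
qed

lemma coprime_inv:
  assumes U: "coprime_to P U" shows "coprime_to P (ideal_inv U)"
proof -
  obtain I J where 1: "iideal I" "iideal J" "\<not> I \<subseteq> P" "\<not> J \<subseteq> P" "U \<star> J = I"
    using U unfolding coprime_to_def by blast
  have "ideal_inv U \<star> I = (ideal_inv U \<star> U) \<star> J" using 1(5) by (simp add: imul_assoc)
  also have "\<dots> = J" using imul_inv(2) imul_one(2) coprime_frac[OF U] iidealD(4)[OF 1(2)] by simp
  finally show ?thesis unfolding coprime_to_def using 1 frac_inv[OF coprime_frac[OF U]] by blast
qed

lemma pow_subset_prime:
  assumes P: "P \<in> prime_ideals E" and k: "k > 0"
  shows "P [^]\<^bsub>\<I>\<^esub> (k::nat) \<subseteq> P" "iideal (P [^]\<^bsub>\<I>\<^esub> (k::nat))"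
proof -
  have I: "iideal (P [^]\<^bsub>\<I>\<^esub> (j::nat))" for j
    by (induction j) (use iideal_O iideal_imul primeD(1)[OF P] in simp_all)
  obtain j where "k = Suc j" using k gr0_implies_Suc by blast
  then have "P [^]\<^bsub>\<I>\<^esub> k = P \<star> (P [^]\<^bsub>\<I>\<^esub> j)" using imul_commute by simp
  then show "P [^]\<^bsub>\<I>\<^esub> k \<subseteq> P" using imul_subset[OF primeD(1)[OF P] I[of j]] by simp
  show "iideal (P [^]\<^bsub>\<I>\<^esub> k)" by (rule I)
qed

lemma coprime_pow_nonpos:
  assumes P: "P \<in> prime_ideals E" and U: "coprime_to P (P [^]\<^bsub>\<I>\<^esub> (k::nat))"
  shows "k = 0"
proof (rule ccontr)
  assume "k \<noteq> 0"
  then have k: "k > 0" by simp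
  obtain I J where 1: "iideal I" "iideal J" "\<not> I \<subseteq> P" "\<not> J \<subseteq> P" "P [^]\<^bsub>\<I>\<^esub> k \<star> J = I"
    using U unfolding coprime_to_def by blast
  then show False using imul_subset[OF pow_subset_prime(2)[OF P k] 1(2)] pow_subset_prime(1)[OF P k] by blast
qed

text \<open>Only l \<le> k is proved, and applied twice. If l = k + m with m > 0, cancellation makes
  P^m a unit at P, although it is contained in P.\<close>

lemma val_unique:
  assumes P: "P \<in> prime_ideals E" and U: "coprime_to P U" and V: "coprime_to P V"
    and eq: "P [^]\<^bsub>\<I>\<^esub> (k::int) \<star> U = P [^]\<^bsub>\<I>\<^esub> (l::int) \<star> V"
  shows "k = l"
proof -
  have le: "l \<le> k" if U: "coprime_to P U" and V: "coprime_to P V"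
    and eq: "P [^]\<^bsub>\<I>\<^esub> (k::int) \<star> U = P [^]\<^bsub>\<I>\<^esub> (l::int) \<star> V" for k l U V
  proof (rule ccontr)
    assume "\<not> l \<le> k"
    then obtain m where "l - k = int m" using nonneg_int_cases[of "l - k"] by auto
    then have lk: "l = k + int m" "m \<noteq> 0" using \<open>\<not> l \<le> k\<close> by auto
    have fr: "is_frac P" "is_frac U" "is_frac V" "is_frac (P [^]\<^bsub>\<I>\<^esub> k)" "is_frac (P [^]\<^bsub>\<I>\<^esub> m)"
      using prime_frac[OF P] coprime_frac U V frac_int_pow frac_nat_pow by auto
    have "P [^]\<^bsub>\<I>\<^esub> l = P [^]\<^bsub>\<I>\<^esub> k \<star> P [^]\<^bsub>\<I>\<^esub> m"
      using G.int_pow_mult[of P k "int m"] fr(1) lk(1) by (simp add: int_pow_int)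
    then have "P [^]\<^bsub>\<I>\<^esub> k \<star> U = P [^]\<^bsub>\<I>\<^esub> k \<star> (P [^]\<^bsub>\<I>\<^esub> m \<star> V)"
      using eq by (simp add: imul_assoc)
    then have "U = P [^]\<^bsub>\<I>\<^esub> m \<star> V" using imul_cancel fr frac_imul by blast
    then have "U \<star> ideal_inv V = P [^]\<^bsub>\<I>\<^esub> m" using imul_inv_cancel fr by simp
    then have "coprime_to P (P [^]\<^bsub>\<I>\<^esub> m)" using coprime_imul[OF P U coprime_inv[OF V]] by simp
    then show False using coprime_pow_nonpos[OF P] lk(2) by blast
  qed
  show ?thesis using le[OF U V eq] le[OF V U eq[symmetric]] by simp
qed

lemma val_eqI:
  assumes "P \<in> prime_ideals E" "coprime_to P U" "A = P [^]\<^bsub>\<I>\<^esub> (k::int) \<star> U"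
  shows "val P A = k"
  unfolding val_def using assms val_unique[OF assms(1)] by (intro the_equality) blast+

text \<open>As long as I lies in P, division by P gives a strictly larger integral ideal, so
  noetherian induction counts the exponent.\<close>

lemma iideal_prime_power_decomp:
  assumes P: "P \<in> prime_ideals E" and I: "iideal I"
  shows "\<exists>(k::nat) U. coprime_to P U \<and> I = P [^]\<^bsub>\<I>\<^esub> k \<star> U"
  using I
proof (induction rule: iideal_noetherian_induct)
  case (step I)
  note fr = prime_frac[OF P] iidealD(4)[OF step.hyps]
  show ?case
  proof (cases "I \<subseteq> P")
    case False
    then show ?thesis using coprime_iideal[OF P step.hyps] imul_one(2)[OF fr(2)]
      by (intro exI[of _ "0::nat"] exI[of _ I]) simp
  next
    case True
    define J where "J = I \<star> ideal_inv P"
    have J: "iideal J" unfolding J_def by (rule iideal_divide[OF fr(2,1) True])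
    have JI: "J \<star> P = I" unfolding J_def by (rule imul_inv_cancel'[OF fr(2,1)])
    have "I \<subseteq> J" using imul_subset[OF J primeD(1)[OF P]] JI by simp
    moreover have "I \<noteq> J"
    proof
      assume "I = J"
      then have "I \<star> P = I \<star> \<O>" using JI imul_one(1)[OF fr(2)] by simp
      then have "P = \<O>" using imul_cancel[OF fr(2,1) frac_O] by simp
      then show False using prime_not_O[OF P] by simp
    qed
    ultimately obtain k U where U: "coprime_to P U" "J = P [^]\<^bsub>\<I>\<^esub> (k::nat) \<star> U"
      using step.IH[OF J] by blast
    have "I = P [^]\<^bsub>\<I>\<^esub> Suc k \<star> U"
      unfolding JI[symmetric] U(2) G.nat_pow_Suc ideal_group_simps(2) by (simp only: imul_ac)
    then show ?thesis using U(1) by blast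
  qed
qed

lemma val_decomp:
  assumes P: "P \<in> prime_ideals E" and A: "is_frac A"
  obtains U where "coprime_to P U" "A = P [^]\<^bsub>\<I>\<^esub> val P A \<star> U"
proof -
  obtain I J where IJ: "iideal I" "iideal J" "A \<star> J = I" using frac_fraction[OF A] .
  obtain k U where U: "coprime_to P U" "I = P [^]\<^bsub>\<I>\<^esub> (k::nat) \<star> U"
    using iideal_prime_power_decomp[OF P IJ(1)] by blast
  obtain l V where V: "coprime_to P V" "J = P [^]\<^bsub>\<I>\<^esub> (l::nat) \<star> V"
    using iideal_prime_power_decomp[OF P IJ(2)] by blast
  note fr = prime_frac[OF P] coprime_frac[OF U(1)] coprime_frac[OF V(1)]
  have "A = I \<star> ideal_inv J" using IJ(3) imul_inv_cancel[OF A iidealD(4)[OF IJ(2)]] by simp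
  also have "\<dots> = (P [^]\<^bsub>\<I>\<^esub> k \<star> U) \<star> (ideal_inv (P [^]\<^bsub>\<I>\<^esub> l) \<star> ideal_inv V)"
    unfolding U(2) V(2) using G.inv_mult[of "P [^]\<^bsub>\<I>\<^esub> l" V] frac_nat_pow fr by simp
  also have "\<dots> = (P [^]\<^bsub>\<I>\<^esub> k \<star> ideal_inv (P [^]\<^bsub>\<I>\<^esub> l)) \<star> (U \<star> ideal_inv V)"
    by (simp only: imul_ac)
  also have "P [^]\<^bsub>\<I>\<^esub> k \<star> ideal_inv (P [^]\<^bsub>\<I>\<^esub> l) = P [^]\<^bsub>\<I>\<^esub> (int k - int l)"
    using G.int_pow_diff[of P "int k" "int l"] fr(1) by (simp add: int_pow_int)
  finally have "A = P [^]\<^bsub>\<I>\<^esub> (int k - int l) \<star> (U \<star> ideal_inv V)" .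
  moreover have "coprime_to P (U \<star> ideal_inv V)" by (rule coprime_imul[OF P U(1) coprime_inv[OF V(1)]])
  ultimately show ?thesis using val_eqI[OF P] that by metis
qed

lemma val_imul:
  assumes P: "P \<in> prime_ideals E" and A: "is_frac A" and B: "is_frac B"
  shows "val P (A \<star> B) = val P A + val P B"
proof -
  obtain U where U: "coprime_to P U" "A = P [^]\<^bsub>\<I>\<^esub> val P A \<star> U" using val_decomp[OF P A] .
  obtain V where V: "coprime_to P V" "B = P [^]\<^bsub>\<I>\<^esub> val P B \<star> V" using val_decomp[OF P B] .
  define a b where "a = P [^]\<^bsub>\<I>\<^esub> val P A" and "b = P [^]\<^bsub>\<I>\<^esub> val P B"
  have "A \<star> B = (a \<star> U) \<star> (b \<star> V)" using U(2) V(2) unfolding a_def b_def by simp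
  also have "\<dots> = (a \<star> b) \<star> (U \<star> V)" by (simp only: imul_ac)
  also have "a \<star> b = P [^]\<^bsub>\<I>\<^esub> (val P A + val P B)"
    unfolding a_def b_def using G.int_pow_mult[of P "val P A" "val P B"] prime_frac[OF P] by simp
  finally show ?thesis by (rule val_eqI[OF P coprime_imul[OF P U(1) V(1)]])
qed

lemma val_coprime: "P \<in> prime_ideals E \<Longrightarrow> coprime_to P U \<Longrightarrow> val P U = 0"
  by (rule val_eqI[of P U]) (simp_all add: imul_one coprime_frac)

lemma val_O: "P \<in> prime_ideals E \<Longrightarrow> val P \<O> = 0"
  using val_coprime coprime_iideal iideal_O prime_not_O by blast

lemma val_inv: "P \<in> prime_ideals E \<Longrightarrow> is_frac A \<Longrightarrow> val P (ideal_inv A) = - val P A"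
  using val_imul[of P A "ideal_inv A"] frac_inv imul_inv(1) val_O by simp

lemma val_nat_pow: "P \<in> prime_ideals E \<Longrightarrow> is_frac A \<Longrightarrow> val P (A [^]\<^bsub>\<I>\<^esub> (k::nat)) = int k * val P A"
  by (induction k) (simp_all add: val_O val_imul frac_nat_pow algebra_simps)

lemma val_int_pow:
  assumes "P \<in> prime_ideals E" "is_frac A"
  shows "val P (A [^]\<^bsub>\<I>\<^esub> (k::int)) = k * val P A"
proof (cases "k \<ge> 0")
  case True
  then show ?thesis using val_nat_pow[OF assms, of "nat k"] int_pow_int[of \<I> A "nat k"] by simp
next
  case False
  define m where "m = nat (- k)"
  then have m: "k = - int m" using False by simp
  have "A [^]\<^bsub>\<I>\<^esub> k = ideal_inv (A [^]\<^bsub>\<I>\<^esub> m)"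
    using G.int_pow_neg_int[of A m] assms(2) m by simp
  then show ?thesis using val_inv[OF assms(1) frac_nat_pow[OF assms(2)]] val_nat_pow[OF assms] m by simp
qed

lemma val_self: "P \<in> prime_ideals E \<Longrightarrow> val P P = 1"
  by (rule val_eqI[of P \<O>]) (simp_all add: coprime_iideal iideal_O prime_not_O imul_one prime_frac)

lemma val_iideal_eq_0: "P \<in> prime_ideals E \<Longrightarrow> iideal I \<Longrightarrow> \<not> I \<subseteq> P \<Longrightarrow> val P I = 0"
  using val_coprime coprime_iideal by blast

lemma val_other_prime: "P \<in> prime_ideals E \<Longrightarrow> Q \<in> prime_ideals E \<Longrightarrow> P \<noteq> Q \<Longrightarrow> val P Q = 0"
  using val_iideal_eq_0 prime_subset_eq primeD(1) by blast

lemma val_nonneg: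
  assumes P: "P \<in> prime_ideals E" and I: "iideal I" shows "val P I \<ge> 0"
proof -
  obtain k U where "coprime_to P U" "I = P [^]\<^bsub>\<I>\<^esub> (k::nat) \<star> U"
    using iideal_prime_power_decomp[OF P I] by blast
  then have "val P I = int k" by (intro val_eqI[OF P]) (simp_all add: int_pow_int)
  then show ?thesis by simp
qed

lemma val_pos:
  assumes P: "P \<in> prime_ideals E" and I: "iideal I" and "I \<subseteq> P" shows "val P I > 0"
proof -
  have "iideal (I \<star> ideal_inv P)" by (rule iideal_divide) (use assms prime_frac iidealD in auto)
  then have "val P (I \<star> ideal_inv P) \<ge> 0" by (rule val_nonneg[OF P])
  then show ?thesis
    using val_imul[OF P iidealD(4)[OF I] frac_inv[OF prime_frac[OF P]]] val_inv[OF P prime_frac[OF P]] val_self[OF P]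
    by simp
qed

lemma val_pos_iff: "P \<in> prime_ideals E \<Longrightarrow> iideal I \<Longrightarrow> val P I > 0 \<longleftrightarrow> I \<subseteq> P"
  using val_pos val_iideal_eq_0 by fastforce

text \<open>While the remaining valuation is positive the ideal lies in P and can be divided once
  more. For an extended prime this supplies the integral cofactor to which the chain bound is
  applied.\<close>

lemma iideal_divide_prime_power:
  assumes P: "P \<in> prime_ideals E" and I: "iideal I" and k: "int k \<le> val P I"
  shows "iideal (I \<star> ideal_inv (P [^]\<^bsub>\<I>\<^esub> k))"
  using k
proof (induction k)
  case 0
  then show ?case using I imul_one(1) iidealD(4) inv_O by simp
next
  case (Suc k)
  define J where "J = I \<star> ideal_inv (P [^]\<^bsub>\<I>\<^esub> k)"
  note fr = prime_frac[OF P] frac_nat_pow[OF prime_frac[OF P]] iidealD(4)[OF I]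
  have J: "iideal J" using Suc unfolding J_def by simp
  have "val P J = val P I - int k"
    unfolding J_def using val_imul val_inv val_nat_pow val_self P fr frac_inv by simp
  then have "J \<subseteq> P" using val_pos_iff[OF P J] Suc.prems by simp
  then have "iideal (J \<star> ideal_inv P)" by (rule iideal_divide[OF iidealD(4)[OF J] fr(1)])
  moreover have "J \<star> ideal_inv P = I \<star> ideal_inv (P [^]\<^bsub>\<I>\<^esub> Suc k)"
    unfolding J_def using G.inv_mult[of "P [^]\<^bsub>\<I>\<^esub> k" P] fr by (simp add: imul_assoc)
  ultimately show ?case by simp
qed

text \<open>Positive valuation detects containment in a prime, so a prime above J is also above I;
  both are divided by it. This is the part of unique factorization that the sequel relies
  on.\<close>

lemma iideal_eq_if_val_eq:
  assumes "iideal J" "iideal I" "\<And>P. P \<in> prime_ideals E \<Longrightarrow> val P I = val P J"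
  shows "I = J"
  using assms
proof (induction arbitrary: I rule: iideal_noetherian_induct)
  case (step J)
  show ?case
  proof (cases "1 \<in> J")
    case True
    then have J: "J = \<O>" using omod_eq_O_iff iidealD[OF step.hyps] by blast
    have "1 \<in> I"
    proof (rule ccontr)
      assume "1 \<notin> I"
      then obtain P where "P \<in> prime_ideals E" "I \<subseteq> P" using iideal_in_prime step.prems(1) by metis
      then show False using val_pos[of P I] step.prems(1,2) val_O J by fastforce
    qed
    then show ?thesis using J omod_eq_O_iff iidealD[OF step.prems(1)] by blast
  next
    case False
    then obtain P where P: "P \<in> prime_ideals E" "J \<subseteq> P" using iideal_in_prime step.hyps by metis
    then have "val P I > 0" using val_pos[OF P(1) step.hyps P(2)] step.prems(2)[OF P(1)] by simp
    then have IP: "I \<subseteq> P" using val_pos_iff[OF P(1) step.prems(1)] by simp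
    note fr = prime_frac[OF P(1)] iidealD(4)[OF step.hyps] iidealD(4)[OF step.prems(1)]
    define J' where "J' = J \<star> ideal_inv P"
    define I' where "I' = I \<star> ideal_inv P"
    have J': "iideal J'" "J' \<star> P = J" unfolding J'_def
      using iideal_divide[OF fr(2,1) P(2)] imul_inv_cancel'[OF fr(2,1)] by auto
    have I': "iideal I'" "I' \<star> P = I" unfolding I'_def
      using iideal_divide[OF fr(3,1) IP] imul_inv_cancel'[OF fr(3,1)] by auto
    have "J \<subseteq> J'" using imul_subset[OF J'(1) primeD(1)[OF P(1)]] J'(2) by simp
    moreover have "J \<noteq> J'"
    proof
      assume "J = J'"
      then have "val P J = val P J + val P P" using val_imul[OF P(1) iidealD(4)[OF J'(1)] fr(1)] J'(2) by simp
      then show False using val_self[OF P(1)] by simp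
    qed
    ultimately have "J \<subset> J'" by blast
    moreover have "val Q I' = val Q J'" if "Q \<in> prime_ideals E" for Q
      unfolding I'_def J'_def using step.prems(2)[OF that] val_imul[OF that] fr frac_inv by simp
    ultimately have "I' = J'" using step.IH[OF J'(1)] I'(1) by blast
    then show ?thesis using I'(2) J'(2) by simp
  qed
qed

lemma frac_eq_O_if_val_0:
  assumes A: "is_frac A" and "\<And>P. P \<in> prime_ideals E \<Longrightarrow> val P A = 0"
  shows "A = \<O>"
proof -
  obtain I J where IJ: "iideal I" "iideal J" "A \<star> J = I" using frac_fraction[OF A] .
  have "val P I = val P J" if "P \<in> prime_ideals E" for P
    using val_imul[OF that A iidealD(4)[OF IJ(2)]] IJ(3) assms(2)[OF that] by simp
  then have "I = J" by (rule iideal_eq_if_val_eq[OF IJ(2,1)])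
  then have "J \<star> A = J \<star> \<O>" using IJ(3) imul_one(1)[OF iidealD(4)[OF IJ(2)]] imul_commute by metis
  then show ?thesis using imul_cancel[OF iidealD(4)[OF IJ(2)] A frac_O] by simp
qed

lemma finite_val_support:
  assumes A: "is_frac A" shows "finite {P \<in> prime_ideals E. val P A \<noteq> 0}"
proof -
  have fin: "finite {P \<in> prime_ideals E. val P I \<noteq> 0}" if "iideal I" for I
  proof (rule finite_subset[OF _ finite_over[OF that]])
    show "{P \<in> prime_ideals E. val P I \<noteq> 0} \<subseteq> {J. iideal J \<and> I \<subseteq> J}"
      using val_iideal_eq_0[OF _ that] primeD(1) by blast
  qed
  obtain I J where IJ: "iideal I" "iideal J" "A \<star> J = I" using frac_fraction[OF A] .
  have "val P I = val P A + val P J" if "P \<in> prime_ideals E" for P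
    using val_imul[OF that A iidealD(4)[OF IJ(2)]] IJ(3) by simp
  then have "{P \<in> prime_ideals E. val P A \<noteq> 0} \<subseteq>
      {P \<in> prime_ideals E. val P I \<noteq> 0} \<union> {P \<in> prime_ideals E. val P J \<noteq> 0}" by force
  then show ?thesis using fin[OF IJ(1)] fin[OF IJ(2)] by (meson finite_UnI finite_subset)
qed

text \<open>Ideals have no torsion, by valuations; this closes the induction in
  \<open>DD_generated\<close>.\<close>

lemma ideal_pow_eq_O:
  assumes "is_frac A" "A [^]\<^bsub>\<I>\<^esub> (k::nat) = \<O>" "k > 0"
  shows "A = \<O>"
proof (rule frac_eq_O_if_val_0[OF assms(1)])
  fix P assume P: "P \<in> prime_ideals E"
  show "val P A = 0" using val_nat_pow[OF P assms(1), of k] assms(2,3) val_O[OF P] by simp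
qed

end

section \<open>Extension of ideals\<close>

context nf
begin

lemma imul_psubset:
  assumes "iideal A" "iideal B" "B \<noteq> \<O>" shows "A \<star> B \<subset> A"
proof -
  have "A \<star> B \<noteq> A \<star> \<O>" using imul_cancel[of A B \<O>] assms iidealD(4) frac_O by blast
  then show ?thesis using imul_subset[OF assms(1,2)] imul_one(1)[OF iidealD(4)[OF assms(1)]] by auto
qed

lemma iideal_pow: "iideal A \<Longrightarrow> iideal (A [^]\<^bsub>\<I>\<^esub> (k::nat))"
  by (induction k) (simp_all add: iideal_O iideal_imul)

lemma prime_ne_O: "P \<in> prime_ideals E \<Longrightarrow> P \<noteq> \<O>"
  using prime_not_O by blast

end

locale nf_ext = B: nf K + T: nf E for K E +
  assumes K_sub_E: "K \<subseteq> E"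
begin

abbreviation "OK \<equiv> integers_of K"
abbreviation "OE \<equiv> integers_of E"
abbreviation "ext \<equiv> extend_ideal E"
abbreviation "below P \<equiv> P \<inter> integers_of K"

lemma OK_sub_OE: "x \<in> OK \<Longrightarrow> x \<in> OE"
  using K_sub_E unfolding integers_of_def by auto

lemma OE_K: "x \<in> OE \<Longrightarrow> x \<in> K \<Longrightarrow> x \<in> OK"
  unfolding integers_of_def by auto

lemma ext_eq: "ext A = A \<star> OE"
  unfolding extend_ideal_def ..

lemma ext_imul: "ext (A \<star> C) = ext A \<star> ext C"
proof -
  have "ext (A \<star> C) = (A \<star> C) \<star> (OE \<star> OE)" unfolding ext_eq by (simp only: T.imul_O[OF T.omod_O])
  then show ?thesis unfolding ext_eq by (simp only: imul_ac)
qed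

lemma ext_sub: "A \<subseteq> ext A"
  unfolding ext_eq using imulI[of _ A 1 OE] by auto

lemma ext_least: "T.omod B \<Longrightarrow> A \<subseteq> B \<Longrightarrow> ext A \<subseteq> B"
  unfolding ext_eq using imul_mono[of A B OE OE] T.imul_O[of B] by blast

lemma ext_subset_iff: "T.omod B \<Longrightarrow> ext A \<subseteq> B \<longleftrightarrow> A \<subseteq> B"
  using ext_least ext_sub by blast

lemma ext_OK: "ext OK = OE"
  using ext_least[OF T.omod_O, of OK] OK_sub_OE imulI[of 1 OK _ OE] unfolding ext_eq by force

lemma ext_frac:
  assumes A: "B.is_frac A" shows "T.is_frac (ext A)"
proof -
  obtain a where a: "a \<in> A" "a \<noteq> 0" using B.omod_nonzero B.fracD[OF A] by blast
  obtain d where d: "d \<in> OK" "d \<noteq> 0" "\<forall>x\<in>A. d * x \<in> OK" using A unfolding B.is_frac_def by blast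
  have "ext A \<subseteq> {x\<in>E. d * x \<in> OE}" unfolding ext_eq
  proof (rule imul_least)
    fix x y assume xy: "x \<in> A" "y \<in> OE"
    have "x * y \<in> E" using xy B.fracD(2)[OF A] K_sub_E T.O_E T.E_mult by blast
    moreover have "(d * x) * y \<in> OE" using xy d(3) OK_sub_OE T.O_mult by blast
    ultimately show "x * y \<in> {x\<in>E. d * x \<in> OE}" by (simp add: mult.assoc)
  next
    fix x y assume "x \<in> {x\<in>E. d * x \<in> OE}" "y \<in> {x\<in>E. d * x \<in> OE}"
    then show "x + y \<in> {x\<in>E. d * x \<in> OE}" using T.O_add T.E_add by (simp add: distrib_left)
  qed
  moreover have "T.omod (ext A)" unfolding ext_eq using T.omod_imul[OF T.omod_O a(1)] imul_commute by simp
  moreover have "ext A \<noteq> {0}" using ext_sub[of A] a by blast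
  ultimately show ?thesis unfolding T.is_frac_def using d(1,2) OK_sub_OE by blast
qed

lemma ext_iideal: "B.iideal A \<Longrightarrow> T.iideal (ext A)"
  using ext_frac ext_least[OF T.omod_O] OK_sub_OE unfolding B.iideal_frac T.iideal_frac by blast

lemma ext_hom: "ext \<in> hom (ideal_group K) (ideal_group E)"
  using ext_frac ext_imul by (auto simp: hom_def)

sublocale ext: group_hom "ideal_group K" "ideal_group E" ext
  by unfold_locales (rule ext_hom)

lemma ext_inv: "B.is_frac A \<Longrightarrow> ext (inv\<^bsub>ideal_group K\<^esub> A) = inv\<^bsub>ideal_group E\<^esub> (ext A)"
  using ext.hom_inv[of A] by simp

lemma ext_nat_pow: "B.is_frac A \<Longrightarrow> ext (A [^]\<^bsub>ideal_group K\<^esub> (k::nat)) = ext A [^]\<^bsub>ideal_group E\<^esub> k"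
  using ext.hom_nat_pow[of A k] by simp

lemma ext_int_pow: "B.is_frac A \<Longrightarrow> ext (A [^]\<^bsub>ideal_group K\<^esub> (k::int)) = ext A [^]\<^bsub>ideal_group E\<^esub> k"
  using ext.hom_int_pow[of A k] by simp

text \<open>If x in K lies in the extension of A, then x times the inverse of A consists of integers
  of E that belong to K, hence of integers of K; multiplying by A puts x into A. Extension is
  therefore injective, and ideals of K may be compared after extension.\<close>

lemma ext_inter_K:
  assumes A: "B.is_frac A" and x: "x \<in> ext A" "x \<in> K"
  shows "x \<in> A"
proof -
  let ?B = "inv\<^bsub>ideal_group K\<^esub> A"
  have xb: "x * b \<in> OK" if b: "b \<in> ?B" for b
  proof -
    have "x * b \<in> ext A \<star> ext ?B" using x(1) b ext_sub by (intro imulI) auto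
    also have "\<dots> = OE" using B.imul_inv(1)[OF A] ext_OK ext_imul[of A ?B] by simp
    finally have "x * b \<in> OE" .
    moreover have "x * b \<in> K" using x(2) b B.fracD(2)[OF B.frac_inv[OF A]] B.E_mult by blast
    ultimately show ?thesis by (rule OE_K)
  qed
  have "A \<star> ?B \<subseteq> {c. c * x \<in> A}"
  proof (rule imul_least)
    fix a b assume "a \<in> A" "b \<in> ?B"
    then have "(x * b) * a \<in> A" using B.omod_mult[OF B.fracD(1)[OF A] xb] by blast
    then show "a * b \<in> {c. c * x \<in> A}" by (simp add: ac_simps)
  qed (use B.omod_add[OF B.fracD(1)[OF A]] in \<open>simp add: distrib_right\<close>)
  then have "1 \<in> {c. c * x \<in> A}" using B.imul_inv(1)[OF A] B.O_one by blast
  then show ?thesis by simp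
qed

lemma ext_inj:
  assumes "B.is_frac A" "B.is_frac C" "ext A = ext C" shows "A = C"
  using ext_inter_K[OF assms(1)] ext_inter_K[OF assms(2)] ext_sub[of A] ext_sub[of C] assms(3)
    B.fracD(2)[OF assms(1)] B.fracD(2)[OF assms(2)] by blast

lemma below_prime:
  assumes P: "P \<in> prime_ideals E"
  shows "below P \<in> prime_ideals K"
  unfolding B.prime_ideals_iff
proof (intro conjI ballI impI)
  note PI = T.primeD[OF P]
  have "B.omod (below P)"
    unfolding B.omod_def
    using T.omod_zero[OF T.iidealD(1)[OF PI(1)]] T.omod_add[OF T.iidealD(1)[OF PI(1)]]
      T.omod_mult[OF T.iidealD(1)[OF PI(1)] OK_sub_OE] B.O_add B.O_mult by simp
  \<comment> \<open>A positive rational integer in P shows that the contraction is nonzero.\<close>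
  moreover obtain m :: nat where m: "m > 0" "of_nat m \<in> P" using T.iideal_contains_nat[OF PI(1)] .
  moreover have "of_nat m \<in> OK" using B.O_of_int[of "int m"] by simp
  moreover have "(of_nat m :: complex) \<noteq> 0" using m(1) by simp
  ultimately show "B.iideal (below P)" unfolding B.iideal_def by blast
  show "1 \<notin> below P" using PI(2) by simp
  fix a b assume "a \<in> OK" "b \<in> OK" "a * b \<in> below P"
  then show "a \<in> below P \<or> b \<in> below P" using PI(3)[of a b] OK_sub_OE by blast
qed

lemma iideal_below: "B.iideal I \<Longrightarrow> I \<subseteq> P \<longleftrightarrow> I \<subseteq> below P"
  using B.iidealD(2) by blast

lemma ext_below_subset: "P \<in> prime_ideals E \<Longrightarrow> ext (below P) \<subseteq> P"
  using ext_least T.iidealD(1)[OF T.primeD(1)] by blast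

lemma val_ext_iideal_0:
  assumes P: "P \<in> prime_ideals E" and I: "B.iideal I" "\<not> I \<subseteq> below P"
  shows "T.val P (ext I) = 0"
proof (rule T.val_iideal_eq_0[OF P ext_iideal[OF I(1)]])
  show "\<not> ext I \<subseteq> P"
    using ext_subset_iff[OF T.iidealD(1)[OF T.primeD(1)[OF P]]] iideal_below[OF I(1)] I(2) by blast
qed

text \<open>Ideals that are units at \<open>below P\<close> extend to units at P, so only the power
  of \<open>below P\<close> counts. The factor \<open>T.val P (ext (below P))\<close> is the
  ramification index of P, which is written in this form throughout.\<close>

lemma val_ext:
  assumes P: "P \<in> prime_ideals E" and A: "B.is_frac A"
  shows "T.val P (ext A) = B.val (below P) A * T.val P (ext (below P))"
proof -
  note p = below_prime[OF P]
  obtain U where U: "B.coprime_to (below P) U" "A = below P [^]\<^bsub>ideal_group K\<^esub> B.val (below P) A \<star> U"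
    using B.val_decomp[OF p A] .
  note frU = B.coprime_frac[OF U(1)] and frp = B.prime_frac[OF p]
  obtain I J where IJ: "B.iideal I" "B.iideal J" "\<not> I \<subseteq> below P" "\<not> J \<subseteq> below P" "U \<star> J = I"
    using U(1) unfolding B.coprime_to_def by blast
  have "T.val P (ext I) = T.val P (ext U) + T.val P (ext J)"
    using T.val_imul[OF P ext_frac[OF frU] ext_frac[OF B.iidealD(4)[OF IJ(2)]]] IJ(5) ext_imul by metis
  then have "T.val P (ext U) = 0" using val_ext_iideal_0[OF P] IJ by simp
  moreover have "ext A = ext (below P) [^]\<^bsub>ideal_group E\<^esub> B.val (below P) A \<star> ext U"
    using ext_imul[of "below P [^]\<^bsub>ideal_group K\<^esub> B.val (below P) A" U] U(2) ext_int_pow[OF frp] by simp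
  ultimately show ?thesis
    using T.val_imul[OF P T.frac_int_pow[OF ext_frac[OF frp]] ext_frac[OF frU]]
      T.val_int_pow[OF P ext_frac[OF frp]] by simp
qed

lemma ext_below_pos: "P \<in> prime_ideals E \<Longrightarrow> T.val P (ext (below P)) > 0"
  using T.val_pos ext_below_subset ext_iideal B.primeD(1) below_prime by blast

text \<open>By \<open>ext_inter_K\<close> the extension of p does not contain 1. A prime above it
  contracts to a prime containing p, and maximality gives equality.\<close>

lemma prime_above:
  assumes p: "p \<in> prime_ideals K"
  obtains P where "P \<in> prime_ideals E" "below P = p"
proof -
  have "1 \<notin> ext p" using ext_inter_K[OF B.prime_frac[OF p], of 1] B.primeD(2)[OF p] by auto
  then obtain P where P: "P \<in> prime_ideals E" "ext p \<subseteq> P"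
    using T.iideal_in_prime[OF ext_iideal[OF B.primeD(1)[OF p]]] by blast
  then have "p \<subseteq> below P" using ext_sub[of p] B.iidealD(2)[OF B.primeD(1)[OF p]] by blast
  then have "below P = p" using B.prime_subset_eq[OF p below_prime[OF P(1)]] by simp
  then show ?thesis using that P(1) by blast
qed

end

text \<open>A bound for the length of a chain of ideals from \<open>\<pp>\<close> to the unit ideal replaces the
  fundamental identity \<open>\<Sum> e f = n\<close>: elements \<open>x\<^sub>i\<close> separating the members of the chain are linearly
  independent modulo \<open>\<pp>\<close>, hence over \<open>K\<close>.\<close>

locale nf_ext_degree = nf_ext +
  fixes n :: nat
  assumes degree: "has_degree K E n"
begin

lemma dimension: "CR.dimension n K E"
  using degree unfolding has_degree_def .

lemma ideal_chain_length:
  assumes p: "p \<in> prime_ideals K"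
    and I: "\<And>i. i \<le> m \<Longrightarrow> T.iideal (I i)" "\<And>i. i < m \<Longrightarrow> I (Suc i) \<subset> I i" "ext p \<subseteq> I m"
  shows "m \<le> n"
proof (rule ccontr)
  assume "\<not> m \<le> n"
  then have nm: "n < m" by simp
  have "\<forall>i<m. \<exists>x. x \<in> I i \<and> x \<notin> I (Suc i)" using I(2) by blast
  then obtain x where x: "\<And>i. i < m \<Longrightarrow> x i \<in> I i" "\<And>i. i < m \<Longrightarrow> x i \<notin> I (Suc i)" by metis
  have xE: "x i \<in> E" if "i < m" for i
    using x(1)[OF that] T.iidealD(2)[OF I(1)[of i]] T.O_E that by auto
  obtain c where c: "\<forall>i<m. c i \<in> K" "\<exists>i<m. c i \<noteq> 0" "(\<Sum>i<m. c i * x i) = 0"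
    by (rule dependence_if_dimension_less[OF B.subfield dimension, of m x], erule xE, rule nm, rule that)
  have anti: "I j \<subseteq> I i" if "i \<le> j" "j \<le> m" for i j
    using that
  proof (induction j rule: dec_induct)
    case (step j)
    then show ?case using I(2)[of j] by force
  qed simp
  \<comment> \<open>The ideal of K generated by the coefficients. As p need not be principal, common
    factors p are removed from the coefficients by an element of the inverse of D instead of by a
    division.\<close>
  define D where "D = {\<Sum>i<m. c i * a i | a. \<forall>i<m. a i \<in> OK}"
  have omD: "B.omod D" unfolding B.omod_def
  proof (intro conjI ballI)
    show "0 \<in> D" unfolding D_def by (intro CollectI exI[of _ "\<lambda>i. 0"]) simp
    fix u v assume "u \<in> D" "v \<in> D"
    then obtain a b where ab: "u = (\<Sum>i<m. c i * a i)" "v = (\<Sum>i<m. c i * b i)" "\<forall>i<m. a i \<in> OK" "\<forall>i<m. b i \<in> OK"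
      unfolding D_def by blast
    then have "u + v = (\<Sum>i<m. c i * (a i + b i))" by (simp add: sum.distrib distrib_left)
    moreover have "\<forall>i<m. a i + b i \<in> OK" using ab(3,4) B.O_add by blast
    ultimately show "u + v \<in> D" unfolding D_def by (intro CollectI exI[of _ "\<lambda>i. a i + b i"] conjI)
  next
    fix r u assume "r \<in> OK" "u \<in> D"
    then obtain a where a: "u = (\<Sum>i<m. c i * a i)" "\<forall>i<m. a i \<in> OK" unfolding D_def by blast
    then have "r * u = (\<Sum>i<m. c i * (r * a i))" by (simp add: sum_distrib_left mult.left_commute)
    moreover have "\<forall>i<m. r * a i \<in> OK" using a(2) \<open>r \<in> OK\<close> B.O_mult by blast
    ultimately show "r * u \<in> D" unfolding D_def by (intro CollectI exI[of _ "\<lambda>i. r * a i"] conjI)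
  qed
  have cD: "c i \<in> D" if "i < m" for i
  proof -
    have "c i = (\<Sum>j<m. c j * (if j = i then 1 else 0))"
      using that by (simp add: if_distrib cong: if_cong)
    moreover have "\<forall>j<m. (if j = i then 1 else 0) \<in> OK" using B.O_zero B.O_one by simp
    ultimately show ?thesis unfolding D_def
      by (intro CollectI exI[of _ "\<lambda>j. if j = i then 1 else 0"] conjI)
  qed
  have denom: "\<exists>d::int. d \<noteq> 0 \<and> (\<forall>i<k. of_int d * c i \<in> OK)" if "k \<le> m" for k
    using that
  proof (induction k)
    case (Suc k)
    then obtain d :: int where d: "d \<noteq> 0" "\<forall>i<k. of_int d * c i \<in> OK" by auto
    have "c k \<in> K" using c(1) Suc.prems by simp
    then obtain e :: int where e: "e \<noteq> 0" "of_int e * c k \<in> OK" by (rule B.integral_multiple)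
    have "of_int (d * e) * c i \<in> OK" if "i < Suc k" for i
    proof (cases "i = k")
      case True
      then show ?thesis using B.O_mult[OF B.O_of_int[of d] e(2)] by (simp add: mult.assoc)
    next
      case False
      then have "of_int e * (of_int d * c i) \<in> OK" using d(2) that B.O_mult[OF B.O_of_int[of e]] by simp
      then show ?thesis by (simp add: ac_simps)
    qed
    then show ?case using d(1) e(1) by (intro exI[of _ "d * e"]) auto
  qed (auto intro: exI[of _ 1])
  obtain d :: int where d: "d \<noteq> 0" "\<forall>i<m. of_int d * c i \<in> OK" using denom[of m] by blast
  have dD: "\<forall>u\<in>D. of_int d * u \<in> OK"
  proof
    fix u assume "u \<in> D"
    then obtain a where a: "u = (\<Sum>i<m. c i * a i)" "\<forall>i<m. a i \<in> OK" unfolding D_def by blast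
    have "(\<Sum>i<m. (of_int d * c i) * a i) \<in> OK" 
      by (rule B.O_sum, rule B.O_mult) (use a(2) d(2) in auto)
    then show "of_int d * u \<in> OK" unfolding a(1) by (simp add: sum_distrib_left mult.assoc)
  qed
  have DK: "D \<subseteq> K"
  proof
    fix u assume "u \<in> D"
    then obtain a where a: "u = (\<Sum>i<m. c i * a i)" "\<forall>i<m. a i \<in> OK" unfolding D_def by blast
    then show "u \<in> K" using c(1) B.O_E by (auto intro!: B.E_sum B.E_mult)
  qed
  have "D \<noteq> {0}" using c(2) cD by blast
  then have D: "B.is_frac D"
    unfolding B.is_frac_def using omD dD DK d(1) by (intro conjI bexI[of _ "of_int d"]) auto
  let ?D = "inv\<^bsub>ideal_group K\<^esub> D"
  have DD: "D \<star> ?D = OK" by (rule B.imul_inv(1)[OF D])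
  have omp: "B.omod p" using B.iidealD(1)[OF B.primeD(1)[OF p]] .
  \<comment> \<open>If every l in the inverse of D moved all coefficients into p, then D times its
    inverse, the unit ideal, would lie in p.\<close>
  obtain l i where l: "l \<in> ?D" "i < m" "c i * l \<notin> p"
  proof (rule ccontr)
    assume "\<not> thesis"
    then have all: "\<forall>l\<in>?D. \<forall>i<m. c i * l \<in> p" using that by blast
    have "D \<star> ?D \<subseteq> p"
    proof (rule imul_least)
      fix u l assume u: "u \<in> D" and l: "l \<in> ?D"
      obtain a where a: "u = (\<Sum>i<m. c i * a i)" "\<forall>i<m. a i \<in> OK" using u unfolding D_def by blast
      have "u * l = (\<Sum>i<m. a i * (c i * l))" unfolding a(1) sum_distrib_right by (simp only: ac_simps)
      also have "\<dots> \<in> p" using all l a(2) B.omod_mult[OF omp] by (intro B.omod_sum[OF omp]) auto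
      finally show "u * l \<in> p" .
    qed (rule B.omod_add[OF omp])
    then show False using DD B.O_one B.primeD(2)[OF p] by blast
  qed
  have cl: "c j * l \<in> OK" if "j < m" for j using imulI[OF cD[OF that] l(1)] DD by simp
  \<comment> \<open>The first coefficient outside p. Earlier terms lie in the extension of p, later
    ones are multiples of members of \<open>I (Suc i0)\<close>; so the term at i0 is in
    \<open>I (Suc i0)\<close> as well. Its coefficient is a unit modulo p, which puts
    \<open>x i0\<close> there, against its choice.\<close>
  define i0 where "i0 = (LEAST i. i < m \<and> c i * l \<notin> p)"
  have i0: "i0 < m" "c i0 * l \<notin> p"
    using LeastI[of "\<lambda>i. i < m \<and> c i * l \<notin> p" i] l unfolding i0_def by auto
  have low: "c j * l \<in> p" if "j < i0" for j
    using not_less_Least[of j "\<lambda>i. i < m \<and> c i * l \<notin> p"] that i0(1) unfolding i0_def by auto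
  let ?J = "I (Suc i0)"
  have omJ: "T.omod ?J" using T.iidealD(1)[OF I(1)[of "Suc i0"]] i0(1) by simp
  have pJ: "ext p \<subseteq> ?J" using I(3) anti[of "Suc i0" m] i0(1) by auto
  have other: "c j * l * x j \<in> ?J" if "j < m" "j \<noteq> i0" for j
  proof (cases "j < i0")
    case True
    have "x j \<in> OE" using x(1)[OF that(1)] T.iidealD(2)[OF I(1)[of j]] that(1) by auto
    then have "c j * l * x j \<in> ext p" unfolding ext_eq using low[OF True] by (intro imulI)
    then show ?thesis using pJ by blast
  next
    case False
    then have "x j \<in> ?J" using x(1)[OF that(1)] anti[of "Suc i0" j] that by auto
    then show ?thesis using T.omod_mult[OF omJ OK_sub_OE[OF cl[OF that(1)]]] by simp
  qed
  have "(\<Sum>j<m. c j * l * x j) = l * (\<Sum>j<m. c j * x j)"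
    unfolding sum_distrib_left by (simp only: ac_simps)
  then have "(\<Sum>j<m. c j * l * x j) = 0" using c(3) by simp
  then have "c i0 * l * x i0 = - (\<Sum>j\<in>{..<m} - {i0}. c j * l * x j)"
    using i0(1) by (simp add: sum.remove[of "{..<m}" i0] eq_neg_iff_add_eq_0)
  moreover have "- (\<Sum>j\<in>{..<m} - {i0}. c j * l * x j) \<in> ?J"
    using other by (intro T.omod_uminus[OF omJ] T.omod_sum[OF omJ]) auto
  ultimately have cx: "c i0 * l * x i0 \<in> ?J" by simp
  note adj = B.iideal_adjoin[OF B.primeD(1)[OF p] cl[OF i0(1)]]
  have "1 \<in> {r * (c i0 * l) + y | r y. r \<in> OK \<and> y \<in> p}"
    by (rule B.prime_maximal[OF p adj(1)]) (use adj(2,3) i0(2) in blast)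
  then obtain r y where ry: "1 = r * (c i0 * l) + y" "r \<in> OK" "y \<in> p" by blast
  have "x i0 \<in> OE" using x(1)[OF i0(1)] T.iidealD(2)[OF I(1)[of i0]] i0(1) by auto
  then have "y * x i0 \<in> ?J" using imulI[OF ry(3), of "x i0" OE] pJ unfolding ext_eq by blast
  moreover have "r * (c i0 * l * x i0) \<in> ?J" using T.omod_mult[OF omJ OK_sub_OE[OF ry(2)] cx] .
  moreover have "x i0 = (r * (c i0 * l) + y) * x i0" using ry(1) by simp
  then have "x i0 = r * (c i0 * l * x i0) + y * x i0" by (simp only: distrib_right mult.assoc)
  ultimately have "x i0 \<in> ?J" using T.omod_add[OF omJ] by metis
  then show False using x(2)[OF i0(1)] by blast
qed

text \<open>The powers of P from exponent 0 to k form a strict chain of k steps down to P^k, and a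
  proper cofactor C adds one more. So ramification indices are at most n, and the value n is
  attained only if nothing but P^n is left.\<close>

lemma prime_power_chain:
  assumes P: "P \<in> prime_ideals E" and C: "T.iideal C"
    and eq: "ext (below P) = P [^]\<^bsub>ideal_group E\<^esub> (k::nat) \<star> C"
  shows "k \<le> n" "C \<noteq> OE \<Longrightarrow> k < n"
proof -
  note PI = T.primeD(1)[OF P]
  have st: "P [^]\<^bsub>ideal_group E\<^esub> Suc i \<subset> P [^]\<^bsub>ideal_group E\<^esub> i" for i :: nat
    using T.imul_psubset[OF T.iideal_pow[OF PI] PI T.prime_ne_O[OF P]] by simp
  have sub: "P [^]\<^bsub>ideal_group E\<^esub> k \<star> C \<subseteq> P [^]\<^bsub>ideal_group E\<^esub> k"
    by (rule T.imul_subset[OF T.iideal_pow[OF PI] C])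
  show "k \<le> n"
    by (rule ideal_chain_length[OF below_prime[OF P], of k "\<lambda>i. P [^]\<^bsub>ideal_group E\<^esub> i"])
      (use T.iideal_pow[OF PI] st sub eq in auto)
  assume C1: "C \<noteq> OE"
  define I where "I = (\<lambda>i. if i \<le> k then P [^]\<^bsub>ideal_group E\<^esub> i else P [^]\<^bsub>ideal_group E\<^esub> k \<star> C)"
  have "Suc k \<le> n"
  proof (rule ideal_chain_length[OF below_prime[OF P], of "Suc k" I])
    show "T.iideal (I i)" for i unfolding I_def using T.iideal_pow[OF PI] T.iideal_imul C by simp
    show "I (Suc i) \<subset> I i" if "i < Suc k" for i
      unfolding I_def using st[of i] T.imul_psubset[OF T.iideal_pow[OF PI, of k] C C1] that
      by (cases "i < k") (auto simp: less_Suc_eq)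
    show "ext (below P) \<subseteq> I (Suc k)" unfolding I_def using eq by simp
  qed
  then show "k < n" by simp
qed

lemma ramification_index_le:
  assumes P: "P \<in> prime_ideals E" shows "T.val P (ext (below P)) \<le> int n"
proof -
  let ?A = "ext (below P)"
  define k where "k = nat (T.val P ?A)"
  have I: "T.iideal ?A" by (rule ext_iideal[OF B.primeD(1)[OF below_prime[OF P]]])
  have k: "int k = T.val P ?A" using ext_below_pos[OF P] unfolding k_def by simp
  have "T.iideal (?A \<star> inv\<^bsub>ideal_group E\<^esub> (P [^]\<^bsub>ideal_group E\<^esub> k))"
    using T.iideal_divide_prime_power[OF P I] k by simp
  moreover have "?A = P [^]\<^bsub>ideal_group E\<^esub> k \<star> (?A \<star> inv\<^bsub>ideal_group E\<^esub> (P [^]\<^bsub>ideal_group E\<^esub> k))"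
    using T.imul_inv_cancel'[OF T.iidealD(4)[OF I] T.frac_nat_pow[OF T.prime_frac[OF P]]] imul_commute by simp
  ultimately have "k \<le> n" by (rule prime_power_chain(1)[OF P])
  then show ?thesis using k by simp
qed

lemma totally_ramified_if_val_ge:
  assumes P: "P \<in> prime_ideals E" and ge: "T.val P (ext (below P)) \<ge> int n"
  shows "ext (below P) = P [^]\<^bsub>ideal_group E\<^esub> n"
proof -
  let ?A = "ext (below P)"
  define C where "C = ?A \<star> inv\<^bsub>ideal_group E\<^esub> (P [^]\<^bsub>ideal_group E\<^esub> n)"
  have I: "T.iideal ?A" by (rule ext_iideal[OF B.primeD(1)[OF below_prime[OF P]]])
  have C: "T.iideal C" unfolding C_def using T.iideal_divide_prime_power[OF P I ge] .
  have eq: "?A = P [^]\<^bsub>ideal_group E\<^esub> n \<star> C" unfolding C_def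
    using T.imul_inv_cancel'[OF T.iidealD(4)[OF I] T.frac_nat_pow[OF T.prime_frac[OF P]]] imul_commute by simp
  then have "C = OE" using prime_power_chain(2)[OF P C eq] by blast
  then show ?thesis using eq T.imul_one(1)[OF T.frac_nat_pow[OF T.prime_frac[OF P]]] by simp
qed

text \<open>The degree is quantified in \<open>totally_ramified\<close>; uniqueness of the dimension
  identifies it with n.\<close>

lemma totally_ramified_iff:
  "totally_ramified K E P \<longleftrightarrow> P \<in> prime_ideals E \<and> ext (below P) = P [^]\<^bsub>ideal_group E\<^esub> n"
proof -
  have "m = n" if "has_degree K E m" for m
    using that degree CR.dimension_is_inj[OF B.subfield] unfolding has_degree_def by blast
  then show ?thesis unfolding totally_ramified_def using degree by blast
qed

lemma totally_ramified_iff_val: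
  "totally_ramified K E P \<longleftrightarrow> P \<in> prime_ideals E \<and> T.val P (ext (below P)) = int n"
proof
  assume "totally_ramified K E P"
  then have P: "P \<in> prime_ideals E" and eq: "ext (below P) = P [^]\<^bsub>ideal_group E\<^esub> n"
    unfolding totally_ramified_iff by auto
  show "P \<in> prime_ideals E \<and> T.val P (ext (below P)) = int n"
    unfolding eq using T.val_nat_pow[OF P T.prime_frac[OF P], of n] T.val_self[OF P] P by simp
next
  assume "P \<in> prime_ideals E \<and> T.val P (ext (below P)) = int n"
  then show "totally_ramified K E P"
    unfolding totally_ramified_iff using totally_ramified_if_val_ge by simp
qed

end

section \<open>Quadratic extensions\<close>

text \<open>A description, which has a unique solution once \<theta> is outside K and x is in K + K
  \<theta>; it depends on K and \<theta> only.\<close>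

definition conj_map :: "complex set \<Rightarrow> complex \<Rightarrow> complex \<Rightarrow> complex" where
  "conj_map K \<theta> x = (THE y. \<exists>u\<in>K. \<exists>v\<in>K. x = u + v * \<theta> \<and> y = u - v * \<theta>)"

text \<open>The generator \<theta> is a parameter and not chosen inside, because the same \<theta>
  has to serve for K/F and for N/L; this makes the two conjugations agree in
  \<open>tau_agree\<close>.\<close>

locale nf_quadratic = nf_ext +
  fixes \<theta> :: complex
  assumes theta: "\<theta> \<in> E" "\<theta> \<notin> K" "\<theta>\<^sup>2 \<in> K"
    and E_decomp: "x \<in> E \<Longrightarrow> \<exists>u\<in>K. \<exists>v\<in>K. x = u + v * \<theta>"
begin

definition tau :: "complex \<Rightarrow> complex" where "tau = conj_map K \<theta>"

lemma E_cases:
  assumes "x \<in> E"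
  obtains u v where "u \<in> K" "v \<in> K" "x = u + v * \<theta>"
  using E_decomp[OF assms] by blast

lemma decomp_unique:
  assumes "u \<in> K" "v \<in> K" "u' \<in> K" "v' \<in> K" "u + v * \<theta> = u' + v' * \<theta>"
  shows "u = u'" "v = v'"
proof -
  show "v = v'"
  proof (rule ccontr)
    assume "v \<noteq> v'"
    then have "\<theta> = (u' - u) / (v - v')" using assms(5) by (simp add: field_simps)
    then show False using theta(2) assms B.E_divide B.E_diff by simp
  qed
  then show "u = u'" using assms(5) by simp
qed

lemma tau_decomp: "u \<in> K \<Longrightarrow> v \<in> K \<Longrightarrow> tau (u + v * \<theta>) = u - v * \<theta>"
  unfolding tau_def conj_map_def by (rule the_equality) (use decomp_unique in blast)+

lemma K_E: "x \<in> K \<Longrightarrow> x \<in> E"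
  using K_sub_E by blast

lemma tau_K: "x \<in> K \<Longrightarrow> tau x = x"
  using tau_decomp[of x 0] by simp

lemma tau_E: "x \<in> E \<Longrightarrow> tau x \<in> E"
  by (erule E_cases) (simp add: tau_decomp T.E_diff T.E_mult K_E theta(1))

lemma tau_tau: "x \<in> E \<Longrightarrow> tau (tau x) = x"
proof (erule E_cases)
  fix u v assume uv: "u \<in> K" "v \<in> K" "x = u + v * \<theta>"
  then have "tau x = u + (- v) * \<theta>" by (simp add: tau_decomp)
  then show ?thesis using tau_decomp[OF uv(1) B.E_uminus[OF uv(2)]] uv(3) by simp
qed

lemma tau_add: "x \<in> E \<Longrightarrow> y \<in> E \<Longrightarrow> tau (x + y) = tau x + tau y"
proof (erule E_cases, erule E_cases)
  fix u v u' v' assume uv: "u \<in> K" "v \<in> K" "x = u + v * \<theta>" "u' \<in> K" "v' \<in> K" "y = u' + v' * \<theta>"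
  have "x + y = (u + u') + (v + v') * \<theta>" using uv by (simp add: algebra_simps)
  then have "tau (x + y) = (u + u') - (v + v') * \<theta>"
    using tau_decomp[OF B.E_add[OF uv(1,4)] B.E_add[OF uv(2,5)]] by (simp only:)
  moreover have "tau x = u - v * \<theta>" "tau y = u' - v' * \<theta>"
    unfolding uv(3,6) using tau_decomp uv by blast+
  ultimately show ?thesis by (simp only:) (simp add: algebra_simps)
qed

lemma tau_mult: "x \<in> E \<Longrightarrow> y \<in> E \<Longrightarrow> tau (x * y) = tau x * tau y"
proof (erule E_cases, erule E_cases)
  fix u v u' v' assume uv: "u \<in> K" "v \<in> K" "x = u + v * \<theta>" "u' \<in> K" "v' \<in> K" "y = u' + v' * \<theta>"
  have K: "u * u' + v * v' * \<theta>\<^sup>2 \<in> K" "u * v' + v * u' \<in> K"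
    using uv(1,2,4,5) theta(3) by (simp_all add: B.E_add B.E_mult)
  have "x * y = (u * u' + v * v' * \<theta>\<^sup>2) + (u * v' + v * u') * \<theta>"
    using uv(3,6) by (simp add: algebra_simps power2_eq_square)
  then have "tau (x * y) = (u * u' + v * v' * \<theta>\<^sup>2) - (u * v' + v * u') * \<theta>"
    using tau_decomp[OF K] by (simp only:)
  moreover have "tau x = u - v * \<theta>" "tau y = u' - v' * \<theta>"
    unfolding uv(3,6) using tau_decomp uv by blast+
  ultimately show ?thesis by (simp only:) (simp add: algebra_simps power2_eq_square)
qed

lemma tau_power: "x \<in> E \<Longrightarrow> tau (x ^ k) = tau x ^ k"
  by (induction k) (simp_all add: tau_K tau_mult T.E_power)

lemma tau_sum: "(\<And>i. i \<in> S \<Longrightarrow> f i \<in> E) \<Longrightarrow> tau (sum f S) = (\<Sum>i\<in>S. tau (f i))"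
  by (induction S rule: infinite_finite_induct) (simp_all add: tau_K tau_add T.E_sum)

text \<open>Conjugation fixes integer coefficients, so the conjugate is a root of the same monic
  polynomial.\<close>

lemma tau_O: assumes x: "x \<in> OE" shows "tau x \<in> OE"
proof -
  have xE: "x \<in> E" by (rule T.O_E[OF x])
  obtain p :: "int poly" where p: "poly (map_poly of_int p) x = 0" "lead_coeff p = 1"
    using T.O_int[OF x] unfolding algebraic_int_altdef_ipoly by auto
  have ev: "poly (map_poly of_int p) y = (\<Sum>i\<le>degree p. of_int (coeff p i) * y ^ i)" for y :: complex
    by (simp add: poly_altdef coeff_map_poly)
  have "tau (\<Sum>i\<le>degree p. of_int (coeff p i) * x ^ i) = (\<Sum>i\<le>degree p. tau (of_int (coeff p i) * x ^ i))"
    by (rule tau_sum) (simp add: T.E_mult T.E_power xE)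
  also have "\<dots> = (\<Sum>i\<le>degree p. of_int (coeff p i) * tau x ^ i)"
    by (simp add: tau_mult tau_power tau_K T.E_power xE)
  finally have "poly (map_poly of_int p) (tau x) = tau 0" using p(1) ev by metis
  then have "poly (map_poly of_int p) (tau x) = 0" by (simp add: tau_K)
  then have "algebraic_int (tau x)" unfolding algebraic_int_altdef_ipoly using p(2) by blast
  then show ?thesis using T.O_I tau_E[OF xE] by blast
qed

lemma tau_eq_0: "x \<in> E \<Longrightarrow> tau x = 0 \<Longrightarrow> x = 0"
  using tau_tau[of x] tau_K[of 0] by simp

lemma norm_K: assumes "x \<in> E" shows "x * tau x \<in> K"
proof -
  obtain u v where uv: "u \<in> K" "v \<in> K" "x = u + v * \<theta>" using E_cases[OF assms] .
  have "x * tau x = (u + v * \<theta>) * (u - v * \<theta>)" unfolding uv(3) tau_decomp[OF uv(1,2)] ..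
  also have "\<dots> = u * u - v * v * \<theta>\<^sup>2" by (simp add: algebra_simps power2_eq_square)
  finally have "x * tau x = u * u - v * v * \<theta>\<^sup>2" .
  then show ?thesis using uv theta(3) by (simp add: B.E_diff B.E_mult)
qed

text \<open>An embedding over K fixes the square of \<theta> and so sends \<theta> to \<theta> or
  -\<theta>, which determines it.\<close>

lemma embeddings_eq: "embeddings K E = {restrict id E, restrict tau E}"
proof
  show "{restrict id E, restrict tau E} \<subseteq> embeddings K E"
    unfolding embeddings_def using tau_mult tau_add tau_K T.E_mult T.E_add K_E
    by (auto simp: Ring.ring_hom_def)
  show "embeddings K E \<subseteq> {restrict id E, restrict tau E}"
  proof
    fix \<sigma> assume \<sigma>: "\<sigma> \<in> embeddings K E"
    then have hom: "\<And>x y. x \<in> E \<Longrightarrow> y \<in> E \<Longrightarrow> \<sigma> (x * y) = \<sigma> x * \<sigma> y"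
        "\<And>x y. x \<in> E \<Longrightarrow> y \<in> E \<Longrightarrow> \<sigma> (x + y) = \<sigma> x + \<sigma> y"
        "\<And>x. x \<in> K \<Longrightarrow> \<sigma> x = x" "\<sigma> \<in> extensional E"
      unfolding embeddings_def Ring.ring_hom_def by auto
    have "\<sigma> \<theta> * \<sigma> \<theta> = \<theta> * \<theta>" using hom(1)[OF theta(1,1)] hom(3)[OF theta(3)] by (simp add: power2_eq_square)
    then have cases: "\<sigma> \<theta> = \<theta> \<or> \<sigma> \<theta> = - \<theta>" by (simp add: square_eq_iff)
    have dec: "\<sigma> (u + v * \<theta>) = u + v * \<sigma> \<theta>" if "u \<in> K" "v \<in> K" for u v
      using that hom T.E_mult K_E theta(1) by simp
    show "\<sigma> \<in> {restrict id E, restrict tau E}"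
      using cases
    proof
      assume "\<sigma> \<theta> = \<theta>"
      then have "\<sigma> x = x" if "x \<in> E" for x using E_cases[OF that] dec by metis
      then have "\<sigma> = restrict id E" using hom(4) by (intro extensionalityI[of _ E]) auto
      then show ?thesis by simp
    next
      assume "\<sigma> \<theta> = - \<theta>"
      then have "\<sigma> (u + v * \<theta>) = tau (u + v * \<theta>)" if "u \<in> K" "v \<in> K" for u v
        using dec[OF that] tau_decomp[OF that] by simp
      then have "\<sigma> x = tau x" if "x \<in> E" for x using E_cases[OF that] by metis
      then have "\<sigma> = restrict tau E" using hom(4) by (intro extensionalityI[of _ E]) auto
      then show ?thesis by simp
    qed
  qed
qed

lemma rel_norm_eq: assumes "x \<in> E" shows "rel_norm K E x = x * tau x"
proof -
  \<comment> \<open>The two embeddings must be distinct, since the product runs over a set and would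
    otherwise have a single factor.\<close>
  have "\<theta> \<noteq> 0" using theta(2) by auto
  then have "tau \<theta> \<noteq> \<theta>" using tau_decomp[of 0 1] by simp
  then have "restrict id E \<noteq> restrict tau E" using theta(1) by (metis id_apply restrict_apply')
  then show ?thesis unfolding rel_norm_def embeddings_eq using assms by simp
qed

subsection \<open>Conjugation and norms of ideals\<close>

abbreviation cj :: "complex set \<Rightarrow> complex set" where "cj A \<equiv> tau ` A"

lemma cj_mem_iff: "A \<subseteq> E \<Longrightarrow> x \<in> E \<Longrightarrow> tau x \<in> cj A \<longleftrightarrow> x \<in> A"
proof
  assume A: "A \<subseteq> E" and x: "x \<in> E" and "tau x \<in> cj A"
  then obtain a where a: "a \<in> A" "tau x = tau a" by blast
  then have "tau (tau x) = tau (tau a)" by simp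
  then have "x = a" using tau_tau[OF x] tau_tau[of a] A a(1) by auto
  then show "x \<in> A" using a(1) by simp
qed simp

lemma cj_cj: "A \<subseteq> E \<Longrightarrow> cj (cj A) = A"
  using tau_tau by (force simp: image_image)

lemma cj_omod: assumes "T.omod A" "A \<subseteq> E" shows "T.omod (cj A)"
  unfolding T.omod_def
proof (intro conjI ballI)
  show "0 \<in> cj A" using T.omod_zero[OF assms(1)] tau_K[of 0] by force
  fix x y assume "x \<in> cj A" "y \<in> cj A"
  then obtain a b where ab: "x = tau a" "y = tau b" "a \<in> A" "b \<in> A" by blast
  then have "x + y = tau (a + b)" using tau_add[of a b] assms(2) by (metis subsetD)
  then show "x + y \<in> cj A" using T.omod_add[OF assms(1) ab(3,4)] by blast
next
  fix r x assume r: "r \<in> OE" and "x \<in> cj A"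
  then obtain a where a: "x = tau a" "a \<in> A" by blast
  have "tau (tau r * a) = r * x" using tau_mult[of "tau r" a] tau_E tau_tau T.O_E[OF r] a assms(2) by auto
  then show "r * x \<in> cj A" using T.omod_mult[OF assms(1) tau_O[OF r] a(2)] by (metis imageI)
qed

lemma cj_frac: assumes A: "T.is_frac A" shows "T.is_frac (cj A)"
proof -
  obtain a where a: "a \<in> A" "a \<noteq> 0" using T.omod_nonzero T.fracD[OF A] by blast
  obtain d where d: "d \<in> OE" "d \<noteq> 0" "\<forall>x\<in>A. d * x \<in> OE" using A unfolding T.is_frac_def by blast
  have AE: "A \<subseteq> E" by (rule T.fracD(2)[OF A])
  have "\<forall>x\<in>cj A. tau d * x \<in> OE"
  proof
    fix x assume "x \<in> cj A"
    then obtain a where a: "x = tau a" "a \<in> A" by blast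
    then have "tau d * x = tau (d * a)" using tau_mult T.O_E[OF d(1)] AE by auto
    then show "tau d * x \<in> OE" using tau_O d(3) a(2) by simp
  qed
  moreover have "tau d \<noteq> 0" "tau d \<in> OE" using tau_eq_0 T.O_E tau_O d(1,2) by blast+
  moreover have "cj A \<noteq> {0}" using a tau_eq_0[of a] AE by blast
  moreover have "cj A \<subseteq> E" using tau_E AE by blast
  ultimately show ?thesis using cj_omod[OF T.fracD(1)[OF A] AE] unfolding T.is_frac_def by blast
qed

lemma cj_OE: "cj OE = OE"
  using tau_O tau_tau T.O_E by (metis (no_types, opaque_lifting) image_eqI image_subset_iff subset_antisym subsetI)

lemma cj_iideal: "T.iideal A \<Longrightarrow> T.iideal (cj A)"
  using cj_frac cj_OE image_mono[of A OE tau] unfolding T.iideal_frac by auto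

lemma cj_imul:
  assumes A: "A \<subseteq> E" and B: "B \<subseteq> E" shows "cj (A \<star> B) = cj A \<star> cj B"
proof -
  have 1: "A \<star> B \<subseteq> {x\<in>E. tau x \<in> cj A \<star> cj B}" if A: "A \<subseteq> E" and B: "B \<subseteq> E" for A B
  proof (rule imul_least)
    fix a b assume ab: "a \<in> A" "b \<in> B"
    then have "tau (a * b) = tau a * tau b" "a * b \<in> E" 
      using tau_mult[of a b] T.E_mult[of a b] A B by auto
    then show "a * b \<in> {x\<in>E. tau x \<in> cj A \<star> cj B}" using ab by (simp add: imulI)
  next
    fix x y assume "x \<in> {x\<in>E. tau x \<in> cj A \<star> cj B}" "y \<in> {x\<in>E. tau x \<in> cj A \<star> cj B}"
    then show "x + y \<in> {x\<in>E. tau x \<in> cj A \<star> cj B}" by (simp add: tau_add imul_add T.E_add)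
  qed
  have cE: "cj A \<subseteq> E" "cj B \<subseteq> E" using tau_E A B by blast+
  \<comment> \<open>The reverse inclusion is the first one for the conjugate ideals, because
    conjugation is an involution.\<close>
  have "cj A \<star> cj B \<subseteq> cj (A \<star> B)"
  proof
    fix x assume "x \<in> cj A \<star> cj B"
    then have x: "x \<in> E" "tau x \<in> cj (cj A) \<star> cj (cj B)" using 1[OF cE] by blast+
    then have "tau x \<in> A \<star> B" using cj_cj A B by simp
    then show "x \<in> cj (A \<star> B)" using tau_tau[OF x(1)] by (metis imageI)
  qed
  then show ?thesis using 1[OF A B] by blast
qed

lemma cj_ext: assumes A: "A \<subseteq> K" shows "cj (ext A) = ext A"
proof -
  have "cj A = A" using tau_K A by (force simp: image_def)
  moreover have "A \<subseteq> E" "OE \<subseteq> E" using A K_sub_E T.O_E by auto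
  ultimately show ?thesis unfolding ext_eq by (simp add: cj_imul cj_OE)
qed

lemma cj_prime: assumes P: "P \<in> prime_ideals E" shows "cj P \<in> prime_ideals E"
  unfolding T.prime_ideals_iff
proof (intro conjI ballI impI)
  note PI = T.primeD[OF P]
  have PE: "P \<subseteq> E" using T.fracD(2)[OF T.prime_frac[OF P]] .
  show "T.iideal (cj P)" by (rule cj_iideal[OF PI(1)])
  show "1 \<notin> cj P" using cj_mem_iff[OF PE T.E_one] tau_K[OF B.E_one] PI(2) by simp
  fix a b assume ab: "a \<in> OE" "b \<in> OE" "a * b \<in> cj P"
  have "tau (a * b) \<in> P" using ab(3) cj_cj[OF PE] by blast
  then have "tau a * tau b \<in> P" using tau_mult T.O_E ab(1,2) by simp
  then have "tau a \<in> P \<or> tau b \<in> P" using PI(3)[OF tau_O tau_O] ab by blast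
  then show "a \<in> cj P \<or> b \<in> cj P" using tau_tau T.O_E ab(1,2) by (metis imageI)
qed

lemma cj_hom: "cj \<in> hom (ideal_group E) (ideal_group E)"
  using cj_frac cj_imul T.fracD(2) by (auto simp: hom_def)

lemma below_cj: assumes P: "P \<in> prime_ideals E" shows "below (cj P) = below P"
proof -
  have PE: "P \<subseteq> E" using T.fracD(2)[OF T.prime_frac[OF P]] .
  have "x \<in> cj P \<longleftrightarrow> x \<in> P" if "x \<in> OK" for x
    using cj_mem_iff[OF PE, of x] tau_K[of x] B.O_E[OF that] K_E by simp
  then show ?thesis by blast
qed

abbreviation nm :: "complex set \<Rightarrow> complex set" where "nm \<equiv> ideal_norm K E"

lemma nm_eq: assumes "A \<subseteq> E" shows "nm A = (\<lambda>x. x * tau x) ` A \<star> OK"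
proof -
  have "rel_norm K E ` A = (\<lambda>x. x * tau x) ` A" using rel_norm_eq assms by (intro image_cong) auto
  then show ?thesis unfolding ideal_norm_def by simp
qed

lemma nm_frac: assumes A: "T.is_frac A" shows "B.is_frac (nm A)"
proof -
  obtain a where a: "a \<in> A" "a \<noteq> 0" using T.omod_nonzero T.fracD[OF A] by blast
  obtain d where d: "d \<in> OE" "d \<noteq> 0" "\<forall>x\<in>A. d * x \<in> OE" using A unfolding T.is_frac_def by blast
  have AE: "A \<subseteq> E" by (rule T.fracD(2)[OF A])
  \<comment> \<open>The norm of a denominator of A is a denominator of the norm of A, and it lies in
    K.\<close>
  define e where "e = d * tau d"
  have dE: "d \<in> E" using d(1) T.O_E by blast
  have e: "e \<in> OK" "e \<noteq> 0"
    unfolding e_def using OE_K[OF T.O_mult[OF d(1) tau_O[OF d(1)]] norm_K[OF dE]] tau_eq_0[OF dE] d(2) by auto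
  have "nm A \<subseteq> {x\<in>K. e * x \<in> OK}" unfolding nm_eq[OF AE]
  proof (rule imul_least)
    fix x r assume "x \<in> (\<lambda>x. x * tau x) ` A" and r: "r \<in> OK"
    then obtain y where y: "y \<in> A" "x = y * tau y" by blast
    have yE: "y \<in> E" using y(1) AE by blast
    have xK: "x \<in> K" using norm_K[OF yE] y(2) by simp
    have "(d * y) * tau (d * y) \<in> OE" using d(3) y(1) tau_O T.O_mult by blast
    then have "e * x \<in> OE" unfolding e_def y(2) tau_mult[OF dE yE] by (simp add: ac_simps)
    then have "e * x \<in> OK" using OE_K B.E_mult B.O_E e(1) xK by blast
    then have "e * (x * r) \<in> OK" using B.O_mult[OF _ r, of "e * x"] by (simp only: mult.assoc)
    then show "x * r \<in> {x\<in>K. e * x \<in> OK}" using B.E_mult[OF xK B.O_E[OF r]] by blast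
  qed (simp add: distrib_left B.O_add B.E_add)
  moreover have "B.omod (nm A)"
    unfolding nm_eq[OF AE] imul_commute[of _ OK] by (rule B.omod_imul[OF B.omod_O imageI[OF a(1)]])
  moreover have "nm A \<noteq> {0}"
  proof
    assume 0: "nm A = {0}"
    have "(a * tau a) * 1 \<in> nm A"
      unfolding nm_eq[OF AE] by (rule imulI[OF imageI[OF a(1)] B.O_one])
    then have "a * tau a = 0" unfolding 0 by simp
    then show False using a tau_eq_0[of a] AE by auto
  qed
  ultimately show ?thesis unfolding B.is_frac_def using e by blast
qed

text \<open>Over \<open>E\<close>, the element \<open>t = a \<tau>(b)\<close> satisfies \<open>t\<^sup>2 = s t - d\<close> with \<open>s\<close>, \<open>d\<close> in the ideal
  \<open>J\<close> generated by the norms and in \<open>J\<^sup>2\<close>, respectively. Hence \<open>T = J + (t)\<close> satisfies \<open>T\<^sup>2 = J T\<close>, so that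
  \<open>T = J\<close>.\<close>

lemma ext_nm:
  assumes A: "T.is_frac A" shows "ext (nm A) = A \<star> cj A"
proof
  have AE: "A \<subseteq> E" by (rule T.fracD(2)[OF A])
  define J where "J = ext (nm A)"
  have J: "T.is_frac J" unfolding J_def by (rule ext_frac[OF nm_frac[OF A]])
  note omJ = T.fracD(1)[OF J]
  have J_eq: "J = (\<lambda>x. x * tau x) ` A \<star> OE"
  proof -
    have "J = (\<lambda>x. x * tau x) ` A \<star> ext OK" unfolding J_def nm_eq[OF AE] ext_eq by (simp only: imul_assoc)
    then show ?thesis unfolding ext_OK .
  qed
  have omAA: "T.omod (A \<star> cj A)" using T.fracD(1)[OF T.frac_imul[OF A cj_frac[OF A]]] .
  show "ext (nm A) \<subseteq> A \<star> cj A" unfolding J_def[symmetric] unfolding J_eq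
  proof (rule imul_least)
    fix x r assume "x \<in> (\<lambda>x. x * tau x) ` A" "r \<in> OE"
    then show "x * r \<in> A \<star> cj A" using T.omod_mult[OF omAA, of r x] by (auto simp: imulI mult.commute)
  qed (rule imul_add)
  have nJ: "x * tau x \<in> J" if "x \<in> A" for x
    unfolding J_eq using imulI[of "x * tau x" _ 1 OE] that by auto
  have "a * tau b \<in> J" if ab: "a \<in> A" "b \<in> A" for a b
  proof -
    have abE: "a \<in> E" "b \<in> E" using ab AE by auto
    define t s d where "t = a * tau b" and "s = a * tau b + b * tau a" and "d = (a * tau a) * (b * tau b)"
    \<comment> \<open>Polarization: s is the norm of a + b minus the norms of a and b.\<close>
    have "(a + b) * tau (a + b) - a * tau a - b * tau b \<in> J"
      using nJ[OF T.omod_add[OF T.fracD(1)[OF A] ab]] nJ[OF ab(1)] nJ[OF ab(2)] T.omod_diff[OF omJ] by blast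
    then have s: "s \<in> J" unfolding s_def tau_add[OF abE] by (simp add: algebra_simps)
    have d: "d \<in> J \<star> J" unfolding d_def using nJ ab by (intro imulI)
    have t2: "t * t = s * t - d" unfolding t_def s_def d_def by (simp add: algebra_simps)
    define T where "T = {j + r * t | j r. j \<in> J \<and> r \<in> OE}"
    have JT: "J \<subseteq> T" unfolding T_def
    proof
      fix j assume "j \<in> J"
      then show "j \<in> {j + r * t | j r. j \<in> J \<and> r \<in> OE}" by (intro CollectI exI[of _ j] exI[of _ 0]) simp
    qed
    have tT: "t \<in> T" unfolding T_def using T.omod_zero[OF omJ] T.O_one
      by (intro CollectI exI[of _ 0] exI[of _ 1]) simp
    have tE: "t \<in> E" unfolding t_def using abE tau_E T.E_mult by blast
    have omT: "T.omod T" unfolding T.omod_def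
    proof (intro conjI ballI)
      show "0 \<in> T" using JT T.omod_zero[OF omJ] by blast
      fix x y assume "x \<in> T" "y \<in> T"
      then obtain j r k u where xy: "x = j + r * t" "y = k + u * t" "j \<in> J" "k \<in> J" "r \<in> OE" "u \<in> OE"
        unfolding T_def by blast
      then have "x + y = (j + k) + (r + u) * t" by (simp add: algebra_simps)
      then show "x + y \<in> T" unfolding T_def using T.omod_add[OF omJ xy(3,4)] T.O_add[OF xy(5,6)] by blast
    next
      fix c x assume c: "c \<in> OE" and "x \<in> T"
      then obtain j r where x: "x = j + r * t" "j \<in> J" "r \<in> OE" unfolding T_def by blast
      then have "c * x = c * j + (c * r) * t" by (simp add: algebra_simps)
      then show "c * x \<in> T" unfolding T_def using T.omod_mult[OF omJ c x(2)] T.O_mult[OF c x(3)] by blast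
    qed
    obtain e where e: "e \<in> OE" "e \<noteq> 0" "\<forall>x\<in>J. e * x \<in> OE" using J unfolding T.is_frac_def by blast
    obtain m :: int where m: "m \<noteq> 0" "of_int m * t \<in> OE" using T.integral_multiple[OF tE] .
    have "\<forall>x\<in>T. (of_int m * e) * x \<in> OE"
    proof
      fix x assume "x \<in> T"
      then obtain j r where x: "x = j + r * t" "j \<in> J" "r \<in> OE" unfolding T_def by blast
      have "of_int m * (e * j) + (e * r) * (of_int m * t) \<in> OE"
        using T.O_add[OF T.O_mult[OF T.O_of_int e(3)[rule_format, OF x(2)]] T.O_mult[OF T.O_mult[OF e(1) x(3)] m(2)]] .
      then show "(of_int m * e) * x \<in> OE" unfolding x(1) by (simp add: algebra_simps)
    qed
    moreover have "of_int m * e \<in> OE" "of_int m * e \<noteq> 0" using T.O_mult[OF T.O_of_int e(1)] m(1) e(2) by auto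
    moreover have "T \<subseteq> E" unfolding T_def using T.fracD(2)[OF J] tE T.O_E T.E_add T.E_mult by blast
    moreover have "T \<noteq> {0}" using JT T.omod_nonzero[OF T.fracD(1,3)[OF J]] by blast
    ultimately have T: "T.is_frac T" unfolding T.is_frac_def using omT by blast
    have JTf: "T.omod (J \<star> T)" using T.fracD(1)[OF T.frac_imul[OF J T]] .
    have "T \<star> T \<subseteq> J \<star> T"
    proof (rule imul_least)
      fix x y assume "x \<in> T" and y: "y \<in> T"
      then obtain j r where x: "x = j + r * t" "j \<in> J" "r \<in> OE" unfolding T_def by blast
      obtain k u where y': "y = k + u * t" "k \<in> J" "u \<in> OE" using y unfolding T_def by blast
      have "d \<in> J \<star> T" using d imul_mono[OF order_refl JT] by blast
      then have "t * t \<in> J \<star> T" unfolding t2 using T.omod_diff[OF JTf] imulI[OF s tT] by blast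
      then have "(r * u) * (t * t) \<in> J \<star> T" using T.omod_mult[OF JTf T.O_mult[OF x(3) y'(3)]] by blast
      moreover have "j * y \<in> J \<star> T" by (rule imulI[OF x(2) y])
      moreover have "r * (k * t) \<in> J \<star> T" using T.omod_mult[OF JTf x(3) imulI[OF y'(2) tT]] .
      moreover have "x * y = j * y + r * (k * t) + (r * u) * (t * t)"
        unfolding x(1) y'(1) by (simp add: algebra_simps)
      ultimately show "x * y \<in> J \<star> T" using imul_add by metis
    qed (rule imul_add)
    moreover have "J \<star> T \<subseteq> T \<star> T" by (rule imul_mono[OF JT order_refl])
    ultimately have "T \<star> T = T \<star> J" using imul_commute by blast
    then have "T = J" using T.imul_cancel[OF T T J] by blast
    then show ?thesis using tT unfolding t_def by blast
  qed
  then have "A \<star> cj A \<subseteq> J" using T.omod_add[OF omJ] by (intro imul_least) auto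
  then show "A \<star> cj A \<subseteq> ext (nm A)" unfolding J_def .
qed

text \<open>After extension the norm is A \<tau>(A), which is visibly multiplicative, and
  \<open>ext_inj\<close> brings the identity back to K.\<close>

lemma nm_imul:
  assumes A: "T.is_frac A" and C: "T.is_frac C" shows "nm (A \<star> C) = nm A \<star> nm C"
proof (rule ext_inj)
  have "ext (nm (A \<star> C)) = (A \<star> C) \<star> (cj A \<star> cj C)"
    using ext_nm[OF T.frac_imul[OF A C]] cj_imul[OF T.fracD(2)[OF A] T.fracD(2)[OF C]] by simp
  also have "\<dots> = (A \<star> cj A) \<star> (C \<star> cj C)" by (simp only: imul_ac)
  also have "\<dots> = ext (nm A \<star> nm C)" using ext_nm[OF A] ext_nm[OF C] ext_imul by simp
  finally show "ext (nm (A \<star> C)) = ext (nm A \<star> nm C)" .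
qed (use A C nm_frac T.frac_imul B.frac_imul in auto)

lemma nm_hom: "nm \<in> hom (ideal_group E) (ideal_group K)"
  using nm_frac nm_imul by (auto simp: hom_def)

lemma nm_ext: assumes A: "B.is_frac A" shows "nm (ext A) = A \<star> A"
proof (rule ext_inj)
  show "ext (nm (ext A)) = ext (A \<star> A)"
    using ext_nm[OF ext_frac[OF A]] cj_ext[OF B.fracD(2)[OF A]] ext_imul by simp
qed (use A nm_frac ext_frac B.frac_imul in auto)

text \<open>If P were fixed, its norm would extend to the square of P and so be divisible by the
  prime below P. Then Q, which lies over the same prime, would divide the square of P, and this is
  impossible for another prime.\<close>

lemma cj_ne_if_split:
  assumes P: "P \<in> prime_ideals E" and Q: "Q \<in> prime_ideals E" "Q \<noteq> P" "below Q = below P"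
  shows "cj P \<noteq> P"
proof
  assume "cj P = P"
  then have eq: "ext (nm P) = P \<star> P" using ext_nm[OF T.prime_frac[OF P]] by simp
  note fr = T.prime_frac[OF P]
  have "T.val P (ext (nm P)) = 2" unfolding eq using T.val_imul[OF P fr fr] T.val_self[OF P] by simp
  then have "B.val (below P) (nm P) \<noteq> 0" using val_ext[OF P nm_frac[OF fr]] by auto
  moreover have "T.val Q (ext (below Q)) > 0" by (rule ext_below_pos[OF Q(1)])
  ultimately have "T.val Q (ext (nm P)) \<noteq> 0" using val_ext[OF Q(1) nm_frac[OF fr]] Q(3) by simp
  moreover have "T.val Q (ext (nm P)) = 0"
    unfolding eq using T.val_imul[OF Q(1) fr fr] T.val_other_prime[OF Q(1) P Q(2)] by simp
  ultimately show False by simp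
qed

end

section \<open>Degree two: factorization of split primes and choice of a square root\<close>

context nf_ext_degree
begin

text \<open>Both primes divide the extended prime, and a proper cofactor D would give a chain of
  three steps from the unit ideal through P and P Q, exceeding the bound 2.\<close>

lemma quadratic_split:
  assumes n: "n = 2" and P: "P \<in> prime_ideals E" and Q: "Q \<in> prime_ideals E" "Q \<noteq> P" "below Q = below P"
  shows "ext (below P) = P \<star> Q"
proof -
  let ?A = "ext (below P)"
  have I: "T.iideal ?A" by (rule ext_iideal[OF B.primeD(1)[OF below_prime[OF P]]])
  note fr = T.iidealD(4)[OF I] T.prime_frac[OF P] T.prime_frac[OF Q(1)]
  note PI = T.primeD(1)[OF P] and QI = T.primeD(1)[OF Q(1)]
  define C where "C = ?A \<star> inv\<^bsub>ideal_group E\<^esub> P"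
  have C: "T.iideal C" unfolding C_def
    by (rule T.iideal_divide[OF fr(1,2) ext_below_subset[OF P]])
  have CP: "C \<star> P = ?A" unfolding C_def by (rule T.imul_inv_cancel'[OF fr(1,2)])
  have "T.val Q C = T.val Q ?A"
    unfolding C_def using T.val_imul[OF Q(1) fr(1) T.frac_inv[OF fr(2)]] T.val_inv[OF Q(1) fr(2)]
      T.val_other_prime[OF Q(1) P Q(2)] by simp
  then have "C \<subseteq> Q" using ext_below_pos[OF Q(1)] Q(3) T.val_pos_iff[OF Q(1) C] by simp
  define D where "D = C \<star> inv\<^bsub>ideal_group E\<^esub> Q"
  have D: "T.iideal D" unfolding D_def by (rule T.iideal_divide[OF T.iidealD(4)[OF C] fr(3) \<open>C \<subseteq> Q\<close>])
  have DQ: "D \<star> Q = C" unfolding D_def by (rule T.imul_inv_cancel'[OF T.iidealD(4)[OF C] fr(3)])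
  have eq: "?A = (P \<star> Q) \<star> D" unfolding CP[symmetric] DQ[symmetric] by (simp only: imul_ac)
  have "D = OE"
  proof (rule ccontr)
    assume D1: "D \<noteq> OE"
    define I where "I = (\<lambda>i::nat. if i = 0 then OE else if i = 1 then P else if i = 2 then P \<star> Q else ?A)"
    have "3 \<le> n"
    proof (rule ideal_chain_length[OF below_prime[OF P], of 3 I])
      show "T.iideal (I i)" for i
        unfolding I_def using T.iideal_O PI T.iideal_imul[OF PI QI] I by simp
      have 0: "P \<subset> OE" using T.iidealD(2)[OF PI] T.prime_ne_O[OF P] by blast
      have 1: "P \<star> Q \<subset> P" by (rule T.imul_psubset[OF PI QI T.prime_ne_O[OF Q(1)]])
      have 2: "?A \<subset> P \<star> Q" unfolding eq by (rule T.imul_psubset[OF T.iideal_imul[OF PI QI] D D1])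
      show "I (Suc i) \<subset> I i" if i3: "i < 3" for i
      proof -
        consider "i = 0" | "i = 1" | "i = 2" using i3 by linarith
        then show ?thesis unfolding I_def using 0 1 2 by cases auto
      qed
      show "ext (below P) \<subseteq> I 3" unfolding I_def by simp
    qed
    then show False using n by simp
  qed
  then show ?thesis using eq T.imul_one(1)[OF T.frac_imul[OF fr(2,3)]] by simp
qed

lemma quadratic_basis:
  assumes n: "n = 2" and x: "x \<in> E" "x \<notin> K" and y: "y \<in> E"
  shows "\<exists>u\<in>K. \<exists>v\<in>K. y = u + v * x"
proof -
  define f where "f = (\<lambda>i::nat. if i = 0 then 1 else if i = 1 then x else y)"
  have fE: "f i \<in> E" for i unfolding f_def using x y by simp
  have nm: "n < 3" using n by simp
  obtain c where c: "\<forall>i<3. c i \<in> K" "\<exists>i<3. c i \<noteq> 0" "(\<Sum>i<3. c i * f i) = 0"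
    by (rule dependence_if_dimension_less[OF B.subfield dimension, of 3 f], rule fE, rule nm, rule that)
  have cK: "c 0 \<in> K" "c 1 \<in> K" "c 2 \<in> K" using c(1) by auto
  have rel: "c 0 + c 1 * x + c 2 * y = 0"
    using c(3) unfolding f_def by (simp add: eval_nat_numeral)
  have "c 2 \<noteq> 0"
  proof
    assume c2: "c 2 = 0"
    have "c 1 = 0"
    proof (rule ccontr)
      assume "c 1 \<noteq> 0"
      then have "x = (- c 0) / c 1" using rel c2 by (simp add: field_simps add_eq_0_iff)
      then show False using x(2) B.E_divide[OF B.E_uminus[OF cK(1)] cK(2)] by simp
    qed
    then have "c i = 0" if "i < 3" for i
      using rel c2 that by (auto simp: less_Suc_eq eval_nat_numeral)
    then show False using c(2) by blast
  qed
  moreover have "c 2 * y = - (c 0 + c 1 * x)" using rel by (simp add: add_eq_0_iff)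
  ultimately have "y = - (c 0 + c 1 * x) / c 2" by (metis nonzero_mult_div_cancel_left)
  also have "\<dots> = (- c 0) / c 2 + ((- c 1) / c 2) * x" by (simp add: add_divide_distrib diff_divide_distrib)
  finally have "y = (- c 0) / c 2 + ((- c 1) / c 2) * x" .
  then show ?thesis using B.E_divide[OF B.E_uminus[OF cK(1)] cK(3)] B.E_divide[OF B.E_uminus[OF cK(2)] cK(3)] by blast
qed

text \<open>Completing the square in x^2 = u + v x, for any x outside K.\<close>

lemma quadratic_generator:
  assumes n: "n = 2"
  obtains \<theta> where "\<theta> \<in> E" "\<theta> \<notin> K" "\<theta>\<^sup>2 \<in> K"
proof -
  have "K \<noteq> E"
  proof
    assume "K = E"
    then have "CR.dimension 1 K E" using CR.dimension_one[OF B.subfield] by simp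
    then show False using CR.dimension_is_inj[OF B.subfield dimension] n by force
  qed
  then obtain x where x: "x \<in> E" "x \<notin> K" using K_sub_E by blast
  obtain u v where uv: "u \<in> K" "v \<in> K" "x * x = u + v * x"
    using quadratic_basis[OF n x T.E_mult[OF x(1,1)]] by blast
  have v2: "v / 2 \<in> K" using B.E_divide[OF uv(2), of 2] B.E_of_nat[of 2] by simp
  show ?thesis
  proof (rule that[of "x - v / 2"])
    show "x - v / 2 \<in> E" using x(1) v2 K_sub_E T.E_diff by blast
    show "x - v / 2 \<notin> K" using B.E_add[OF _ v2, of "x - v / 2"] x(2) by auto
    have "(x - v / 2)\<^sup>2 = x * x - v * x + (v / 2) * (v / 2)" by (simp add: power2_eq_square algebra_simps)
    also have "\<dots> = u + (v / 2) * (v / 2)" unfolding uv(3) by simp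
    finally have "(x - v / 2)\<^sup>2 = u + (v / 2) * (v / 2)" .
    then show "(x - v / 2)\<^sup>2 \<in> K" using B.E_add[OF uv(1) B.E_mult[OF v2 v2]] by simp
  qed
qed

end

section \<open>Elementary abelian groups\<close>

text \<open>Exponents are integers and not residues, so that the same products can be formed in the
  torsion-free group of ideals and in its quotients.\<close>

definition pow_prod :: "('a, 'm) monoid_scheme \<Rightarrow> ('i \<Rightarrow> 'a) \<Rightarrow> 'i set \<Rightarrow> ('i \<Rightarrow> int) \<Rightarrow> 'a" where
  "pow_prod G b I a = finprod G (\<lambda>i. b i [^]\<^bsub>G\<^esub> a i) I"

context comm_group
begin

lemma pow_prod_closed: "b \<in> I \<rightarrow> carrier G \<Longrightarrow> pow_prod G b I a \<in> carrier G"
  unfolding pow_prod_def by (rule finprod_closed) auto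

lemma pow_prod_cong:
  assumes "b \<in> I \<rightarrow> carrier G" "\<And>i. i \<in> I \<Longrightarrow> b i [^] a i = b i [^] c i"
  shows "pow_prod G b I a = pow_prod G b I c"
  unfolding pow_prod_def by (rule finprod_cong') (use assms in auto)

lemma pow_prod_add:
  assumes "b \<in> I \<rightarrow> carrier G"
  shows "pow_prod G b I (\<lambda>i. a i + c i) = pow_prod G b I a \<otimes> pow_prod G b I c"
proof -
  have "pow_prod G b I (\<lambda>i. a i + c i) = finprod G (\<lambda>i. b i [^] a i \<otimes> b i [^] c i) I"
    unfolding pow_prod_def by (rule finprod_cong') (use Pi_mem[OF assms] in \<open>auto simp: int_pow_mult\<close>)
  also have "\<dots> = pow_prod G b I a \<otimes> pow_prod G b I c"
    unfolding pow_prod_def by (rule finprod_multf) (use assms in auto)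
  finally show ?thesis .
qed

lemma pow_prod_zero: "pow_prod G b I (\<lambda>i. 0) = \<one>"
  unfolding pow_prod_def by simp

lemma pow_prod_minus:
  assumes "b \<in> I \<rightarrow> carrier G"
  shows "pow_prod G b I (\<lambda>i. - a i) = inv (pow_prod G b I a)"
proof -
  have "pow_prod G b I (\<lambda>i. - a i) \<otimes> pow_prod G b I a = \<one>"
    using pow_prod_add[OF assms, of "\<lambda>i. - a i" a] by (simp add: pow_prod_zero)
  then show ?thesis using pow_prod_closed[OF assms] by (simp add: inv_equality)
qed

lemma pow_prod_single:
  assumes "finite I" "b \<in> I \<rightarrow> carrier G" "j \<in> I"
  shows "pow_prod G b I (\<lambda>i. if i = j then k else 0) = b j [^] k"
proof -
  have "pow_prod G b I (\<lambda>i. if i = j then k else 0) = finprod G (\<lambda>i. if j = i then b i [^] k else \<one>) I"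
    unfolding pow_prod_def by (rule finprod_cong') (use Pi_mem[OF assms(2)] in auto)
  also have "\<dots> = b j [^] k" by (rule finprod_singleton) (use assms Pi_mem[OF assms(2)] in auto)
  finally show ?thesis .
qed

lemma pow_prod_reindex:
  assumes "bij_betw e J I" "b \<in> I \<rightarrow> carrier G"
  shows "pow_prod G (b \<circ> e) J (a \<circ> e) = pow_prod G b I a"
proof -
  have "inj_on e J" "e ` J = I" using assms(1) by (auto simp: bij_betw_def)
  then show ?thesis
    unfolding pow_prod_def using finprod_reindex[of "\<lambda>i. b i [^] a i" e J] Pi_mem[OF assms(2)] by auto
qed

lemma pow_prod_Plus:
  assumes "finite I" "finite J" "b \<in> I \<rightarrow> carrier G" "c \<in> J \<rightarrow> carrier G"
  shows "pow_prod G (case_sum b c) (I <+> J) a = pow_prod G b I (a \<circ> Inl) \<otimes> pow_prod G c J (a \<circ> Inr)"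
proof -
  let ?f = "\<lambda>i. case_sum b c i [^] a i"
  have "finprod G ?f (Inl ` I \<union> Inr ` J) = finprod G ?f (Inl ` I) \<otimes> finprod G ?f (Inr ` J)"
    by (rule finprod_Un_disjoint) (use assms Pi_mem[OF assms(3)] Pi_mem[OF assms(4)] in auto)
  also have "finprod G ?f (Inl ` I) = finprod G (\<lambda>i. ?f (Inl i)) I"
    by (rule finprod_reindex) (use assms Pi_mem[OF assms(3)] Pi_mem[OF assms(4)] in auto)
  also have "finprod G ?f (Inr ` J) = finprod G (\<lambda>i. ?f (Inr i)) J"
    by (rule finprod_reindex) (use assms Pi_mem[OF assms(3)] Pi_mem[OF assms(4)] in auto)
  finally show ?thesis unfolding pow_prod_def Plus_def by simp
qed

end

lemma hom_pow_prod:
  assumes "comm_group G" "comm_group H" "h \<in> hom G H" "b \<in> I \<rightarrow> carrier G" "finite I"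
  shows "h (pow_prod G b I a) = pow_prod H (h \<circ> b) I a"
proof -
  interpret G: comm_group G by fact
  interpret H: comm_group H by fact
  interpret h: group_hom G H h by unfold_locales fact
  show ?thesis using assms(5,4)
  proof (induction I rule: finite_induct)
    case (insert i I)
    then have hb: "h \<circ> b \<in> I \<rightarrow> carrier H" "h (b i) \<in> carrier H" using h.hom_closed[OF Pi_mem[of b I "\<lambda>_. carrier G"]] by auto
    have "h (pow_prod G b (insert i I) a) = h (b i [^]\<^bsub>G\<^esub> a i \<otimes>\<^bsub>G\<^esub> pow_prod G b I a)"
      unfolding pow_prod_def using insert by (subst G.finprod_insert) auto
    also have "\<dots> = h (b i) [^]\<^bsub>H\<^esub> a i \<otimes>\<^bsub>H\<^esub> pow_prod H (h \<circ> b) I a"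
      using insert G.pow_prod_closed[of b I a] h.hom_int_pow by (simp add: o_def)
    also have "\<dots> = pow_prod H (h \<circ> b) (insert i I) a"
      unfolding pow_prod_def using insert(1,2) hb(2) Pi_mem[OF hb(1)] by (subst H.finprod_insert) auto
    finally show ?case .
  qed (simp add: pow_prod_def)
qed

subsection \<open>Groups with a basis over the prime field\<close>

text \<open>Independence is phrased by divisibility of integer exponents, the form in which
  valuations deliver it. The isomorphism with \<open>Fp_power\<close> and the vector space dimension
  are both derived from this locale.\<close>

locale Fp_basis = comm_group Q for Q :: "('a, 'm) monoid_scheme" (structure) +
  fixes p :: nat and I :: "'i set" and b :: "'i \<Rightarrow> 'a"
  assumes prime_p: "Factorial_Ring.prime p"
    and fin: "finite I" and b: "b \<in> I \<rightarrow> carrier Q"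
    and pow_p: "x \<in> carrier Q \<Longrightarrow> x [^] p = \<one>"
    and generates: "x \<in> carrier Q \<Longrightarrow> \<exists>a. x = pow_prod Q b I a"
    and independent: "pow_prod Q b I a = \<one> \<Longrightarrow> i \<in> I \<Longrightarrow> int p dvd a i"
begin

lemma p_pos: "p > 0" using prime_p prime_gt_0_nat by blast

lemma pow_mod: "x \<in> carrier Q \<Longrightarrow> x [^] (k mod int p) = x [^] (k :: int)"
proof -
  assume x: "x \<in> carrier Q"
  have "x [^] k = x [^] (int p * (k div int p) + k mod int p)" by (simp only: mult_div_mod_eq)
  also have "\<dots> = (x [^] int p) [^] (k div int p) \<otimes> x [^] (k mod int p)"
    using x by (simp only: int_pow_mult int_pow_pow)
  also have "x [^] int p = \<one>" using pow_p[OF x] by (simp only: int_pow_int)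
  also have "\<one> [^] (k div int p) \<otimes> x [^] (k mod int p) = x [^] (k mod int p)" using x by simp
  finally show ?thesis by (rule sym)
qed

lemma pow_prod_eq_iff:
  "pow_prod Q b I a = pow_prod Q b I c \<longleftrightarrow> (\<forall>i\<in>I. a i mod int p = c i mod int p)"
proof
  assume eq: "pow_prod Q b I a = pow_prod Q b I c"
  have "pow_prod Q b I (\<lambda>i. a i + - c i) = \<one>"
    unfolding pow_prod_add[OF b, of a "\<lambda>i. - c i"] pow_prod_minus[OF b] eq
    using pow_prod_closed[OF b] by simp
  then show "\<forall>i\<in>I. a i mod int p = c i mod int p"
    using independent by (auto simp: mod_eq_dvd_iff)
next
  assume *: "\<forall>i\<in>I. a i mod int p = c i mod int p"
  show "pow_prod Q b I a = pow_prod Q b I c"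
  proof (rule pow_prod_cong[OF b])
    fix i assume i: "i \<in> I"
    then have "b i \<in> carrier Q" using b by auto
    then show "b i [^] a i = b i [^] c i" using pow_mod[of "b i" "a i"] pow_mod[of "b i" "c i"] * i by simp
  qed
qed

lemma reindex:
  assumes "bij_betw e J I" shows "Fp_basis Q p J (b \<circ> e)"
proof (unfold_locales)
  show "Factorial_Ring.prime p" by (rule prime_p)
  show "finite J" using bij_betw_finite[OF assms] fin by simp
  show "b \<circ> e \<in> J \<rightarrow> carrier Q" using b bij_betw_apply[OF assms] by auto
  show "x \<in> carrier Q \<Longrightarrow> x [^] p = \<one>" for x by (rule pow_p)
  show "\<exists>a. x = pow_prod Q (b \<circ> e) J a" if "x \<in> carrier Q" for x
    using generates[OF that] pow_prod_reindex[OF assms b] by metis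
  fix a i assume a: "pow_prod Q (b \<circ> e) J a = \<one>" and i: "i \<in> J"
  define c where "c = a \<circ> inv_into J e"
  have inj: "inj_on e J" using assms by (simp add: bij_betw_def)
  have "pow_prod Q (b \<circ> e) J (c \<circ> e) = pow_prod Q (b \<circ> e) J a"
  proof (rule pow_prod_cong)
    show "b \<circ> e \<in> J \<rightarrow> carrier Q" using b bij_betw_apply[OF assms] by auto
  qed (simp add: c_def inv_into_f_f[OF inj])
  then have "pow_prod Q b I c = \<one>" using a pow_prod_reindex[OF assms b] by simp
  then have "int p dvd c (e i)" by (rule independent[OF _ bij_betw_apply[OF assms i]])
  then show "int p dvd a i" unfolding c_def using inv_into_f_f[OF inj i] by simp
qed

end

lemma residue_ring_simps [simp]:
  "carrier (residue_ring m) = {0..m - 1}" "x \<oplus>\<^bsub>residue_ring m\<^esub> y = (x + y) mod m"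
  "x \<otimes>\<^bsub>residue_ring m\<^esub> y = (x * y) mod m" "\<one>\<^bsub>residue_ring m\<^esub> = 1" "\<zero>\<^bsub>residue_ring m\<^esub> = 0"
  by (simp_all add: residue_ring_def)

lemma residue_field:
  assumes "Factorial_Ring.prime p" shows "field (residue_ring (int p))"
proof -
  interpret residues_prime p "residue_ring (int p)" by unfold_locales (use assms in simp_all)
  show ?thesis by (rule is_field)
qed

lemma residue_comm_group:
  assumes "Factorial_Ring.prime p" shows "comm_group (add_monoid (residue_ring (int p)))"
proof -
  interpret field "residue_ring (int p)" by (rule residue_field[OF assms])
  show ?thesis by (rule a_comm_group)
qed

lemma Fp_power_group:
  assumes "Factorial_Ring.prime p" shows "group (Fp_power p m)"
  unfolding Fp_power_def using comm_group.axioms(2)[OF residue_comm_group[OF assms]] by (simp add: product_group)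

lemma Fp_power_simps [simp]:
  "carrier (Fp_power p m) = {1..m} \<rightarrow>\<^sub>E {0..int p - 1}"
  "f \<otimes>\<^bsub>Fp_power p m\<^esub> g = (\<lambda>i\<in>{1..m}. (f i + g i) mod int p)"
  unfolding Fp_power_def by simp_all

context Fp_basis
begin

text \<open>The map goes from exponent vectors to the group, where its definition needs no choice of
  a representation, and is inverted at the end.\<close>

lemma iso_Fp_power: "Q \<cong> Fp_power p (card I)"
proof -
  define m where "m = card I"
  obtain e where e: "bij_betw e {1..m} I"
    using finite_same_card_bij[of "{1..m}" I] fin unfolding m_def by auto
  interpret R: Fp_basis Q p "{1..m}" "b \<circ> e" by (rule reindex[OF e])
  define \<phi> where "\<phi> = pow_prod Q (b \<circ> e) {1..m}"
  have "\<phi> \<in> iso (Fp_power p m) Q"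
  proof (rule isoI)
    show "\<phi> \<in> hom (Fp_power p m) Q"
    proof (rule homI)
      fix f g assume "f \<in> carrier (Fp_power p m)" "g \<in> carrier (Fp_power p m)"
      have "\<phi> (f \<otimes>\<^bsub>Fp_power p m\<^esub> g) = pow_prod Q (b \<circ> e) {1..m} (\<lambda>i. f i + g i)"
        unfolding \<phi>_def R.pow_prod_eq_iff by simp
      then show "\<phi> (f \<otimes>\<^bsub>Fp_power p m\<^esub> g) = \<phi> f \<otimes> \<phi> g" unfolding \<phi>_def pow_prod_add[OF R.b] .
    qed (use pow_prod_closed[OF R.b] in \<open>auto simp: \<phi>_def\<close>)
    show "bij_betw \<phi> (carrier (Fp_power p m)) (carrier Q)"
      unfolding bij_betw_def
    proof
      show "inj_on \<phi> (carrier (Fp_power p m))"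
      proof (rule inj_onI)
        fix f g assume f: "f \<in> carrier (Fp_power p m)" and g: "g \<in> carrier (Fp_power p m)" and "\<phi> f = \<phi> g"
        then have "\<forall>i\<in>{1..m}. f i mod int p = g i mod int p" unfolding \<phi>_def R.pow_prod_eq_iff by simp
        moreover have "f i mod int p = f i" "g i mod int p = g i" if "i \<in> {1..m}" for i
          
          using PiE_mem[of f "{1..m}" "\<lambda>_. {0..int p - 1}" i] PiE_mem[of g "{1..m}" "\<lambda>_. {0..int p - 1}" i] f g that
          by auto
        ultimately show "f = g" using f g by (intro PiE_ext[of f "{1..m}" _ g]) auto
      qed
      show "\<phi> ` carrier (Fp_power p m) = carrier Q"
      proof
        show "\<phi> ` carrier (Fp_power p m) \<subseteq> carrier Q" unfolding \<phi>_def using pow_prod_closed[OF R.b] by blast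
        show "carrier Q \<subseteq> \<phi> ` carrier (Fp_power p m)"
        proof
          fix x assume "x \<in> carrier Q"
          then obtain a where a: "x = pow_prod Q (b \<circ> e) {1..m} a" using R.generates by blast
          define f where "f = (\<lambda>i\<in>{1..m}. a i mod int p)"
          have "f \<in> carrier (Fp_power p m)" unfolding f_def using p_pos by auto
          moreover have "\<phi> f = x" unfolding \<phi>_def a R.pow_prod_eq_iff f_def by simp
          ultimately show "x \<in> \<phi> ` carrier (Fp_power p m)" by blast
        qed
      qed
    qed
  qed
  then have "Fp_power p m \<cong> Q" unfolding is_iso_def by blast
  then show ?thesis unfolding m_def using group.iso_sym[OF Fp_power_group[OF prime_p]] by blast
qed

lemma power_module_simps [simp]:
  "carrier (power_module Q) = carrier Q" "x \<oplus>\<^bsub>power_module Q\<^esub> y = x \<otimes> y" "\<zero>\<^bsub>power_module Q\<^esub> = \<one>"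
  "k \<odot>\<^bsub>power_module Q\<^esub> x = x [^] k"
  by (simp_all add: power_module_def)

lemma abelian_group_power_module: "abelian_group (power_module Q)"
proof (rule abelian_groupI)
  fix x assume "x \<in> carrier (power_module Q)"
  then show "\<exists>y\<in>carrier (power_module Q). y \<oplus>\<^bsub>power_module Q\<^esub> x = \<zero>\<^bsub>power_module Q\<^esub>"
    by (intro bexI[of _ "inv x"]) simp_all
next
  fix x y assume "x \<in> carrier (power_module Q)" "y \<in> carrier (power_module Q)"
  then show "x \<oplus>\<^bsub>power_module Q\<^esub> y = y \<oplus>\<^bsub>power_module Q\<^esub> x" by (simp add: m_comm)
qed (simp_all add: m_assoc)

lemma module_power_module: "module (residue_ring (int p)) (power_module Q)"
proof -
  interpret K: field "residue_ring (int p)" by (rule residue_field[OF prime_p])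
  show ?thesis
    by (rule moduleI[OF K.is_cring abelian_group_power_module])
      (simp_all add: pow_mod int_pow_mult int_pow_mult_distrib m_comm int_pow_pow mult.commute)
qed

lemma finsum_power_module:
  "f \<in> A \<rightarrow> carrier Q \<Longrightarrow> finsum (power_module Q) f A = finprod Q f A"
proof (induction A rule: infinite_finite_induct)
  case (insert x A)
  interpret M: abelian_group "power_module Q" by (rule abelian_group_power_module)
  show ?case using insert by (subst M.finsum_insert) auto
next
  case (infinite A)
  interpret M: abelian_group "power_module Q" by (rule abelian_group_power_module)
  show ?case using infinite by simp
next
  case empty
  interpret M: abelian_group "power_module Q" by (rule abelian_group_power_module)
  show ?case by simp
qed

text \<open>Bases of vector spaces are sets; injectivity makes the image of the family as large as
  its index set, so that the dimension is \<open>card I\<close>.\<close>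

lemma b_inj: "inj_on b I"
proof (rule inj_onI, rule ccontr)
  fix i j assume ij: "i \<in> I" "j \<in> I" "b i = b j" "i \<noteq> j"
  then have bi: "b i \<in> carrier Q" using b by auto
  have "pow_prod Q b I (\<lambda>k. if k = i then 1 else 0) = pow_prod Q b I (\<lambda>k. if k = j then 1 else 0)"
    using pow_prod_single[OF fin b ij(1), of 1] pow_prod_single[OF fin b ij(2), of 1] ij(3) by simp
  then have "(1::int) mod int p = 0 mod int p" using pow_prod_eq_iff ij by fastforce
  then show False using prime_p prime_gt_1_nat[OF prime_p] by simp
qed

lemma has_dim: "has_Fp_dim p Q (card I)"
proof -
  interpret K: field "residue_ring (int p)" by (rule residue_field[OF prime_p])
  interpret V: vectorspace "residue_ring (int p)" "power_module Q"
    by (intro vectorspace.intro module_power_module K.field_axioms)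
  let ?B = "b ` I"
  have B: "finite ?B" "?B \<subseteq> carrier (power_module Q)" using fin b by auto
  have lin: "V.lincomb a ?B = pow_prod Q b I (\<lambda>i. a (b i))" for a
  proof -
    have "V.lincomb a ?B = finprod Q (\<lambda>v. v [^] a v) ?B"
      unfolding V.lincomb_def using finsum_power_module[of "\<lambda>v. v [^] a v" ?B] b by auto
    also have "\<dots> = finprod Q (\<lambda>i. b i [^] a (b i)) I"
      by (rule finprod_reindex[OF _ b_inj]) (use b in auto)
    finally show ?thesis unfolding pow_prod_def .
  qed
  have "V.gen_set ?B"
  proof
    show "V.span ?B \<subseteq> carrier (power_module Q)" by (rule V.span_is_subset2[OF B(2)])
    show "carrier (power_module Q) \<subseteq> V.span ?B"
    proof
      fix x assume "x \<in> carrier (power_module Q)"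
      then obtain a where a: "x = pow_prod Q b I a" using generates by auto
      define c where "c = (\<lambda>v. a (inv_into I b v) mod int p)"
      have "V.lincomb c ?B = x" unfolding lin a pow_prod_eq_iff c_def using inv_into_f_f[OF b_inj] by simp
      moreover have "c \<in> ?B \<rightarrow> carrier (residue_ring (int p))" unfolding c_def using p_pos by auto
      ultimately show "x \<in> V.span ?B" using V.finite_span[OF B] by blast
    qed
  qed
  moreover have "V.lin_indpt ?B"
  proof (rule V.finite_lin_indpt2[OF B])
    fix a assume a: "a \<in> ?B \<rightarrow> carrier (residue_ring (int p))"
      and "V.lincomb a ?B = \<zero>\<^bsub>power_module Q\<^esub>"
    then have 1: "pow_prod Q b I (\<lambda>i. a (b i)) = \<one>" using lin by simp
    show "\<forall>v\<in>?B. a v = \<zero>\<^bsub>residue_ring (int p)\<^esub>"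
    proof
      fix v assume v: "v \<in> ?B"
      then have "int p dvd a v" using independent[OF 1] by auto
      moreover have "a v \<in> {0..int p - 1}" using a v by auto
      ultimately show "a v = \<zero>\<^bsub>residue_ring (int p)\<^esub>" 
        using zdvd_not_zless[of "a v" "int p"] by force
    qed
  qed
  ultimately have basis: "V.basis ?B" unfolding V.basis_def using B(2) by simp
  then have "V.dim = card ?B" by (rule V.dim_basis[OF B(1)])
  moreover have "V.fin_dim" unfolding V.fin_dim_def using basis B unfolding V.basis_def by blast
  ultimately show ?thesis
    unfolding has_Fp_dim_def using V.vectorspace_axioms card_image[OF b_inj] by simp
qed

end

lemma Fp_power_add: "Fp_power p (s + n) \<cong> Fp_power p s \<times>\<times> Fp_power p n"
proof -
  \<comment> \<open>The coordinates s + 1, ..., s + n are shifted down to 1, ..., n.\<close>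
  define \<phi> where "\<phi> = (\<lambda>f :: nat \<Rightarrow> int. (restrict f {1..s}, \<lambda>j\<in>{1..n}. f (s + j)))"
  have split: "i \<in> {1..s} \<or> (i - s \<in> {1..n} \<and> i = s + (i - s))" if "i \<in> {1..s + n}" for i :: nat
    using that by auto
  have "\<phi> \<in> iso (Fp_power p (s + n)) (Fp_power p s \<times>\<times> Fp_power p n)"
  proof (rule isoI)
    show "\<phi> \<in> hom (Fp_power p (s + n)) (Fp_power p s \<times>\<times> Fp_power p n)"
    proof (rule homI)
      fix f assume f: "f \<in> carrier (Fp_power p (s + n))"
      then have "f i \<in> {0..int p - 1}" if "i \<in> {1..s + n}" for i using that by auto
      then show "\<phi> f \<in> carrier (Fp_power p s \<times>\<times> Fp_power p n)" unfolding \<phi>_def by simp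
    next
      fix f g :: "nat \<Rightarrow> int"
      have "restrict (\<lambda>i\<in>{1..s + n}. (f i + g i) mod int p) {1..s} = (\<lambda>i\<in>{1..s}. (restrict f {1..s} i + restrict g {1..s} i) mod int p)"
        by (rule restrict_ext) auto
      moreover have "(\<lambda>j\<in>{1..n}. (\<lambda>i\<in>{1..s + n}. (f i + g i) mod int p) (s + j)) =
          (\<lambda>j\<in>{1..n}. ((\<lambda>j\<in>{1..n}. f (s + j)) j + (\<lambda>j\<in>{1..n}. g (s + j)) j) mod int p)"
        by (rule restrict_ext) auto
      ultimately show "\<phi> (f \<otimes>\<^bsub>Fp_power p (s + n)\<^esub> g) = \<phi> f \<otimes>\<^bsub>Fp_power p s \<times>\<times> Fp_power p n\<^esub> \<phi> g"
        unfolding \<phi>_def by (simp only: mult_DirProd Fp_power_simps)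
    qed
    show "bij_betw \<phi> (carrier (Fp_power p (s + n))) (carrier (Fp_power p s \<times>\<times> Fp_power p n))"
      unfolding bij_betw_def
    proof
      show "inj_on \<phi> (carrier (Fp_power p (s + n)))"
      proof (rule inj_onI)
        fix f g assume fg: "f \<in> carrier (Fp_power p (s + n))" "g \<in> carrier (Fp_power p (s + n))" "\<phi> f = \<phi> g"
        have 1: "f i = g i" if "i \<in> {1..s}" for i using fg(3) that unfolding \<phi>_def by (metis fst_conv restrict_apply')
        have 2: "f (s + j) = g (s + j)" if "j \<in> {1..n}" for j
          using fg(3) that unfolding \<phi>_def by (metis (mono_tags, lifting) snd_conv restrict_apply')
        have "f i = g i" if "i \<in> {1..s + n}" for i using split[OF that] 1 2 by metis
        then show "f = g" using fg(1,2) by (intro PiE_ext[of f "{1..s + n}" _ g]) auto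
      qed
      show "\<phi> ` carrier (Fp_power p (s + n)) = carrier (Fp_power p s \<times>\<times> Fp_power p n)"
      proof
        show "\<phi> ` carrier (Fp_power p (s + n)) \<subseteq> carrier (Fp_power p s \<times>\<times> Fp_power p n)"
          unfolding \<phi>_def by (auto simp: PiE_iff)
        show "carrier (Fp_power p s \<times>\<times> Fp_power p n) \<subseteq> \<phi> ` carrier (Fp_power p (s + n))"
        proof
          fix x assume "x \<in> carrier (Fp_power p s \<times>\<times> Fp_power p n)"
          then obtain g h where gh: "x = (g, h)" "g \<in> {1..s} \<rightarrow>\<^sub>E {0..int p - 1}" "h \<in> {1..n} \<rightarrow>\<^sub>E {0..int p - 1}"
            by auto
          define f where "f = (\<lambda>i\<in>{1..s + n}. if i \<le> s then g i else h (i - s))"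
          have "f \<in> {1..s + n} \<rightarrow>\<^sub>E {0..int p - 1}"
          proof (rule PiE_I)
            fix i assume i: "i \<in> {1..s + n}"
            show "f i \<in> {0..int p - 1}"
            proof (cases "i \<le> s")
              case True
              then show ?thesis using i gh(2) unfolding f_def by (auto simp: PiE_iff)
            next
              case False
              then have "i - s \<in> {1..n}" using i by auto
              then have "h (i - s) \<in> {0..int p - 1}" using gh(3) by (rule_tac PiE_mem)
              then show ?thesis using i False unfolding f_def by simp
            qed
          qed (auto simp: f_def)
          moreover have "restrict f {1..s} = g"
          proof
            fix i show "restrict f {1..s} i = g i"
              by (cases "i \<in> {1..s}") (use PiE_arb[OF gh(2), of i] in \<open>auto simp: f_def\<close>)
          qed
          moreover have "(\<lambda>j\<in>{1..n}. f (s + j)) = h"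
            using gh(3) unfolding f_def by (intro extensionalityI[of _ "{1..n}"]) (auto simp: PiE_iff)
          ultimately have "f \<in> carrier (Fp_power p (s + n))" "\<phi> f = x" unfolding \<phi>_def gh(1) by simp_all
          then show "x \<in> \<phi> ` carrier (Fp_power p (s + n))" by blast
        qed
      qed
    qed
  qed
  then show ?thesis unfolding is_iso_def by blast
qed

section \<open>Subquotients of abelian groups\<close>

locale subquotient = comm_group G for G :: "('a, 'm) monoid_scheme" (structure) +
  fixes D H :: "'a set"
  assumes D: "subgroup D G" and H: "subgroup H G" and HD: "H \<subseteq> D"
begin

text \<open>The coset is taken in the ambient group and does not depend on D. Subquotients with the
  same H share their classes, which \<open>kernel_eq\<close> exploits.\<close>

definition cls :: "'a \<Rightarrow> 'a set" where "cls a = H #> a"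

abbreviation QG :: "'a set monoid" where "QG \<equiv> G\<lparr>carrier := D\<rparr> Mod H"

lemma D_carrier: "x \<in> D \<Longrightarrow> x \<in> carrier G"
  using subgroup.subset[OF D] by blast

lemma H_carrier: "x \<in> H \<Longrightarrow> x \<in> carrier G"
  using subgroup.subset[OF H] by blast

lemma D_closed:
  "\<one> \<in> D" "x \<in> D \<Longrightarrow> y \<in> D \<Longrightarrow> x \<otimes> y \<in> D" "x \<in> D \<Longrightarrow> inv x \<in> D"
  using D by (auto simp: subgroup.one_closed subgroup.m_closed subgroup.m_inv_closed)

lemma H_closed:
  "\<one> \<in> H" "x \<in> H \<Longrightarrow> y \<in> H \<Longrightarrow> x \<otimes> y \<in> H" "x \<in> H \<Longrightarrow> inv x \<in> H"
  using H by (auto simp: subgroup.one_closed subgroup.m_closed subgroup.m_inv_closed)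

lemma Quot_carrier: "carrier QG = cls ` D"
  unfolding carrier_FactGroup by (simp add: r_coset_def cls_def)

lemma cls_eq_iff:
  assumes a: "a \<in> carrier G" and b: "b \<in> carrier G"
  shows "cls a = cls b \<longleftrightarrow> a \<otimes> inv b \<in> H"
proof
  assume eq: "cls a = cls b"
  have "a \<in> cls a" unfolding cls_def using H_closed(1) a by (force simp: r_coset_def)
  then obtain h where "h \<in> H" "a = h \<otimes> b" unfolding eq by (auto simp: cls_def r_coset_def)
  then show "a \<otimes> inv b \<in> H" using b H_carrier by (simp add: m_assoc)
next
  assume h: "a \<otimes> inv b \<in> H"
  have "a = (a \<otimes> inv b) \<otimes> b" using a b by (simp add: m_assoc)
  then have "cls a = (H #> (a \<otimes> inv b)) #> b"
    unfolding cls_def using coset_mult_assoc[OF subgroup.subset[OF H], of "a \<otimes> inv b" b] a b by simp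
  also have "H #> (a \<otimes> inv b) = H" using coset_join2[OF _ H h] a b by simp
  finally show "cls a = cls b" unfolding cls_def .
qed

lemma cls_mult: "a \<in> carrier G \<Longrightarrow> b \<in> carrier G \<Longrightarrow> cls a \<otimes>\<^bsub>QG\<^esub> cls b = cls (a \<otimes> b)"
proof -
  assume ab: "a \<in> carrier G" "b \<in> carrier G"
  have "normal H G" using normal_iff_subgroup H by blast
  then have "(H #> a) <#>\<^bsub>G\<^esub> (H #> b) = H #> (a \<otimes> b)" by (rule normal.rcos_sum[OF _ ab])
  then show ?thesis unfolding cls_def by (simp add: set_mult_def)
qed

lemma cls_one: "cls \<one> = \<one>\<^bsub>QG\<^esub>" 
  unfolding cls_def using coset_mult_one[OF subgroup.subset[OF H]] by simp

lemma cls_eq_one_iff: "a \<in> carrier G \<Longrightarrow> cls a = \<one>\<^bsub>QG\<^esub> \<longleftrightarrow> a \<in> H"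
  using cls_eq_iff[of a \<one>] unfolding cls_one by simp

lemma comm_group_Quot: "comm_group QG"
proof (rule comm_groupI)
  fix x y assume "x \<in> carrier QG" "y \<in> carrier QG"
  then obtain a b where ab: "a \<in> D" "b \<in> D" "x = cls a" "y = cls b" unfolding Quot_carrier by blast
  show "x \<otimes>\<^bsub>QG\<^esub> y \<in> carrier QG"
    unfolding ab(3,4) cls_mult[OF D_carrier[OF ab(1)] D_carrier[OF ab(2)]] Quot_carrier
    using D_closed(2)[OF ab(1,2)] by blast
  show "x \<otimes>\<^bsub>QG\<^esub> y = y \<otimes>\<^bsub>QG\<^esub> x"
    unfolding ab(3,4) cls_mult[OF D_carrier[OF ab(1)] D_carrier[OF ab(2)]]
      cls_mult[OF D_carrier[OF ab(2)] D_carrier[OF ab(1)]] using m_comm D_carrier ab(1,2) by simp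
next
  show "\<one>\<^bsub>QG\<^esub> \<in> carrier QG" unfolding Quot_carrier cls_one[symmetric] using D_closed(1) by blast
next
  fix x y z assume "x \<in> carrier QG" "y \<in> carrier QG" "z \<in> carrier QG"
  then obtain a b c where ab: "a \<in> D" "b \<in> D" "c \<in> D" "x = cls a" "y = cls b" "z = cls c" unfolding Quot_carrier by blast
  then show "x \<otimes>\<^bsub>QG\<^esub> y \<otimes>\<^bsub>QG\<^esub> z = x \<otimes>\<^bsub>QG\<^esub> (y \<otimes>\<^bsub>QG\<^esub> z)"
    using D_carrier by (simp only: cls_mult m_closed m_assoc)
next
  fix x assume "x \<in> carrier QG"
  then obtain a where a: "a \<in> D" "x = cls a" unfolding Quot_carrier by blast
  show "\<one>\<^bsub>QG\<^esub> \<otimes>\<^bsub>QG\<^esub> x = x"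
    unfolding a(2) cls_one[symmetric] using D_carrier[OF a(1)] by (simp only: cls_mult one_closed l_one)
  have "cls (inv a) \<otimes>\<^bsub>QG\<^esub> x = \<one>\<^bsub>QG\<^esub>"
    unfolding a(2) cls_one[symmetric] using D_carrier[OF a(1)] by (simp only: cls_mult inv_closed l_inv)
  then show "\<exists>y\<in>carrier QG. y \<otimes>\<^bsub>QG\<^esub> x = \<one>\<^bsub>QG\<^esub>"
    unfolding Quot_carrier using D_closed(3)[OF a(1)] by blast
qed

sublocale QG: comm_group QG by (rule comm_group_Quot)

lemma group_D: "comm_group (G\<lparr>carrier := D\<rparr>)"
  by (rule group.group_comm_groupI[OF subgroup_imp_group[OF D]]) (simp add: m_comm D_carrier)

lemma cls_hom: "cls \<in> hom (G\<lparr>carrier := D\<rparr>) QG"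
  using cls_mult D_carrier by (auto simp: hom_def Quot_carrier simp del: mult_FactGroup)

lemma cls_nat_pow: assumes a: "a \<in> D" shows "cls a [^]\<^bsub>QG\<^esub> (k::nat) = cls (a [^] k)"
proof -
  interpret D: comm_group "G\<lparr>carrier := D\<rparr>" by (rule group_D)
  interpret h: group_hom "G\<lparr>carrier := D\<rparr>" QG cls by unfold_locales (rule cls_hom)
  show ?thesis using h.hom_nat_pow[of a k] a nat_pow_consistent[of a k D] by simp
qed

lemma cls_int_pow: assumes a: "a \<in> D" shows "cls a [^]\<^bsub>QG\<^esub> (k::int) = cls (a [^] k)"
proof -
  interpret D: comm_group "G\<lparr>carrier := D\<rparr>" by (rule group_D)
  interpret h: group_hom "G\<lparr>carrier := D\<rparr>" QG cls by unfold_locales (rule cls_hom)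
  show ?thesis using h.hom_int_pow[of a k] a int_pow_consistent[OF D a, of k] by simp
qed

lemma pow_prod_D: "b \<in> I \<rightarrow> D \<Longrightarrow> pow_prod G b I a \<in> D"
proof (induction I rule: infinite_finite_induct)
  case (insert i I)
  then have bI: "b \<in> I \<rightarrow> D" and bi: "b i \<in> D" by auto
  have "pow_prod G b (insert i I) a = b i [^] a i \<otimes> pow_prod G b I a"
    unfolding pow_prod_def using insert(1,2) D_carrier Pi_mem[OF bI] bi by (subst finprod_insert) auto
  then show ?case using insert.IH[OF bI] D_closed(2) subgroup_int_pow_closed[OF D bi] by simp
qed (simp_all add: pow_prod_def D_closed)

lemma cls_pow_prod:
  assumes "finite I" "b \<in> I \<rightarrow> D"
  shows "cls (pow_prod G b I a) = pow_prod QG (cls \<circ> b) I a"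
  using assms
proof (induction I rule: finite_induct)
  case (insert i I)
  then have bI: "b \<in> I \<rightarrow> D" and bi: "b i \<in> D" by auto
  have "pow_prod G b (insert i I) a = b i [^] a i \<otimes> pow_prod G b I a"
    unfolding pow_prod_def using insert(1,2) D_carrier Pi_mem[OF bI] bi by (subst finprod_insert) auto
  then have "cls (pow_prod G b (insert i I) a) = cls (b i) [^]\<^bsub>QG\<^esub> a i \<otimes>\<^bsub>QG\<^esub> pow_prod QG (cls \<circ> b) I a"
    unfolding cls_int_pow[OF bi] insert.IH[OF bI, symmetric]
    using cls_mult[of "b i [^] a i" "pow_prod G b I a"] D_carrier bi pow_prod_D[OF bI] by simp
  also have "\<dots> = pow_prod QG (cls \<circ> b) (insert i I) a"
  proof -
    have "cls (b j) \<in> carrier QG" if "j \<in> insert i I" for j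
      unfolding Quot_carrier using insert.prems that by auto
    then show ?thesis unfolding pow_prod_def using insert(1,2) by (subst QG.finprod_insert) auto
  qed
  finally show ?case .
qed (simp add: pow_prod_def cls_one)

text \<open>Moves the verification of a basis of D / H to G: elements of H contribute the zero
  exponent vector in the induction over \<open>generate\<close>, and a trivial class means
  membership in H.\<close>

lemma Fp_basisI:
  assumes p: "Factorial_Ring.prime p" and fin: "finite I" and b: "b \<in> I \<rightarrow> D"
    and pow: "\<And>x. x \<in> D \<Longrightarrow> x [^] p \<in> H"
    and gen: "\<And>x. x \<in> D \<Longrightarrow> x \<in> generate G (H \<union> b ` I)"
    and ind: "\<And>a i. pow_prod G b I a \<in> H \<Longrightarrow> i \<in> I \<Longrightarrow> int p dvd a i"
  shows "Fp_basis QG p I (cls \<circ> b)"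
proof (unfold_locales)
  show clb: "cls \<circ> b \<in> I \<rightarrow> carrier QG" unfolding Quot_carrier using b by auto
  show "x [^]\<^bsub>QG\<^esub> p = \<one>\<^bsub>QG\<^esub>" if x: "x \<in> carrier QG" for x
  proof -
    obtain a where a: "a \<in> D" "x = cls a" using x unfolding Quot_carrier by blast
    show ?thesis unfolding a(2) cls_nat_pow[OF a(1)] using cls_eq_one_iff pow[OF a(1)] H_carrier by blast
  qed
  have comb: "x \<in> D \<and> (\<exists>a. cls x = pow_prod QG (cls \<circ> b) I a)" if "x \<in> generate G (H \<union> b ` I)" for x
    using that
  proof (induction rule: generate.induct)
    case one
    then show ?case using D_closed(1) QG.pow_prod_zero[of "cls \<circ> b" I] cls_one by metis
  next
    case (incl h)
    then show ?case
    proof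
      assume h: "h \<in> H"
      then have "cls h = pow_prod QG (cls \<circ> b) I (\<lambda>i. 0)"
        using cls_eq_one_iff[OF H_carrier[OF h]] h by (simp add: QG.pow_prod_zero)
      then show ?case using h HD by blast
    next
      assume "h \<in> b ` I"
      then obtain j where j: "j \<in> I" "h = b j" by blast
      then have hD: "h \<in> D" using b by auto
      have "pow_prod QG (cls \<circ> b) I (\<lambda>i. if i = j then 1 else 0) = (cls \<circ> b) j [^]\<^bsub>QG\<^esub> (1::int)"
        by (rule QG.pow_prod_single[OF fin clb j(1)])
      also have "\<dots> = cls h" using cls_int_pow[OF hD, of 1] D_carrier[OF hD] j(2) by simp
      finally show ?case using hD by metis
    qed
  next
    case (inv h)
    then show ?case
    proof
      assume h: "h \<in> H"
      then have "cls (inv h) = pow_prod QG (cls \<circ> b) I (\<lambda>i. 0)"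
        using cls_eq_one_iff[OF H_carrier[OF H_closed(3)[OF h]]] H_closed(3)[OF h] by (simp add: QG.pow_prod_zero)
      then show ?case using H_closed(3)[OF h] HD by blast
    next
      assume "h \<in> b ` I"
      then obtain j where j: "j \<in> I" "h = b j" by blast
      then have hD: "h \<in> D" using b by auto
      have "pow_prod QG (cls \<circ> b) I (\<lambda>i. if i = j then -1 else 0) = (cls \<circ> b) j [^]\<^bsub>QG\<^esub> (-1::int)"
        by (rule QG.pow_prod_single[OF fin clb j(1)])
      also have "\<dots> = cls (inv h)"
        using cls_int_pow[OF hD, of "-1"] D_carrier[OF hD] j(2) int_pow_neg[of h 1] by simp
      finally show ?case using D_closed(3)[OF hD] by metis
    qed
  next
    case (eng h1 h2)
    then obtain a1 a2 where *: "h1 \<in> D" "h2 \<in> D" "cls h1 = pow_prod QG (cls \<circ> b) I a1"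
      "cls h2 = pow_prod QG (cls \<circ> b) I a2" by blast
    then have "cls (h1 \<otimes> h2) = pow_prod QG (cls \<circ> b) I (\<lambda>i. a1 i + a2 i)"
      using QG.pow_prod_add[OF clb, of a1 a2] cls_mult[OF D_carrier[OF *(1)] D_carrier[OF *(2)]] by metis
    then show ?case using D_closed(2)[OF *(1,2)] by blast
  qed
  show "\<exists>a. x = pow_prod QG (cls \<circ> b) I a" if "x \<in> carrier QG" for x
    using that gen comb unfolding Quot_carrier by blast
  show "int p dvd a i" if "pow_prod QG (cls \<circ> b) I a = \<one>\<^bsub>QG\<^esub>" "i \<in> I" for a i
  proof -
    have "cls (pow_prod G b I a) = \<one>\<^bsub>QG\<^esub>" using that(1) cls_pow_prod[OF fin b] by simp
    then show ?thesis using ind that(2) cls_eq_one_iff[OF D_carrier[OF pow_prod_D[OF b]]] by blast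
  qed
qed (rule p, rule fin)

end

text \<open>As f maps H into H', all representatives of a class have images in one coset. The union
  in \<open>induced_map\<close> therefore runs over a nonempty set of equal cosets.\<close>

lemma induced_map_cls:
  assumes S: "subquotient G D H" and S': "subquotient G' D' H'" and f: "f \<in> hom G G'"
    and fH: "f ` H \<subseteq> H'" and a: "a \<in> carrier G"
  shows "induced_map G' H' f (subquotient.cls G H a) = subquotient.cls G' H' (f a)"
proof -
  interpret S: subquotient G D H by fact
  interpret S': subquotient G' D' H' by fact
  have "S'.cls (f (h \<otimes>\<^bsub>G\<^esub> a)) = S'.cls (f a)" if h: "h \<in> H" for h
  proof -
    have fh: "f h \<in> H'" "f (h \<otimes>\<^bsub>G\<^esub> a) = f h \<otimes>\<^bsub>G'\<^esub> f a" "f a \<in> carrier G'"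
      using h fH hom_mult[OF f S.H_carrier[OF h] a] f a by (auto simp: hom_def)
    then have "f (h \<otimes>\<^bsub>G\<^esub> a) \<otimes>\<^bsub>G'\<^esub> inv\<^bsub>G'\<^esub> f a = f h"
      using S'.H_carrier[OF fh(1)] by (simp add: S'.m_assoc)
    then show ?thesis using S'.cls_eq_iff[of "f (h \<otimes>\<^bsub>G\<^esub> a)" "f a"] fh S'.H_carrier[OF fh(1)] by simp
  qed
  then have "H' #>\<^bsub>G'\<^esub> f x = S'.cls (f a)" if "x \<in> S.cls a" for x
    using that unfolding S.cls_def S'.cls_def r_coset_def[of G H a] by blast
  moreover have "S.cls a \<noteq> {}" unfolding S.cls_def r_coset_def using S.H_closed(1) by blast
  ultimately show ?thesis unfolding induced_map_def by simp
qed

lemma induced_map_hom: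
  assumes S: "subquotient G D H" and S': "subquotient G' D' H'" and f: "f \<in> hom G G'"
    and fH: "f ` H \<subseteq> H'" and fD: "f ` D \<subseteq> D'"
  shows "induced_map G' H' f \<in> hom (G\<lparr>carrier := D\<rparr> Mod H) (G'\<lparr>carrier := D'\<rparr> Mod H')"
proof -
  interpret S: subquotient G D H by fact
  interpret S': subquotient G' D' H' by fact
  have im: "induced_map G' H' f (S.cls a) = S'.cls (f a)" if "a \<in> D" for a
    by (rule induced_map_cls[OF S S' f fH S.D_carrier[OF that]])
  show ?thesis
  proof (rule homI)
    fix x assume "x \<in> carrier S.QG"
    then obtain a where a: "a \<in> D" "x = S.cls a" unfolding S.Quot_carrier by blast
    then show "induced_map G' H' f x \<in> carrier S'.QG" unfolding S'.Quot_carrier using im fD by blast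
  next
    fix x y assume "x \<in> carrier S.QG" "y \<in> carrier S.QG"
    then obtain a b where ab: "a \<in> D" "b \<in> D" "x = S.cls a" "y = S.cls b" unfolding S.Quot_carrier by blast
    have "induced_map G' H' f (x \<otimes>\<^bsub>S.QG\<^esub> y) = S'.cls (f (a \<otimes>\<^bsub>G\<^esub> b))"
      unfolding ab(3,4) S.cls_mult[OF S.D_carrier[OF ab(1)] S.D_carrier[OF ab(2)]]
      by (rule im[OF S.D_closed(2)[OF ab(1,2)]])
    also have "f (a \<otimes>\<^bsub>G\<^esub> b) = f a \<otimes>\<^bsub>G'\<^esub> f b" by (rule hom_mult[OF f S.D_carrier[OF ab(1)] S.D_carrier[OF ab(2)]])
    also have "S'.cls (f a \<otimes>\<^bsub>G'\<^esub> f b) = S'.cls (f a) \<otimes>\<^bsub>S'.QG\<^esub> S'.cls (f b)"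
      using fD ab(1,2) S'.D_carrier by (intro S'.cls_mult[symmetric]) auto
    finally show "induced_map G' H' f (x \<otimes>\<^bsub>S.QG\<^esub> y) = induced_map G' H' f x \<otimes>\<^bsub>S'.QG\<^esub> induced_map G' H' f y"
      unfolding ab(3,4) im[OF ab(1)] im[OF ab(2)] .
  qed
qed

text \<open>Infinite order makes y^k a power of y^p exactly when p divides k, so classes correspond
  to residues of exponents. For ideals the infinite order is read off from a valuation.\<close>

lemma cyclic_quotient_iso:
  assumes "comm_group G" and p: "Factorial_Ring.prime p" and y: "y \<in> carrier G"
    and inf: "\<And>k::int. y [^]\<^bsub>G\<^esub> k = \<one>\<^bsub>G\<^esub> \<Longrightarrow> k = 0"
  shows "cyclic_quotient G p y \<cong> add_monoid (residue_ring (int p))"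
    and "group (cyclic_quotient G p y)"
proof -
  interpret comm_group G by fact
  have yp: "y [^]\<^bsub>G\<^esub> p \<in> carrier G" using y by simp
  note gen = generate_pow[OF y] generate_pow[OF yp]
  have D: "subgroup (generate G {y}) G" and H: "subgroup (generate G {y [^]\<^bsub>G\<^esub> p}) G"
    using generate_is_subgroup y yp by simp_all
  have ypk: "(y [^]\<^bsub>G\<^esub> p) [^]\<^bsub>G\<^esub> k = y [^]\<^bsub>G\<^esub> (int p * k)" for k :: int
    using int_pow_pow[OF y, of "int p" k] by (simp add: int_pow_int)
  have HD: "generate G {y [^]\<^bsub>G\<^esub> p} \<subseteq> generate G {y}" unfolding gen using ypk by blast
  interpret S: subquotient G "generate G {y}" "generate G {y [^]\<^bsub>G\<^esub> p}" 
    by (intro subquotient.intro subquotient_axioms.intro comm_group_axioms D H HD)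
  have Q: "cyclic_quotient G p y = S.QG" unfolding cyclic_quotient_def subgroup_of_def ..
  have mem: "y [^]\<^bsub>G\<^esub> k \<in> generate G {y [^]\<^bsub>G\<^esub> p} \<longleftrightarrow> int p dvd k" for k :: int
  proof
    assume "y [^]\<^bsub>G\<^esub> k \<in> generate G {y [^]\<^bsub>G\<^esub> p}"
    then obtain l where "y [^]\<^bsub>G\<^esub> k = y [^]\<^bsub>G\<^esub> (int p * l)" unfolding gen ypk by blast
    then have "y [^]\<^bsub>G\<^esub> (k - int p * l) = \<one>\<^bsub>G\<^esub>" using int_pow_diff[OF y] y by simp
    then show "int p dvd k" using inf[of "k - int p * l"] by simp
  next
    assume "int p dvd k"
    then show "y [^]\<^bsub>G\<^esub> k \<in> generate G {y [^]\<^bsub>G\<^esub> p}" unfolding gen ypk by (auto simp: dvd_def)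
  qed
  have eq: "S.cls (y [^]\<^bsub>G\<^esub> k) = S.cls (y [^]\<^bsub>G\<^esub> l) \<longleftrightarrow> k mod int p = l mod int p" for k l :: int
    using S.cls_eq_iff[of "y [^]\<^bsub>G\<^esub> k" "y [^]\<^bsub>G\<^esub> l"] mem[of "k - l"] int_pow_diff[OF y, of k l] y
    by (simp add: mod_eq_dvd_iff)
  define \<phi> where "\<phi> = (\<lambda>k::int. S.cls (y [^]\<^bsub>G\<^esub> k))"
  have carr: "carrier S.QG = range \<phi>" unfolding S.Quot_carrier unfolding gen(1) \<phi>_def by auto
  have "\<phi> \<in> iso (add_monoid (residue_ring (int p))) S.QG"
  proof (rule isoI)
    show "\<phi> \<in> hom (add_monoid (residue_ring (int p))) S.QG"
    proof (rule homI)
      fix k l :: int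
      have "\<phi> ((k + l) mod int p) = \<phi> (k + l)" unfolding \<phi>_def eq by simp
      also have "\<dots> = S.cls (y [^]\<^bsub>G\<^esub> k \<otimes>\<^bsub>G\<^esub> y [^]\<^bsub>G\<^esub> l)" unfolding \<phi>_def int_pow_mult[OF y] ..
      also have "\<dots> = \<phi> k \<otimes>\<^bsub>S.QG\<^esub> \<phi> l" unfolding \<phi>_def using y by (intro S.cls_mult[symmetric]) auto
      finally show "\<phi> (k \<otimes>\<^bsub>add_monoid (residue_ring (int p))\<^esub> l) = \<phi> k \<otimes>\<^bsub>S.QG\<^esub> \<phi> l" by simp
    qed (simp only: carr rangeI)
    show "bij_betw \<phi> (carrier (add_monoid (residue_ring (int p)))) (carrier S.QG)"
      unfolding bij_betw_def
    proof
      show "inj_on \<phi> (carrier (add_monoid (residue_ring (int p))))"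
        by (rule inj_onI) (simp add: \<phi>_def eq)
      have "\<phi> k = \<phi> (k mod int p)" for k unfolding \<phi>_def eq by simp
      moreover have "k mod int p \<in> carrier (add_monoid (residue_ring (int p)))" for k
        using prime_gt_0_nat[OF p] by simp
      ultimately have "\<phi> k \<in> \<phi> ` carrier (add_monoid (residue_ring (int p)))" for k by (metis imageI)
      then show "\<phi> ` carrier (add_monoid (residue_ring (int p))) = carrier S.QG"
        unfolding carr by blast
    qed
  qed
  then have "add_monoid (residue_ring (int p)) \<cong> S.QG" unfolding is_iso_def by blast
  then show "cyclic_quotient G p y \<cong> add_monoid (residue_ring (int p))"
    unfolding Q using group.iso_sym comm_group.axioms(2)[OF residue_comm_group[OF p]] by blast
  show "group (cyclic_quotient G p y)" unfolding Q by (rule S.QG.is_group)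
qed

lemma product_cyclic_quotient_iso:
  assumes G: "comm_group G" and p: "Factorial_Ring.prime p" and y: "\<And>i. i \<in> {1..m} \<Longrightarrow> y i \<in> carrier G"
    and inf: "\<And>i k. i \<in> {1..m} \<Longrightarrow> y i [^]\<^bsub>G\<^esub> (k::int) = \<one>\<^bsub>G\<^esub> \<Longrightarrow> k = 0"
  shows "Fp_power p m \<cong> product_group {1..m} (\<lambda>i. cyclic_quotient G p (y i))" (is ?thesis1)
    and "group (product_group {1..m} (\<lambda>i. cyclic_quotient G p (y i)))"
proof -
  have Z: "group (add_monoid (residue_ring (int p)))" by (rule comm_group.axioms(2)[OF residue_comm_group[OF p]])
  have c: "cyclic_quotient G p (y i) \<cong> add_monoid (residue_ring (int p))" "group (cyclic_quotient G p (y i))"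
    if "i \<in> {1..m}" for i
    using cyclic_quotient_iso[OF G p y[OF that] inf[OF that]] by blast+
  show "group (product_group {1..m} (\<lambda>i. cyclic_quotient G p (y i)))" 
    by (rule product_group) (rule c(2))
  then have iso: "product_group {1..m} (\<lambda>i. cyclic_quotient G p (y i)) \<cong> Fp_power p m \<Longrightarrow> ?thesis1"
    by (rule group.iso_sym)
  have "product_group {1..m} (\<lambda>i. cyclic_quotient G p (y i)) \<cong> Fp_power p m"
    unfolding Fp_power_def by (rule iso_product_groupI) (use c Z in auto)
  then show ?thesis1 by (rule iso)
qed

subsection \<open>A section of multiplication by two\<close>

locale norm_section = A: comm_group A + B: comm_group B
  for A :: "('a, 'm) monoid_scheme" and B :: "('b, 'n) monoid_scheme" +
  fixes e :: "'a \<Rightarrow> 'b" and n :: "'b \<Rightarrow> 'a" and p :: nat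
  assumes e: "e \<in> hom A B" and n: "n \<in> hom B A"
    and ne: "x \<in> carrier A \<Longrightarrow> n (e x) = x \<otimes>\<^bsub>A\<^esub> x"
    and odd_p: "odd p"
    and pow_A: "x \<in> carrier A \<Longrightarrow> x [^]\<^bsub>A\<^esub> p = \<one>\<^bsub>A\<^esub>"
begin

sublocale e: group_hom A B e by unfold_locales (rule e)
sublocale n: group_hom B A n by unfold_locales (rule n)

abbreviation "im \<equiv> e ` carrier A"
abbreviation "ker \<equiv> kernel B A n"

text \<open>The exponent (p + 1) / 2 is the inverse of 2 modulo p.\<close>

lemma square_root:
  assumes "x \<in> carrier A" shows "(x [^]\<^bsub>A\<^esub> ((p + 1) div 2)) \<otimes>\<^bsub>A\<^esub> (x [^]\<^bsub>A\<^esub> ((p + 1) div 2)) = x"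
proof -
  have "(p + 1) div 2 + (p + 1) div 2 = p + 1" using odd_p by presburger
  then have "(x [^]\<^bsub>A\<^esub> ((p + 1) div 2)) \<otimes>\<^bsub>A\<^esub> (x [^]\<^bsub>A\<^esub> ((p + 1) div 2)) = x [^]\<^bsub>A\<^esub> (p + 1)"
    using A.nat_pow_mult[OF assms, of "(p + 1) div 2" "(p + 1) div 2"] by metis
  then show ?thesis using pow_A[OF assms] assms by simp
qed

lemma square_inj:
  assumes "x \<in> carrier A" "y \<in> carrier A" "x \<otimes>\<^bsub>A\<^esub> x = y \<otimes>\<^bsub>A\<^esub> y" shows "x = y"
proof -
  have "z [^]\<^bsub>A\<^esub> ((p + 1) div 2) \<otimes>\<^bsub>A\<^esub> z [^]\<^bsub>A\<^esub> ((p + 1) div 2) = (z \<otimes>\<^bsub>A\<^esub> z) [^]\<^bsub>A\<^esub> ((p + 1) div 2)"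
    if "z \<in> carrier A" for z
    using A.pow_mult_distrib[of z z "(p + 1) div 2"] that by simp
  then show ?thesis using square_root[OF assms(1)] square_root[OF assms(2)] assms by metis
qed

lemma e_inj: "inj_on e (carrier A)"
  by (rule inj_onI) (metis ne square_inj)

text \<open>In additive terms x is half of n(y), so that n(e(x)) = n(y) and the quotient of y by
  e(x) is in the kernel.\<close>

lemma decomposition:
  assumes y: "y \<in> carrier B"
  obtains x k where "x \<in> carrier A" "k \<in> ker" "y = e x \<otimes>\<^bsub>B\<^esub> k"
proof -
  define x where "x = n y [^]\<^bsub>A\<^esub> ((p + 1) div 2)"
  have x: "x \<in> carrier A" unfolding x_def using y by simp
  define k where "k = inv\<^bsub>B\<^esub> (e x) \<otimes>\<^bsub>B\<^esub> y"
  have k: "k \<in> carrier B" unfolding k_def using x y by simp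
  have "n k = inv\<^bsub>A\<^esub> (n (e x)) \<otimes>\<^bsub>A\<^esub> n y" unfolding k_def using x y by simp
  also have "n (e x) = n y" unfolding ne[OF x] unfolding x_def using square_root y by simp
  finally have "k \<in> ker" unfolding kernel_def using k y by simp
  moreover have "y = e x \<otimes>\<^bsub>B\<^esub> k" unfolding k_def using x y by (simp add: B.m_assoc[symmetric])
  ultimately show ?thesis using that x by blast
qed

lemma decomposition_unique:
  assumes "x \<in> carrier A" "k \<in> ker" "x' \<in> carrier A" "k' \<in> ker" "e x \<otimes>\<^bsub>B\<^esub> k = e x' \<otimes>\<^bsub>B\<^esub> k'"
  shows "x = x'" "k = k'"
proof -
  have k: "k \<in> carrier B" "n k = \<one>\<^bsub>A\<^esub>" "k' \<in> carrier B" "n k' = \<one>\<^bsub>A\<^esub>"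
    using assms unfolding kernel_def by auto
  have "n (e x \<otimes>\<^bsub>B\<^esub> k) = n (e x' \<otimes>\<^bsub>B\<^esub> k')" using assms(5) by simp
  then have "x \<otimes>\<^bsub>A\<^esub> x = x' \<otimes>\<^bsub>A\<^esub> x'" using k assms(1,3) ne by simp
  then show "x = x'" using square_inj assms by blast
  then show "k = k'" using assms(3,5) k by simp
qed

lemma direct_product:
  "(\<lambda>(x, y). x \<otimes>\<^bsub>B\<^esub> y) \<in> iso (B\<lparr>carrier := im\<rparr> \<times>\<times> B\<lparr>carrier := ker\<rparr>) B"
proof (rule isoI)
  have kB: "k \<in> carrier B" if "k \<in> ker" for k using that unfolding kernel_def by simp
  show "(\<lambda>(x, y). x \<otimes>\<^bsub>B\<^esub> y) \<in> hom (B\<lparr>carrier := im\<rparr> \<times>\<times> B\<lparr>carrier := ker\<rparr>) B"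
    using kB by (auto simp: hom_def B.m_ac)
  show "bij_betw (\<lambda>(x, y). x \<otimes>\<^bsub>B\<^esub> y) (carrier (B\<lparr>carrier := im\<rparr> \<times>\<times> B\<lparr>carrier := ker\<rparr>)) (carrier B)"
    unfolding bij_betw_def
  proof
    show "inj_on (\<lambda>(x, y). x \<otimes>\<^bsub>B\<^esub> y) (carrier (B\<lparr>carrier := im\<rparr> \<times>\<times> B\<lparr>carrier := ker\<rparr>))"
    proof (rule inj_onI)
      fix u v assume "u \<in> carrier (B\<lparr>carrier := im\<rparr> \<times>\<times> B\<lparr>carrier := ker\<rparr>)"
        "v \<in> carrier (B\<lparr>carrier := im\<rparr> \<times>\<times> B\<lparr>carrier := ker\<rparr>)"
        and eq: "(\<lambda>(x, y). x \<otimes>\<^bsub>B\<^esub> y) u = (\<lambda>(x, y). x \<otimes>\<^bsub>B\<^esub> y) v"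
      then obtain x k x' k' where *: "u = (e x, k)" "v = (e x', k')" "x \<in> carrier A" "k \<in> ker"
        "x' \<in> carrier A" "k' \<in> ker" by auto
      then have "e x \<otimes>\<^bsub>B\<^esub> k = e x' \<otimes>\<^bsub>B\<^esub> k'" using eq by simp
      then show "u = v" using decomposition_unique[OF *(3-6)] *(1,2) by simp
    qed
    show "(\<lambda>(x, y). x \<otimes>\<^bsub>B\<^esub> y) ` carrier (B\<lparr>carrier := im\<rparr> \<times>\<times> B\<lparr>carrier := ker\<rparr>) = carrier B"
    proof
      show "(\<lambda>(x, y). x \<otimes>\<^bsub>B\<^esub> y) ` carrier (B\<lparr>carrier := im\<rparr> \<times>\<times> B\<lparr>carrier := ker\<rparr>) \<subseteq> carrier B"
        using kB by auto
      show "carrier B \<subseteq> (\<lambda>(x, y). x \<otimes>\<^bsub>B\<^esub> y) ` carrier (B\<lparr>carrier := im\<rparr> \<times>\<times> B\<lparr>carrier := ker\<rparr>)"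
      proof
        fix y assume "y \<in> carrier B"
        then obtain x k where xk: "x \<in> carrier A" "k \<in> ker" "y = e x \<otimes>\<^bsub>B\<^esub> k" by (rule decomposition)
        then show "y \<in> (\<lambda>(x, y). x \<otimes>\<^bsub>B\<^esub> y) ` carrier (B\<lparr>carrier := im\<rparr> \<times>\<times> B\<lparr>carrier := ker\<rparr>)"
          by (intro image_eqI[of _ _ "(e x, k)"]) auto
      qed
    qed
  qed
qed

text \<open>Generation comes from the existence, independence from the uniqueness of the
  decomposition. The disjoint sum of the index sets avoids any comparison of the two families as
  sets.\<close>

lemma Fp_basis_sum:
  assumes bA: "Fp_basis A p I b" and bK: "Fp_basis (B\<lparr>carrier := ker\<rparr>) p J c"
    and pow_B: "\<And>x. x \<in> carrier B \<Longrightarrow> x [^]\<^bsub>B\<^esub> p = \<one>\<^bsub>B\<^esub>"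
  shows "Fp_basis B p (I <+> J) (case_sum (e \<circ> b) c)"
proof -
  interpret FA: Fp_basis A p I b by fact
  interpret FK: Fp_basis "B\<lparr>carrier := ker\<rparr>" p J c by fact
  have inc: "(\<lambda>x. x) \<in> hom (B\<lparr>carrier := ker\<rparr>) B" by (auto simp: hom_def kernel_def)
  have cK: "c \<in> J \<rightarrow> ker" using FK.b by simp
  have cB: "c \<in> J \<rightarrow> carrier B" using cK unfolding kernel_def by auto
  have ebB: "e \<circ> b \<in> I \<rightarrow> carrier B" using Pi_mem[OF FA.b] by auto
  have ppA: "e (pow_prod A b I a) = pow_prod B (e \<circ> b) I a" for a
    by (rule hom_pow_prod[OF A.comm_group_axioms B.comm_group_axioms e FA.b FA.fin])
  have ppK: "pow_prod (B\<lparr>carrier := ker\<rparr>) c J a = pow_prod B c J a" for a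
    using hom_pow_prod[OF FK.comm_group_axioms B.comm_group_axioms inc FK.b FK.fin] by (simp add: o_def)
  have split: "pow_prod B (case_sum (e \<circ> b) c) (I <+> J) a =
      e (pow_prod A b I (a \<circ> Inl)) \<otimes>\<^bsub>B\<^esub> pow_prod (B\<lparr>carrier := ker\<rparr>) c J (a \<circ> Inr)" for a
    unfolding ppA ppK by (rule B.pow_prod_Plus[OF FA.fin FK.fin ebB cB])
  have ppA_c: "pow_prod A b I a \<in> carrier A" for a by (rule A.pow_prod_closed[OF FA.b])
  have ppK_c: "pow_prod (B\<lparr>carrier := ker\<rparr>) c J a \<in> ker" for a using FK.pow_prod_closed[OF FK.b] by simp
  show ?thesis
  proof (unfold_locales)
    show "Factorial_Ring.prime p" by (rule FA.prime_p)
    show "finite (I <+> J)" using FA.fin FK.fin by simp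
    show "case_sum (e \<circ> b) c \<in> I <+> J \<rightarrow> carrier B" using ebB cB by auto
    show "x [^]\<^bsub>B\<^esub> p = \<one>\<^bsub>B\<^esub>" if "x \<in> carrier B" for x using pow_B that .
    show "\<exists>a. x = pow_prod B (case_sum (e \<circ> b) c) (I <+> J) a" if x: "x \<in> carrier B" for x
    proof -
      obtain y k where yk: "y \<in> carrier A" "k \<in> ker" "x = e y \<otimes>\<^bsub>B\<^esub> k" using decomposition[OF x] .
      obtain a where a: "y = pow_prod A b I a" using FA.generates[OF yk(1)] by blast
      obtain a' where a': "k = pow_prod (B\<lparr>carrier := ker\<rparr>) c J a'" using FK.generates[of k] yk(2) by auto
      have "case_sum a a' \<circ> Inl = a" "case_sum a a' \<circ> Inr = a'" by auto
      then have "x = pow_prod B (case_sum (e \<circ> b) c) (I <+> J) (case_sum a a')"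
        unfolding split yk(3) a a' by simp
      then show ?thesis by blast
    qed
    fix a i assume 1: "pow_prod B (case_sum (e \<circ> b) c) (I <+> J) a = \<one>\<^bsub>B\<^esub>" and i: "i \<in> I <+> J"
    have one: "\<one>\<^bsub>B\<^esub> \<in> ker" unfolding kernel_def by simp
    have "e (pow_prod A b I (a \<circ> Inl)) \<otimes>\<^bsub>B\<^esub> pow_prod (B\<lparr>carrier := ker\<rparr>) c J (a \<circ> Inr) = e \<one>\<^bsub>A\<^esub> \<otimes>\<^bsub>B\<^esub> \<one>\<^bsub>B\<^esub>"
      using 1 unfolding split by simp
    note u = decomposition_unique[OF ppA_c ppK_c A.one_closed one this]
    show "int p dvd a i"
    proof (cases i)
      case (Inl j)
      then show ?thesis using FA.independent[OF u(1), of j] i by auto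
    next
      case (Inr j)
      then show ?thesis using FK.independent[of "a \<circ> Inr" j] u(2) i by auto
    qed
  qed
qed

end

section \<open>Differential factors of an extension of prime degree\<close>

context nf
begin

lemma val_pow_prod:
  assumes P: "P \<in> prime_ideals E" and fin: "finite S" and b: "\<And>i. i \<in> S \<Longrightarrow> is_frac (b i)"
  shows "is_frac (pow_prod \<I> b S a)" "val P (pow_prod \<I> b S a) = (\<Sum>i\<in>S. a i * val P (b i))"
proof -
  have "is_frac (pow_prod \<I> b S a) \<and> val P (pow_prod \<I> b S a) = (\<Sum>i\<in>S. a i * val P (b i))"
    using fin b
  proof (induction S rule: finite_induct)
    case empty
    then show ?case by (simp add: pow_prod_def frac_O val_O[OF P])
  next
    case (insert i S)
    have "pow_prod \<I> b (insert i S) a = b i [^]\<^bsub>\<I>\<^esub> a i \<star> pow_prod \<I> b S a"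
      unfolding pow_prod_def using insert(1,2,4) frac_int_pow by (subst G.finprod_insert) auto
    then show ?case using insert frac_imul frac_int_pow val_imul[OF P] val_int_pow[OF P] by simp
  qed
  then show "is_frac (pow_prod \<I> b S a)" "val P (pow_prod \<I> b S a) = (\<Sum>i\<in>S. a i * val P (b i))" by auto
qed

end

locale nf_ext_prime = nf_ext_degree +
  assumes prime_n: "Factorial_Ring.prime n"
begin

abbreviation "HH \<equiv> extended_ideals K E"
abbreviation "DD \<equiv> differential_ideals n K E"
abbreviation "TT \<equiv> {P. totally_ramified K E P}"
abbreviation "IE \<equiv> ideal_group E"

lemma HH_iff: "A \<in> HH \<longleftrightarrow> (\<exists>C. B.is_frac C \<and> A = ext C)"
  unfolding extended_ideals_def by auto

lemma DD_iff: "A \<in> DD \<longleftrightarrow> T.is_frac A \<and> A [^]\<^bsub>IE\<^esub> n \<in> HH"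
  unfolding differential_ideals_def by simp

lemma ext_HH: "B.is_frac C \<Longrightarrow> ext C \<in> HH"
  using HH_iff by blast

lemma HH_subgroup: "subgroup HH IE"
  using ext.img_is_subgroup unfolding extended_ideals_def .

lemma n_pos: "n > 0"
  using prime_n prime_gt_0_nat by blast

lemma DD_subgroup: "subgroup DD IE"
proof (rule T.G.subgroupI)
  show "DD \<subseteq> carrier IE" using DD_iff by auto
  have "OE \<in> DD" unfolding DD_iff
    using T.frac_O T.G.nat_pow_one[of n] subgroup.one_closed[OF HH_subgroup] by simp
  then show "DD \<noteq> {}" by blast
  fix A assume A: "A \<in> DD"
  then show "inv\<^bsub>IE\<^esub> A \<in> DD"
    using T.frac_inv subgroup.m_inv_closed[OF HH_subgroup] T.G.nat_pow_inv[of A n] unfolding DD_iff by simp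
  fix C assume "C \<in> DD"
  then show "A \<otimes>\<^bsub>IE\<^esub> C \<in> DD"
    using A T.frac_imul subgroup.m_closed[OF HH_subgroup] T.G.pow_mult_distrib[of A C n] imul_commute
    unfolding DD_iff by simp
qed

lemma HH_DD: "HH \<subseteq> DD"
proof
  fix A assume "A \<in> HH"
  then obtain C where C: "B.is_frac C" "A = ext C" using HH_iff by blast
  have "A [^]\<^bsub>IE\<^esub> n = ext (C [^]\<^bsub>ideal_group K\<^esub> n)" unfolding C(2) by (rule ext_nat_pow[OF C(1), symmetric])
  then show "A \<in> DD" unfolding DD_iff using C ext_frac ext_HH B.frac_nat_pow by simp
qed

sublocale S: subquotient IE DD HH
  by (intro subquotient.intro subquotient_axioms.intro T.comm_group_ideals DD_subgroup HH_subgroup HH_DD)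

lemma TT_D: "P \<in> TT \<Longrightarrow> P \<in> prime_ideals E" "P \<in> TT \<Longrightarrow> ext (below P) = P [^]\<^bsub>IE\<^esub> n"
  "P \<in> TT \<Longrightarrow> T.val P (ext (below P)) = int n"
  using totally_ramified_iff[of P] totally_ramified_iff_val[of P] by simp_all

lemma TT_pow: "P \<in> TT \<Longrightarrow> P [^]\<^bsub>IE\<^esub> n \<in> HH"
  using TT_D(2) ext_HH B.prime_frac[OF below_prime[OF TT_D(1)]] by metis

lemma TT_DD: "P \<in> TT \<Longrightarrow> P \<in> DD"
  unfolding DD_iff using TT_pow T.prime_frac TT_D(1) by blast

lemma val_HH: assumes "P \<in> TT" "A \<in> HH" shows "int n dvd T.val P A"
proof -
  obtain C where "B.is_frac C" "A = ext C" using assms(2) HH_iff by blast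
  then show ?thesis using val_ext[OF TT_D(1)[OF assms(1)]] TT_D(3)[OF assms(1)] by simp
qed

text \<open>The p-primary part of C already has an n-th root among the generated ideals. If n
  divides the exponent v of p, this is the extension of p^(v/n); otherwise p extends to P^n for a
  prime P, and the root is P^v.\<close>

lemma root_of_prime_power:
  assumes A: "T.is_frac A" and C: "B.is_frac C" and eq: "A [^]\<^bsub>IE\<^esub> n = ext C" and p: "p \<in> prime_ideals K"
  obtains Z where "T.is_frac Z" "Z \<in> generate IE (HH \<union> TT)"
    "Z [^]\<^bsub>IE\<^esub> n = ext (p [^]\<^bsub>ideal_group K\<^esub> B.val p C)"
proof (cases "int n dvd B.val p C")
  case True
  then obtain k where k: "B.val p C = int n * k" by blast
  note frp = B.prime_frac[OF p]
  define Z where "Z = ext (p [^]\<^bsub>ideal_group K\<^esub> k)"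
  have "Z [^]\<^bsub>IE\<^esub> n = ext ((p [^]\<^bsub>ideal_group K\<^esub> k) [^]\<^bsub>ideal_group K\<^esub> n)"
    unfolding Z_def by (rule ext_nat_pow[OF B.frac_int_pow[OF frp], symmetric])
  also have "(p [^]\<^bsub>ideal_group K\<^esub> k) [^]\<^bsub>ideal_group K\<^esub> n = p [^]\<^bsub>ideal_group K\<^esub> B.val p C"
    unfolding k using B.G.int_pow_pow[of p k "int n"] frp by (simp add: int_pow_int mult.commute)
  finally have "Z [^]\<^bsub>IE\<^esub> n = ext (p [^]\<^bsub>ideal_group K\<^esub> B.val p C)" .
  moreover have "Z \<in> HH" unfolding Z_def by (rule ext_HH[OF B.frac_int_pow[OF frp]])
  ultimately show ?thesis
    using that[of Z] ext_frac[OF B.frac_int_pow[OF frp]] generate.incl[of Z "HH \<union> TT" IE] unfolding Z_def by blast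
next
  case False
  obtain P where P: "P \<in> prime_ideals E" "below P = p" using prime_above[OF p] .
  note frP = T.prime_frac[OF P(1)] and frp = B.prime_frac[OF p]
  have "int n * T.val P A = B.val p C * T.val P (ext p)"
    using T.val_nat_pow[OF P(1) A, of n] eq val_ext[OF P(1) C] P(2) by simp
  then have "int n dvd B.val p C * T.val P (ext p)" by (metis dvd_triv_left)
  moreover have "Factorial_Ring.prime (int n)" using prime_n by simp
  ultimately have "int n dvd T.val P (ext p)" using False prime_dvd_mult_iff by blast
  \<comment> \<open>The index is positive and divisible by n, hence at least n, and the chain bound
    leaves P^n as the whole extension.\<close>
  then have "T.val P (ext p) \<ge> int n"
    using zdvd_imp_le ext_below_pos[OF P(1)] P(2) by simp
  then have tot: "ext p = P [^]\<^bsub>IE\<^esub> n" using totally_ramified_if_val_ge[OF P(1)] P(2) by simp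
  then have PT: "P \<in> TT" using totally_ramified_iff P by simp
  define Z where "Z = P [^]\<^bsub>IE\<^esub> B.val p C"
  have "Z [^]\<^bsub>IE\<^esub> n = (P [^]\<^bsub>IE\<^esub> n) [^]\<^bsub>IE\<^esub> B.val p C"
    unfolding Z_def using T.G.int_pow_pow[of P "B.val p C" "int n"] T.G.int_pow_pow[of P "int n" "B.val p C"] frP
    by (simp add: int_pow_int mult.commute)
  then have "Z [^]\<^bsub>IE\<^esub> n = ext (p [^]\<^bsub>ideal_group K\<^esub> B.val p C)" unfolding ext_int_pow[OF frp] tot .
  moreover have "HH \<union> TT \<subseteq> carrier IE" using TT_D(1) T.prime_frac HH_DD DD_iff by auto
  then have "subgroup (generate IE (HH \<union> TT)) IE" by (rule T.G.generate_is_subgroup)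
  then have "Z \<in> generate IE (HH \<union> TT)"
    unfolding Z_def using T.G.subgroup_int_pow_closed generate.incl[of P "HH \<union> TT" IE] PT by blast
  moreover have "T.is_frac Z" unfolding Z_def by (rule T.frac_int_pow[OF frP])
  ultimately show ?thesis using that by blast
qed

text \<open>Induction on the number of primes in C: dividing A by the root Z removes one prime from
  C and creates no other. At the end C is the unit ideal, and A is trivial because ideals have no
  torsion.\<close>

lemma DD_generated:
  assumes "A \<in> DD" shows "A \<in> generate IE (HH \<union> TT)"
proof -
  have "A \<in> generate IE (HH \<union> TT)" if "T.is_frac A" "B.is_frac C" "A [^]\<^bsub>IE\<^esub> n = ext C" for A C
    using that
  proof (induction "card {p \<in> prime_ideals K. B.val p C \<noteq> 0}" arbitrary: A C rule: less_induct)
    case less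
    note A = less.prems(1) and C = less.prems(2) and eq = less.prems(3)
    show ?case
    proof (cases "\<forall>p\<in>prime_ideals K. B.val p C = 0")
      case True
      then have "C = OK" using B.frac_eq_O_if_val_0[OF C] by blast
      then have "A = OE" using T.ideal_pow_eq_O[OF A _ n_pos] eq ext_OK by simp
      then show ?thesis using generate.one[of IE] by simp
    next
      case False
      then obtain p where p: "p \<in> prime_ideals K" "B.val p C \<noteq> 0" by blast
      note frp = B.prime_frac[OF p(1)]
      obtain Z where Z: "T.is_frac Z" "Z \<in> generate IE (HH \<union> TT)"
        "Z [^]\<^bsub>IE\<^esub> n = ext (p [^]\<^bsub>ideal_group K\<^esub> B.val p C)"
        using root_of_prime_power[OF A C eq p(1)] .
      define A' where "A' = A \<star> inv\<^bsub>IE\<^esub> Z"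
      define Y where "Y = p [^]\<^bsub>ideal_group K\<^esub> B.val p C"
      define C' where "C' = C \<star> inv\<^bsub>ideal_group K\<^esub> Y"
      have Y: "B.is_frac Y" unfolding Y_def by (rule B.frac_int_pow[OF frp])
      have A': "T.is_frac A'" unfolding A'_def by (rule T.frac_imul[OF A T.frac_inv[OF Z(1)]])
      have C': "B.is_frac C'" unfolding C'_def by (rule B.frac_imul[OF C B.frac_inv[OF Y]])
      have "A' [^]\<^bsub>IE\<^esub> n = (A [^]\<^bsub>IE\<^esub> n) \<star> inv\<^bsub>IE\<^esub> (Z [^]\<^bsub>IE\<^esub> n)"
        unfolding A'_def using T.G.pow_mult_distrib[of A "inv\<^bsub>IE\<^esub> Z" n] A Z(1) T.frac_inv[OF Z(1)]
          T.G.nat_pow_inv[of Z n] imul_commute by simp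
      also have "\<dots> = ext C'" unfolding C'_def ext_imul ext_inv[OF Y] eq Z(3) Y_def[symmetric] ..
      finally have eq': "A' [^]\<^bsub>IE\<^esub> n = ext C'" .
      have val: "B.val q C' = B.val q C - B.val p C * B.val q p" if "q \<in> prime_ideals K" for q
        unfolding C'_def using B.val_imul[OF that C B.frac_inv[OF Y]] B.val_inv[OF that Y] B.val_int_pow[OF that frp]
        unfolding Y_def by simp
      have "{q \<in> prime_ideals K. B.val q C' \<noteq> 0} \<subseteq> {q \<in> prime_ideals K. B.val q C \<noteq> 0} - {p}"
      proof
        fix q assume q: "q \<in> {q \<in> prime_ideals K. B.val q C' \<noteq> 0}"
        show "q \<in> {q \<in> prime_ideals K. B.val q C \<noteq> 0} - {p}"
        proof (cases "q = p")
          case True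
          then show ?thesis using q val[OF p(1)] B.val_self[OF p(1)] by simp
        next
          case False
          then show ?thesis using q val[of q] B.val_other_prime[of q p] p(1) by simp
        qed
      qed
      then have "{q \<in> prime_ideals K. B.val q C' \<noteq> 0} \<subset> {q \<in> prime_ideals K. B.val q C \<noteq> 0}" using p by blast
      then have "A' \<in> generate IE (HH \<union> TT)"
        using less.hyps[OF psubset_card_mono[OF B.finite_val_support[OF C]] A' C' eq'] by blast
      then have "A' \<otimes>\<^bsub>IE\<^esub> Z \<in> generate IE (HH \<union> TT)" using Z(2) by (rule generate.eng)
      then show ?thesis unfolding A'_def using T.imul_inv_cancel'[OF A Z(1)] by simp
    qed
  qed
  then show ?thesis using assms HH_iff unfolding DD_iff by blast
qed

text \<open>The valuation at P of a product of totally ramified primes is the exponent of P, and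
  ideals extended from K have valuation divisible by n there.\<close>

lemma totally_ramified_Fp_basis:
  assumes fin: "finite TT"
  shows "Fp_basis (differential_group n K E) n TT (S.cls \<circ> (\<lambda>P. P))"
  unfolding differential_group_def
proof (rule S.Fp_basisI[OF prime_n fin])
  show "(\<lambda>P. P) \<in> TT \<rightarrow> DD" using TT_DD by auto
  show "x [^]\<^bsub>IE\<^esub> n \<in> HH" if "x \<in> DD" for x using that DD_iff by blast
  show "x \<in> generate IE (HH \<union> (\<lambda>P. P) ` TT)" if "x \<in> DD" for x using DD_generated[OF that] by simp
  fix a P assume H: "pow_prod IE (\<lambda>P. P) TT a \<in> HH" and P: "P \<in> TT"
  have "T.val P (pow_prod IE (\<lambda>P. P) TT a) = (\<Sum>Q\<in>TT. a Q * T.val P Q)"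
    using T.val_pow_prod(2)[OF TT_D(1)[OF P] fin, of "\<lambda>P. P"] T.prime_frac TT_D(1) by blast
  also have "\<dots> = (\<Sum>Q\<in>TT. if Q = P then a P else 0)"
    using T.val_self[OF TT_D(1)[OF P]] T.val_other_prime[OF TT_D(1)[OF P] TT_D(1)] by (intro sum.cong) auto
  also have "\<dots> = a P" using fin P by simp
  finally show "int n dvd a P" using val_HH[OF P H] by simp
qed

end

section \<open>The composite of a quadratic extension and an extension of prime degree\<close>

text \<open>Both quadratic extensions enter twice: with their conjugation, for a common \<theta>,
  and as extensions of degree 2, to which the chain bound applies.\<close>

locale tower =
  FL: nf_ext_prime F L p + KN: nf_ext_prime K N p +
  FK: nf_quadratic F K \<theta> + LN: nf_quadratic L N \<theta> +
  FK2: nf_ext_degree F K 2 + LN2: nf_ext_degree L N 2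
  for F K L N :: "complex set" and p :: nat and \<theta> :: complex +
  assumes p_ge_3: "p \<ge> 3"
begin

abbreviation "IL \<equiv> ideal_group L"
abbreviation "IN \<equiv> ideal_group N"

lemma prime_p: "Factorial_Ring.prime p"
  by (rule FL.prime_n)

lemma ext_ext_K: "KN.ext (FK.ext A) = extend_ideal N A"
  unfolding KN.ext_eq FK.ext_eq using KN.ext_OK unfolding KN.ext_eq by (simp add: imul_assoc extend_ideal_def)

lemma ext_ext_L: "LN.ext (FL.ext A) = extend_ideal N A"
  unfolding LN.ext_eq FL.ext_eq using LN.ext_OK unfolding LN.ext_eq by (simp add: imul_assoc extend_ideal_def)

lemma tau_agree: assumes x: "x \<in> K" shows "LN.tau x = FK.tau x"
proof -
  obtain u v where uv: "u \<in> F" "v \<in> F" "x = u + v * \<theta>" using FK.E_cases[OF x] .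
  then have "u \<in> L" "v \<in> L" using FL.K_sub_E by auto
  then show ?thesis using LN.tau_decomp[of u v] FK.tau_decomp[OF uv(1,2)] uv(3) by simp
qed

lemma cj_ext_K: assumes A: "A \<subseteq> K" shows "LN.cj (KN.ext A) = KN.ext (FK.cj A)"
proof -
  have "LN.cj A = FK.cj A" using tau_agree A by (intro image_cong) auto
  moreover have "A \<subseteq> N" "integers_of N \<subseteq> N" using A KN.K_sub_E KN.T.O_E by auto
  ultimately show ?thesis unfolding KN.ext_eq by (simp add: LN.cj_imul LN.cj_OE)
qed

lemma cj_HH: assumes "A \<in> KN.HH" shows "LN.cj A \<in> KN.HH"
proof -
  obtain C where C: "KN.B.is_frac C" "A = KN.ext C" using assms KN.HH_iff by blast
  then show ?thesis using cj_ext_K[OF KN.B.fracD(2)[OF C(1)]] KN.ext_HH[OF FK.cj_frac[OF C(1)]] by simp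
qed

text \<open>The sides are compared in N, where conjugation of N/L restricts to that of K/F. This
  makes the map induced by the norm well defined.\<close>

lemma nm_ext_K:
  assumes A: "KN.B.is_frac A" shows "LN.nm (KN.ext A) = FL.ext (FK.nm A)"
proof (rule LN.ext_inj)
  note frA = KN.ext_frac[OF A] and nA = FK.nm_frac[OF A]
  have "LN.ext (LN.nm (KN.ext A)) = KN.ext A \<star> KN.ext (FK.cj A)"
    unfolding LN.ext_nm[OF frA] cj_ext_K[OF KN.B.fracD(2)[OF A]] ..
  also have "\<dots> = KN.ext (FK.ext (FK.nm A))" unfolding FK.ext_nm[OF A] KN.ext_imul ..
  also have "\<dots> = LN.ext (FL.ext (FK.nm A))" unfolding ext_ext_K ext_ext_L ..
  finally show "LN.ext (LN.nm (KN.ext A)) = LN.ext (FL.ext (FK.nm A))" .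
  show "FL.T.is_frac (LN.nm (KN.ext A))" by (rule LN.nm_frac[OF frA])
  show "FL.T.is_frac (FL.ext (FK.nm A))" by (rule FL.ext_frac[OF nA])
qed

lemma ext_HH: "LN.ext ` FL.HH \<subseteq> KN.HH"
proof safe
  fix A assume "A \<in> FL.HH"
  then obtain C where C: "FL.B.is_frac C" "A = FL.ext C" using FL.HH_iff by blast
  have "LN.ext A = KN.ext (FK.ext C)" unfolding C(2) ext_ext_K ext_ext_L ..
  then show "LN.ext A \<in> KN.HH" using KN.ext_HH[OF FK.ext_frac[OF C(1)]] by simp
qed

lemma nm_HH: "LN.nm ` KN.HH \<subseteq> FL.HH"
proof safe
  fix A assume "A \<in> KN.HH"
  then obtain C where C: "KN.B.is_frac C" "A = KN.ext C" using KN.HH_iff by blast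
  then show "LN.nm A \<in> FL.HH" using nm_ext_K[OF C(1)] FL.ext_HH[OF FK.nm_frac[OF C(1)]] by simp
qed

lemma nm_nat_pow: "KN.T.is_frac A \<Longrightarrow> LN.nm (A [^]\<^bsub>IN\<^esub> (k::nat)) = LN.nm A [^]\<^bsub>IL\<^esub> k"
proof -
  interpret h: group_hom IN IL LN.nm by unfold_locales (rule LN.nm_hom)
  show "KN.T.is_frac A \<Longrightarrow> ?thesis" using h.hom_nat_pow[of A k] by simp
qed

lemma ext_DD: "LN.ext ` FL.DD \<subseteq> KN.DD"
proof safe
  fix A assume "A \<in> FL.DD"
  then have A: "FL.T.is_frac A" "A [^]\<^bsub>IL\<^esub> p \<in> FL.HH" unfolding FL.DD_iff by auto
  then have "LN.ext A [^]\<^bsub>IN\<^esub> p \<in> KN.HH" using ext_HH LN.ext_nat_pow[OF A(1), of p] by force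
  then show "LN.ext A \<in> KN.DD" unfolding KN.DD_iff using LN.ext_frac[OF A(1)] by simp
qed

lemma nm_DD: "LN.nm ` KN.DD \<subseteq> FL.DD"
proof safe
  fix A assume "A \<in> KN.DD"
  then have A: "KN.T.is_frac A" "A [^]\<^bsub>IN\<^esub> p \<in> KN.HH" unfolding KN.DD_iff by auto
  then have "LN.nm A [^]\<^bsub>IL\<^esub> p \<in> FL.HH" using nm_HH nm_nat_pow[OF A(1)] by force
  then show "LN.nm A \<in> FL.DD" unfolding FL.DD_iff using LN.nm_frac[OF A(1)] by simp
qed

abbreviation "DGL \<equiv> differential_group p F L"
abbreviation "DGN \<equiv> differential_group p K N"

lemma DGL_eq: "DGL = FL.S.QG" and DGN_eq: "DGN = KN.S.QG"
  by (rule differential_group_def)+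

lemma ext_bar_cls: "A \<in> FL.DD \<Longrightarrow> ext_bar K N (FL.S.cls A) = KN.S.cls (LN.ext A)"
  unfolding ext_bar_def
  by (rule induced_map_cls[OF FL.S.subquotient_axioms KN.S.subquotient_axioms LN.ext_hom ext_HH FL.S.D_carrier])

lemma norm_bar_cls: "A \<in> KN.DD \<Longrightarrow> norm_bar F L N (KN.S.cls A) = FL.S.cls (LN.nm A)"
  unfolding norm_bar_def
  by (rule induced_map_cls[OF KN.S.subquotient_axioms FL.S.subquotient_axioms LN.nm_hom nm_HH KN.S.D_carrier])

lemma ext_bar_hom: "ext_bar K N \<in> hom DGL DGN"
  unfolding DGL_eq DGN_eq ext_bar_def
  by (rule induced_map_hom[OF FL.S.subquotient_axioms KN.S.subquotient_axioms LN.ext_hom ext_HH ext_DD])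

lemma norm_bar_hom: "norm_bar F L N \<in> hom DGN DGL"
  unfolding DGL_eq DGN_eq norm_bar_def
  by (rule induced_map_hom[OF KN.S.subquotient_axioms FL.S.subquotient_axioms LN.nm_hom nm_HH nm_DD])

lemma odd_p: "odd p"
  using prime_odd_nat[OF prime_p] p_ge_3 by simp

lemma DGL_pow: "x \<in> carrier DGL \<Longrightarrow> x [^]\<^bsub>DGL\<^esub> p = \<one>\<^bsub>DGL\<^esub>"
proof -
  assume "x \<in> carrier DGL"
  then obtain A where A: "A \<in> FL.DD" "x = FL.S.cls A" unfolding DGL_eq FL.S.Quot_carrier by blast
  then have "A [^]\<^bsub>IL\<^esub> p \<in> FL.HH" unfolding FL.DD_iff by blast
  then show ?thesis
    unfolding DGL_eq A(2) FL.S.cls_nat_pow[OF A(1)] using FL.S.cls_eq_one_iff FL.S.H_carrier by blast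
qed

lemma DGN_pow: "x \<in> carrier DGN \<Longrightarrow> x [^]\<^bsub>DGN\<^esub> p = \<one>\<^bsub>DGN\<^esub>"
proof -
  assume "x \<in> carrier DGN"
  then obtain A where A: "A \<in> KN.DD" "x = KN.S.cls A" unfolding DGN_eq KN.S.Quot_carrier by blast
  then have "A [^]\<^bsub>IN\<^esub> p \<in> KN.HH" unfolding KN.DD_iff by blast
  then show ?thesis
    unfolding DGN_eq A(2) KN.S.cls_nat_pow[OF A(1)] using KN.S.cls_eq_one_iff KN.S.H_carrier by blast
qed

lemma norm_bar_ext_bar:
  assumes "x \<in> carrier DGL" shows "norm_bar F L N (ext_bar K N x) = x \<otimes>\<^bsub>DGL\<^esub> x"
proof -
  obtain A where A: "A \<in> FL.DD" "x = FL.S.cls A" using assms unfolding DGL_eq FL.S.Quot_carrier by blast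
  have frA: "FL.T.is_frac A" using A(1) FL.DD_iff by blast
  have "norm_bar F L N (ext_bar K N x) = FL.S.cls (LN.nm (LN.ext A))"
    unfolding A(2) ext_bar_cls[OF A(1)] using ext_DD A(1) by (intro norm_bar_cls) blast
  also have "LN.nm (LN.ext A) = A \<otimes>\<^bsub>IL\<^esub> A" using LN.nm_ext[OF frA] by simp
  also have "FL.S.cls (A \<otimes>\<^bsub>IL\<^esub> A) = x \<otimes>\<^bsub>DGL\<^esub> x"
    unfolding DGL_eq A(2) using FL.S.cls_mult FL.S.D_carrier[OF A(1)] by metis
  finally show ?thesis .
qed

sublocale NS: norm_section DGL DGN "ext_bar K N" "norm_bar F L N" p
proof (intro norm_section.intro norm_section_axioms.intro)
  show "comm_group DGL" unfolding DGL_eq by (rule FL.S.comm_group_Quot)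
  show "comm_group DGN" unfolding DGN_eq by (rule KN.S.comm_group_Quot)
qed (fact ext_bar_hom norm_bar_hom norm_bar_ext_bar odd_p DGL_pow)+

subsection \<open>Ramification in the tower\<close>

lemma below_below: "FK.below (KN.below P) = FL.below (LN.below P)"
  using FK.OK_sub_OE FL.OK_sub_OE by blast

text \<open>Multiplicativity of ramification indices along the two paths from F to N, through K and
  through L.\<close>

lemma ramification_tower:
  assumes P: "P \<in> prime_ideals N"
  shows "KN.B.val (KN.below P) (FK.ext (FK.below (KN.below P))) * KN.T.val P (KN.ext (KN.below P)) =
    FL.T.val (LN.below P) (FL.ext (FL.below (LN.below P))) * KN.T.val P (LN.ext (LN.below P))"
proof -
  note k = KN.below_prime[OF P] and l = LN.below_prime[OF P]
  have "KN.T.val P (KN.ext (FK.ext (FK.below (KN.below P)))) =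
      KN.T.val P (LN.ext (FL.ext (FL.below (LN.below P))))"
    unfolding ext_ext_K ext_ext_L below_below ..
  then show ?thesis
    using KN.val_ext[OF P FK.ext_frac[OF FL.B.prime_frac[OF FK.below_prime[OF k]]]]
      LN.val_ext[OF P FL.ext_frac[OF FL.B.prime_frac[OF FL.below_prime[OF l]]]] by simp
qed

text \<open>The quadratic step has index 1 or 2, which is prime to p, so the factor p of the product
  of the indices must come from the step of degree p. The same argument along the other path gives
  \<open>totally_ramified_down\<close>.\<close>

lemma totally_ramified_up:
  assumes P: "P \<in> prime_ideals N" and t: "totally_ramified F L (LN.below P)"
  shows "totally_ramified K N P"
proof -
  note k = KN.below_prime[OF P] and l = LN.below_prime[OF P]
  let ?a = "KN.B.val (KN.below P) (FK.ext (FK.below (KN.below P)))"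
  let ?e = "KN.T.val P (KN.ext (KN.below P))"
  have a: "?a > 0" "?a \<le> 2" using FK.ext_below_pos[OF k] FK2.ramification_index_le[OF k] by simp_all
  have "FL.T.val (LN.below P) (FL.ext (FL.below (LN.below P))) = int p"
    using t unfolding FL.totally_ramified_iff_val by simp
  then have "int p dvd ?a * ?e" using ramification_tower[OF P] by simp
  moreover have "Factorial_Ring.prime (int p)" using prime_p by simp
  moreover have "\<not> int p dvd ?a" using zdvd_imp_le[OF _ a(1), of "int p"] a(2) p_ge_3 by linarith
  ultimately have "int p dvd ?e" using prime_dvd_mult_iff by blast
  then have "?e \<ge> int p" using zdvd_imp_le KN.ext_below_pos[OF P] by blast
  then show ?thesis
    unfolding KN.totally_ramified_iff_val using KN.ramification_index_le[OF P] P by simp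
qed

lemma totally_ramified_down:
  assumes "totally_ramified K N P"
  shows "totally_ramified F L (LN.below P)"
proof -
  have P: "P \<in> prime_ideals N" "KN.T.val P (KN.ext (KN.below P)) = int p"
    using assms unfolding KN.totally_ramified_iff_val by auto
  note k = KN.below_prime[OF P(1)] and l = LN.below_prime[OF P(1)]
  let ?a = "KN.T.val P (LN.ext (LN.below P))"
  let ?e = "FL.T.val (LN.below P) (FL.ext (FL.below (LN.below P)))"
  have a: "?a > 0" "?a \<le> 2" using LN.ext_below_pos[OF P(1)] LN2.ramification_index_le[OF P(1)] by simp_all
  have "int p dvd ?e * ?a" using ramification_tower[OF P(1)] P(2) by (metis dvd_triv_right)
  moreover have "Factorial_Ring.prime (int p)" using prime_p by simp
  moreover have "\<not> int p dvd ?a" using zdvd_imp_le[OF _ a(1), of "int p"] a(2) p_ge_3 by linarith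
  ultimately have "int p dvd ?e" using prime_dvd_mult_iff by blast
  then have "?e \<ge> int p" using zdvd_imp_le FL.ext_below_pos[OF l] by blast
  then show ?thesis
    unfolding FL.totally_ramified_iff_val using FL.ramification_index_le[OF l] l by simp
qed

text \<open>Both factors lie over p', so neither is fixed by conjugation. The extension of p' is
  then also P times the conjugate of P, and cancelling P shows that conjugation exchanges the
  factors; the norms follow by injectivity of extension.\<close>

lemma split_primes:
  assumes p: "p' \<in> prime_ideals L" and P: "P \<in> prime_ideals N" "P' \<in> prime_ideals N" "P \<noteq> P'"
    and eq: "LN.ext p' = P \<star> P'"
  shows "LN.below P = p'" "LN.below P' = p'" "LN.cj P = P'" "LN.cj P' = P" "LN.nm P = p'" "LN.nm P' = p'"
proof -
  have below: "LN.below P = p'" if P: "P \<in> prime_ideals N" "P' \<in> prime_ideals N" and eq: "LN.ext p' = P \<star> P'" for P P'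
  proof -
    have "p' \<subseteq> P" using LN.ext_sub[of p'] KN.T.imul_subset[OF KN.T.primeD(1)[OF P(1)] KN.T.primeD(1)[OF P(2)]] eq by blast
    then have "p' \<subseteq> LN.below P" using FL.T.iidealD(2)[OF FL.T.primeD(1)[OF p]] by blast
    then show ?thesis using FL.T.prime_subset_eq[OF p LN.below_prime[OF P(1)]] by simp
  qed
  have eq': "LN.ext p' = P' \<star> P" using eq imul_commute by simp
  show b: "LN.below P = p'" "LN.below P' = p'" using below[OF P(1,2) eq] below[OF P(2,1) eq'] by auto
  have cj: "LN.cj P = P'" if P: "P \<in> prime_ideals N" "P' \<in> prime_ideals N" "P \<noteq> P'" and eq: "LN.ext p' = P \<star> P'"
    and b: "LN.below P = p'" "LN.below P' = p'" for P P'
  proof -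
    have "LN.cj P \<noteq> P" using LN.cj_ne_if_split[OF P(1,2)] P(3) b by simp
    then have "LN.ext (LN.below P) = P \<star> LN.cj P"
      using LN2.quadratic_split[OF refl P(1) LN.cj_prime[OF P(1)]] LN.below_cj[OF P(1)] by simp
    then have "P \<star> P' = P \<star> LN.cj P" using eq b by simp
    then show ?thesis
      using KN.T.imul_cancel[OF KN.T.prime_frac[OF P(1)] KN.T.prime_frac[OF P(2)] KN.T.prime_frac[OF LN.cj_prime[OF P(1)]]]
      by simp
  qed
  show c: "LN.cj P = P'" "LN.cj P' = P" using cj[OF P eq b] cj[OF P(2,1) P(3)[symmetric] eq' b(2,1)] by auto
  have nm: "LN.nm P = p'" if "P \<in> prime_ideals N" "LN.ext p' = P \<star> LN.cj P" for P
    using LN.ext_inj[OF LN.nm_frac[OF KN.T.prime_frac[OF that(1)]] FL.T.prime_frac[OF p]]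
      LN.ext_nm[OF KN.T.prime_frac[OF that(1)]] that(2) by simp
  show "LN.nm P = p'" "LN.nm P' = p'" using nm[OF P(1)] nm[OF P(2)] c eq eq' by simp_all
qed

text \<open>A prime Q Q' would be contained in, and hence equal to, both Q and Q'. This keeps the
  two lists of primes disjoint when they are counted.\<close>

lemma not_split_and_inert: "\<not> (splits_in N P \<and> inert_in N P)"
proof
  assume "splits_in N P \<and> inert_in N P"
  then have "splits_in N P" and R': "extend_ideal N P \<in> prime_ideals N" unfolding inert_in_def by auto
  then obtain Q Q' where Q: "Q \<in> prime_ideals N" "Q' \<in> prime_ideals N" "Q \<noteq> Q'"
    and eq: "extend_ideal N P = Q \<otimes>\<^bsub>IN\<^esub> Q'" unfolding splits_in_def by blast
  have R: "Q \<star> Q' \<in> prime_ideals N" using R' eq by simp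
  note QI = KN.T.primeD(1)[OF Q(1)] KN.T.primeD(1)[OF Q(2)]
  have "Q \<star> Q' = Q" using KN.T.prime_subset_eq[OF R Q(1)] KN.T.imul_subset[OF QI] by blast
  moreover have "Q' \<star> Q = Q'"
    using KN.T.prime_subset_eq[OF R Q(2)] KN.T.imul_subset[OF QI(2,1)] imul_commute by simp
  ultimately show False using Q(3) imul_commute by simp
qed

subsection \<open>The kernel of the norm\<close>

text \<open>The ideals whose classes form the kernel of the norm: with them the kernel is itself a
  subquotient, open to \<open>Fp_basisI\<close>.\<close>

definition D' :: "complex set set" where "D' = {A \<in> KN.DD. LN.nm A \<in> FL.HH}"

lemma D'_subgroup: "subgroup D' IN"
proof (rule KN.T.G.subgroupI)
  interpret h: group_hom IN IL LN.nm by unfold_locales (rule LN.nm_hom)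
  show "D' \<subseteq> carrier IN" unfolding D'_def using KN.S.D_carrier by blast
  have "\<one>\<^bsub>IN\<^esub> \<in> D'" unfolding D'_def using KN.S.D_closed(1) FL.S.H_closed(1) h.hom_one by simp
  then show "D' \<noteq> {}" by blast
  fix A assume A: "A \<in> D'"
  then have AD: "A \<in> KN.DD" "LN.nm A \<in> FL.HH" "A \<in> carrier IN" unfolding D'_def using KN.S.D_carrier by auto
  show "inv\<^bsub>IN\<^esub> A \<in> D'"
    unfolding D'_def using KN.S.D_closed(3)[OF AD(1)] FL.S.H_closed(3)[OF AD(2)] h.hom_inv[OF AD(3)] by simp
  fix C assume "C \<in> D'"
  then have CD: "C \<in> KN.DD" "LN.nm C \<in> FL.HH" "C \<in> carrier IN" unfolding D'_def using KN.S.D_carrier by auto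
  have "A \<otimes>\<^bsub>IN\<^esub> C \<in> KN.DD" by (rule KN.S.D_closed(2)[OF AD(1) CD(1)])
  moreover have "LN.nm (A \<otimes>\<^bsub>IN\<^esub> C) \<in> FL.HH"
    unfolding h.hom_mult[OF AD(3) CD(3)] by (rule FL.S.H_closed(2)[OF AD(2) CD(2)])
  ultimately show "A \<otimes>\<^bsub>IN\<^esub> C \<in> D'" unfolding D'_def by blast
qed

lemma HH_D': "KN.HH \<subseteq> D'"
  unfolding D'_def using KN.HH_DD nm_HH by blast

sublocale S': subquotient IN D' KN.HH
  by (intro subquotient.intro subquotient_axioms.intro KN.T.comm_group_ideals D'_subgroup KN.HH_subgroup HH_D')

text \<open>The equality is literal and not only up to isomorphism, since cosets and their product
  are formed in the full ideal group of N.\<close>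

lemma kernel_eq: "subgroup_of DGN (relative_factors p F K L N) = S'.QG"
proof -
  have "relative_factors p F K L N = KN.S.cls ` D'"
  proof
    show "relative_factors p F K L N \<subseteq> KN.S.cls ` D'"
    proof
      fix x assume "x \<in> relative_factors p F K L N"
      then have x: "x \<in> carrier DGN" "norm_bar F L N x = \<one>\<^bsub>DGL\<^esub>"
        unfolding relative_factors_def kernel_def by auto
      then obtain A where A: "A \<in> KN.DD" "x = KN.S.cls A" unfolding DGN_eq KN.S.Quot_carrier by blast
      then have "LN.nm A \<in> FL.HH"
        using x(2) unfolding A(2) norm_bar_cls[OF A(1)] DGL_eq
        using FL.S.cls_eq_one_iff[of "LN.nm A"] nm_DD FL.S.D_carrier by blast
      then show "x \<in> KN.S.cls ` D'" using A unfolding D'_def by blast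
    qed
    show "KN.S.cls ` D' \<subseteq> relative_factors p F K L N"
    proof safe
      fix A assume "A \<in> D'"
      then have A: "A \<in> KN.DD" "LN.nm A \<in> FL.HH" unfolding D'_def by auto
      then have "norm_bar F L N (KN.S.cls A) = \<one>\<^bsub>DGL\<^esub>"
        unfolding norm_bar_cls[OF A(1)] DGL_eq using FL.S.cls_eq_one_iff[OF FL.S.H_carrier[OF A(2)]] by blast
      then show "KN.S.cls A \<in> relative_factors p F K L N"
        unfolding relative_factors_def kernel_def DGN_eq KN.S.Quot_carrier using A(1) by blast
    qed
  qed
  moreover have "carrier S'.QG = KN.S.cls ` D'" by (rule S'.Quot_carrier)
  ultimately show ?thesis
    unfolding subgroup_of_def DGN_eq FactGroup_def by (simp add: set_mult_def fun_eq_iff)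
qed

end

section \<open>Generators of the kernel from the split primes\<close>

locale split_family = tower +
  fixes s :: nat and \<pp> \<PP> \<PP>' :: "nat \<Rightarrow> complex set"
  assumes split_enum: "bij_betw \<pp> {1..s} {P. totally_ramified F L P \<and> splits_in N P}"
    and split_dec: "i \<in> {1..s} \<Longrightarrow> \<PP> i \<in> prime_ideals N \<and> \<PP>' i \<in> prime_ideals N \<and> \<PP> i \<noteq> \<PP>' i \<and>
           extend_ideal N (\<pp> i) = \<PP> i \<star> \<PP>' i"
begin

definition rel_gen :: "nat \<Rightarrow> complex set" where "rel_gen i = \<PP> i \<otimes>\<^bsub>IN\<^esub> (\<PP>' i [^]\<^bsub>IN\<^esub> (p - 1))"

lemma pp: assumes "i \<in> {1..s}" shows "\<pp> i \<in> FL.TT" "\<pp> i \<in> prime_ideals L"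
proof -
  show "\<pp> i \<in> FL.TT" using bij_betw_apply[OF split_enum assms] by blast
  then show "\<pp> i \<in> prime_ideals L" by (rule FL.TT_D(1))
qed

lemma PP: assumes i: "i \<in> {1..s}"
  shows "\<PP> i \<in> prime_ideals N" "\<PP>' i \<in> prime_ideals N" "\<PP> i \<noteq> \<PP>' i" "LN.ext (\<pp> i) = \<PP> i \<star> \<PP>' i"
  using split_dec[OF i] by auto

lemmas PP_split = split_primes[OF pp(2) PP(1) PP(2) PP(3) PP(4)]

lemma PP_TT: assumes i: "i \<in> {1..s}" shows "\<PP> i \<in> KN.TT" "\<PP>' i \<in> KN.TT"
  using totally_ramified_up[OF PP(1)[OF i]] totally_ramified_up[OF PP(2)[OF i]] PP_split(1,2)[OF i i i i i] pp(1)[OF i]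
  by simp_all

lemma PP_frac: assumes i: "i \<in> {1..s}"
  shows "KN.T.is_frac (\<PP> i)" "KN.T.is_frac (\<PP>' i)" "KN.T.is_frac (\<PP>' i [^]\<^bsub>IN\<^esub> (k::nat))" "KN.T.is_frac (rel_gen i)"
  using KN.T.prime_frac[OF PP(1)[OF i]] KN.T.prime_frac[OF PP(2)[OF i]] KN.T.frac_nat_pow KN.T.frac_imul
  unfolding rel_gen_def by simp_all

text \<open>Both primes have norm \<open>\<pp> i\<close>, so the norm of the generator is its p-th
  power, an ideal of F by total ramification.\<close>

lemma rel_gen_D': assumes i: "i \<in> {1..s}" shows "rel_gen i \<in> D'"
proof -
  have DD: "\<PP> i \<in> KN.DD" "\<PP>' i \<in> KN.DD" using KN.TT_DD PP_TT[OF i] by auto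
  have pow: "\<PP>' i [^]\<^bsub>IN\<^esub> (p - 1) \<in> KN.DD"
    using KN.T.G.subgroup_int_pow_closed[OF KN.DD_subgroup DD(2), of "int (p - 1)"] by (simp only: int_pow_int)
  have xD: "rel_gen i \<in> KN.DD" unfolding rel_gen_def by (rule KN.S.D_closed(2)[OF DD(1) pow])
  have "LN.nm (rel_gen i) = \<pp> i \<star> (\<pp> i [^]\<^bsub>IL\<^esub> (p - 1))"
    unfolding rel_gen_def using LN.nm_imul[OF PP_frac(1)[OF i] PP_frac(3)[OF i]] nm_nat_pow[OF PP_frac(2)[OF i]]
      PP_split(5,6)[OF i i i i i] by simp
  also have "\<dots> = \<pp> i [^]\<^bsub>IL\<^esub> p"
  proof -
    have "p = Suc (p - 1)" using p_ge_3 by simp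
    then have "\<pp> i [^]\<^bsub>IL\<^esub> p = \<pp> i [^]\<^bsub>IL\<^esub> (p - 1) \<star> \<pp> i"
      by (metis FL.T.G.nat_pow_Suc FL.T.ideal_group_simps(2))
    then show ?thesis using imul_commute by simp
  qed
  finally show ?thesis unfolding D'_def using xD FL.TT_pow[OF pp(1)[OF i]] by simp
qed

text \<open>The valuations at the primes \<open>\<PP> j\<close> alone form an identity matrix, which
  separates the generators; the primes \<open>\<PP>' j\<close> are left aside.\<close>

lemma val_rel_gen:
  assumes i: "i \<in> {1..s}" and j: "j \<in> {1..s}"
  shows "KN.T.val (\<PP> j) (rel_gen i) = (if i = j then 1 else 0)"
proof -
  have v: "KN.T.val (\<PP> j) (rel_gen i) = KN.T.val (\<PP> j) (\<PP> i) + int (p - 1) * KN.T.val (\<PP> j) (\<PP>' i)"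
    unfolding rel_gen_def using KN.T.val_imul[OF PP(1)[OF j] PP_frac(1)[OF i] PP_frac(3)[OF i]]
      KN.T.val_nat_pow[OF PP(1)[OF j] PP_frac(2)[OF i]] by simp
  have inj: "\<pp> i = \<pp> j \<Longrightarrow> i = j" using split_enum i j by (metis bij_betw_def inj_onD)
  have b: "LN.below (\<PP> i) = \<pp> i" "LN.below (\<PP>' i) = \<pp> i" "LN.below (\<PP> j) = \<pp> j"
    using PP_split(1,2)[OF i i i i i] PP_split(1)[OF j j j j j] by auto
  have "\<PP> j \<noteq> \<PP>' i" using b inj PP(3)[OF i] by metis
  then have "KN.T.val (\<PP> j) (\<PP>' i) = 0" by (rule KN.T.val_other_prime[OF PP(1)[OF j] PP(2)[OF i]])
  moreover have "KN.T.val (\<PP> j) (\<PP> i) = (if i = j then 1 else 0)"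
  proof (cases "i = j")
    case True then show ?thesis using KN.T.val_self[OF PP(1)[OF j]] by simp
  next
    case False
    then have "\<PP> j \<noteq> \<PP> i" using b inj by metis
    then show ?thesis using KN.T.val_other_prime[OF PP(1)[OF j] PP(1)[OF i]] False by simp
  qed
  ultimately show ?thesis using v by simp
qed

abbreviation "\<Gamma> \<equiv> generate IN (KN.HH \<union> rel_gen ` {1..s})"

lemma \<Gamma>_subgroup: "subgroup \<Gamma> IN"
  by (rule KN.T.G.generate_is_subgroup) (use PP_frac(4) KN.S.H_carrier in auto)

lemma HH_\<Gamma>: "A \<in> KN.HH \<Longrightarrow> A \<in> \<Gamma>"
  by (rule generate.incl) simp

text \<open>The operator 1 - \<tau>, written multiplicatively.\<close>

definition \<delta> :: "complex set \<Rightarrow> complex set" where "\<delta> A = A \<star> inv\<^bsub>IN\<^esub> (LN.cj A)"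

text \<open>The quotient of \<open>\<PP> i\<close> by its conjugate \<open>\<PP>' i\<close> is the
  generator divided by the p-th power of \<open>\<PP>' i\<close>, an ideal of K. The other quotient
  is its inverse.\<close>

lemma \<delta>_PP: assumes i: "i \<in> {1..s}" shows "\<delta> (\<PP> i) \<in> \<Gamma>" "\<delta> (\<PP>' i) \<in> \<Gamma>"
proof -
  note fr = PP_frac(1,2)[OF i] and cj = PP_split(3,4)[OF i i i i i]
  have "p = Suc (p - 1)" using p_ge_3 by simp
  then have "\<PP>' i [^]\<^bsub>IN\<^esub> p = \<PP>' i [^]\<^bsub>IN\<^esub> (p - 1) \<star> \<PP>' i"
    by (metis KN.T.G.nat_pow_Suc KN.T.ideal_group_simps(2))
  then have "\<delta> (\<PP> i) \<star> (\<PP>' i [^]\<^bsub>IN\<^esub> p) = \<PP> i \<star> (\<PP>' i [^]\<^bsub>IN\<^esub> (p - 1)) \<star> (inv\<^bsub>IN\<^esub> (\<PP>' i) \<star> \<PP>' i)"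
    unfolding \<delta>_def cj by (simp only: imul_ac)
  also have "\<dots> = rel_gen i"
    using KN.T.imul_inv(2)[OF fr(2)] KN.T.imul_one(1)[OF PP_frac(4)[OF i]] unfolding rel_gen_def by simp
  finally have eq: "\<delta> (\<PP> i) \<star> (\<PP>' i [^]\<^bsub>IN\<^esub> p) = rel_gen i" .
  have \<delta>fr: "KN.T.is_frac (\<delta> (\<PP> i))" unfolding \<delta>_def cj by (rule KN.T.frac_imul[OF fr(1) KN.T.frac_inv[OF fr(2)]])
  have "rel_gen i \<star> inv\<^bsub>IN\<^esub> (\<PP>' i [^]\<^bsub>IN\<^esub> p) = \<delta> (\<PP> i)"
    unfolding eq[symmetric] by (rule KN.T.imul_inv_cancel[OF \<delta>fr PP_frac(3)[OF i]])
  moreover have "rel_gen i \<in> \<Gamma>" using generate.incl[of "rel_gen i" "KN.HH \<union> rel_gen ` {1..s}" IN] i by blast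
  moreover have "inv\<^bsub>IN\<^esub> (\<PP>' i [^]\<^bsub>IN\<^esub> p) \<in> \<Gamma>"
    by (rule subgroup.m_inv_closed[OF \<Gamma>_subgroup HH_\<Gamma>[OF KN.TT_pow[OF PP_TT(2)[OF i]]]])
  ultimately show 1: "\<delta> (\<PP> i) \<in> \<Gamma>" using subgroup.m_closed[OF \<Gamma>_subgroup] by fastforce
  have "\<delta> (\<PP>' i) = inv\<^bsub>IN\<^esub> (\<delta> (\<PP> i))"
    unfolding \<delta>_def cj using KN.T.G.inv_mult[of "\<PP> i" "inv\<^bsub>IN\<^esub> (\<PP>' i)"] fr KN.T.frac_inv imul_commute by simp
  then show "\<delta> (\<PP>' i) \<in> \<Gamma>" using subgroup.m_inv_closed[OF \<Gamma>_subgroup 1] by simp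
qed

text \<open>A prime fixed by \<tau>, whether it lies over an inert or a ramified prime of L, has
  trivial image. Otherwise P and its conjugate make up the prime below, which is split and totally
  ramified and hence in the list.\<close>

lemma \<delta>_TT: assumes P: "P \<in> KN.TT" shows "\<delta> P \<in> \<Gamma>"
proof (cases "LN.cj P = P")
  case True
  then have "\<delta> P = \<one>\<^bsub>IN\<^esub>" unfolding \<delta>_def using KN.T.imul_inv(1)[OF KN.T.prime_frac[OF KN.TT_D(1)[OF P]]] by simp
  then show ?thesis using generate.one by metis
next
  case False
  note Pp = KN.TT_D(1)[OF P]
  note cP = LN.cj_prime[OF Pp]
  have eq: "LN.ext (LN.below P) = P \<star> LN.cj P"
    using LN2.quadratic_split[OF refl Pp cP False] LN.below_cj[OF Pp] by simp
  then have "splits_in N (LN.below P)" unfolding splits_in_def using Pp cP False by (metis KN.T.ideal_group_simps(2))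
  moreover have "totally_ramified F L (LN.below P)" using totally_ramified_down P by blast
  ultimately obtain i where i: "i \<in> {1..s}" "LN.below P = \<pp> i"
    using split_enum unfolding bij_betw_def by blast
  have "P = \<PP> i \<or> P = \<PP>' i"
  proof (rule ccontr)
    assume n: "\<not> (P = \<PP> i \<or> P = \<PP>' i)"
    have "KN.T.val P (\<PP> i \<star> \<PP>' i) = 0"
      using KN.T.val_imul[OF Pp PP_frac(1,2)[OF i(1)]] KN.T.val_other_prime[OF Pp PP(1)[OF i(1)]]
        KN.T.val_other_prime[OF Pp PP(2)[OF i(1)]] n by simp
    moreover have "KN.T.val P (LN.ext (LN.below P)) > 0" by (rule LN.ext_below_pos[OF Pp])
    ultimately show False using i(2) PP(4)[OF i(1)] by simp
  qed
  then show ?thesis using \<delta>_PP[OF i(1)] by blast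
qed

text \<open>\<delta> is a homomorphism, so it is enough to look at the generators: ideals of K,
  which \<tau> preserves, and totally ramified primes.\<close>

lemma \<delta>_DD: assumes A: "A \<in> KN.DD" shows "\<delta> A \<in> \<Gamma>"
proof -
  interpret c: group_hom IN IN LN.cj by unfold_locales (rule LN.cj_hom)
  let ?S = "{A \<in> carrier IN. \<delta> A \<in> \<Gamma>}"
  have "subgroup ?S IN"
  proof (rule KN.T.G.subgroupI)
    have "\<delta> \<one>\<^bsub>IN\<^esub> = \<one>\<^bsub>IN\<^esub>" unfolding \<delta>_def using KN.T.imul_inv(1)[OF KN.T.frac_O] LN.cj_OE by simp
    then have "\<one>\<^bsub>IN\<^esub> \<in> ?S" using generate.one[of IN] KN.T.frac_O by simp
    then show "?S \<noteq> {}" by blast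
    fix A assume A: "A \<in> ?S"
    then have fA: "KN.T.is_frac A" by simp
    have "\<delta> (inv\<^bsub>IN\<^esub> A) = inv\<^bsub>IN\<^esub> (\<delta> A)"
      unfolding \<delta>_def using c.hom_inv[of A] KN.T.G.inv_mult[of A "inv\<^bsub>IN\<^esub> (LN.cj A)"]
        fA KN.T.frac_inv LN.cj_frac by simp
    then show "inv\<^bsub>IN\<^esub> A \<in> ?S" using A subgroup.m_inv_closed[OF \<Gamma>_subgroup] KN.T.frac_inv by simp
    fix C assume C: "C \<in> ?S"
    then have fC: "KN.T.is_frac C" by simp
    have "\<delta> (A \<star> C) = (A \<star> C) \<star> (inv\<^bsub>IN\<^esub> (LN.cj A) \<star> inv\<^bsub>IN\<^esub> (LN.cj C))"
      unfolding \<delta>_def using c.hom_mult[of A C] KN.T.G.inv_mult[of "LN.cj A" "LN.cj C"] fA fC LN.cj_frac by simp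
    also have "\<dots> = \<delta> A \<star> \<delta> C" unfolding \<delta>_def by (simp only: imul_ac)
    finally show "A \<otimes>\<^bsub>IN\<^esub> C \<in> ?S" using A C subgroup.m_closed[OF \<Gamma>_subgroup, of "\<delta> A" "\<delta> C"] KN.T.frac_imul by simp
  qed auto
  moreover have "KN.HH \<union> KN.TT \<subseteq> ?S"
  proof
    fix A assume "A \<in> KN.HH \<union> KN.TT"
    then show "A \<in> ?S"
    proof
      assume A: "A \<in> KN.HH"
      then have "inv\<^bsub>IN\<^esub> (LN.cj A) \<in> KN.HH" using KN.S.H_closed(3) cj_HH by blast
      then have "A \<otimes>\<^bsub>IN\<^esub> inv\<^bsub>IN\<^esub> (LN.cj A) \<in> KN.HH" by (rule KN.S.H_closed(2)[OF A])
      then show "A \<in> ?S" using HH_\<Gamma> KN.S.H_carrier[OF A] unfolding \<delta>_def by simp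
    next
      assume A: "A \<in> KN.TT"
      then show "A \<in> ?S" using \<delta>_TT[OF A] KN.T.prime_frac[OF KN.TT_D(1)[OF A]] by simp
    qed
  qed
  ultimately have "generate IN (KN.HH \<union> KN.TT) \<subseteq> ?S" by (rule KN.T.G.generate_subgroup_incl[rotated])
  then show ?thesis using KN.DD_generated[OF A] by blast
qed

text \<open>On the kernel of the norm, \<open>\<tau>\<close> acts as inversion, so that \<open>A\<^sup>2\<close> is \<open>\<delta> A = A / \<tau> A\<close> up to ideals of \<open>K\<close>.\<close>

lemma D'_generated: assumes A: "A \<in> D'" shows "A \<in> \<Gamma>"
proof -
  have AD: "A \<in> KN.DD" "LN.nm A \<in> FL.HH" using A unfolding D'_def by auto
  then have fA: "KN.T.is_frac A" "A [^]\<^bsub>IN\<^esub> p \<in> KN.HH" unfolding KN.DD_iff by auto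
  note fc = LN.cj_frac[OF fA(1)]
  have "A \<star> LN.cj A \<in> KN.HH" using ext_HH AD(2) LN.ext_nm[OF fA(1)] by force
  then have "\<delta> A \<otimes>\<^bsub>IN\<^esub> (A \<star> LN.cj A) \<in> \<Gamma>" using subgroup.m_closed[OF \<Gamma>_subgroup \<delta>_DD[OF AD(1)]] HH_\<Gamma> by blast
  moreover have "\<delta> A \<star> (A \<star> LN.cj A) = A \<star> A \<star> (inv\<^bsub>IN\<^esub> (LN.cj A) \<star> LN.cj A)"
    unfolding \<delta>_def by (simp only: imul_ac)
  then have "\<delta> A \<star> (A \<star> LN.cj A) = A \<star> A"
    using KN.T.imul_inv(2)[OF fc] KN.T.imul_one(1)[OF KN.T.frac_imul[OF fA(1,1)]] by simp
  ultimately have sq: "A [^]\<^bsub>IN\<^esub> (2::nat) \<in> \<Gamma>"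
    using KN.T.imul_one(2)[OF fA(1)] by (simp add: numeral_2_eq_2)
  \<comment> \<open>As p + 1 is even, A^(p+1) is a power of the square of A, and A is the quotient
    of A^(p+1) by A^p, where A^p comes from K.\<close>
  have "(p + 1) = 2 * ((p + 1) div 2)" using odd_p by presburger
  then have "A [^]\<^bsub>IN\<^esub> (p + 1) = (A [^]\<^bsub>IN\<^esub> (2::nat)) [^]\<^bsub>IN\<^esub> ((p + 1) div 2)"
    using KN.T.G.nat_pow_pow[of A 2 "(p + 1) div 2"] fA(1) by simp
  then have "A [^]\<^bsub>IN\<^esub> (p + 1) \<in> \<Gamma>" 
    using KN.T.G.subgroup_int_pow_closed[OF \<Gamma>_subgroup sq, of "int ((p + 1) div 2)"] by (simp only: int_pow_int)
  moreover have "inv\<^bsub>IN\<^esub> (A [^]\<^bsub>IN\<^esub> p) \<in> \<Gamma>"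
    by (rule subgroup.m_inv_closed[OF \<Gamma>_subgroup HH_\<Gamma>[OF fA(2)]])
  ultimately have "A [^]\<^bsub>IN\<^esub> (p + 1) \<otimes>\<^bsub>IN\<^esub> inv\<^bsub>IN\<^esub> (A [^]\<^bsub>IN\<^esub> p) \<in> \<Gamma>" by (rule generate.eng)
  moreover have "A [^]\<^bsub>IN\<^esub> (p + 1) = A \<star> A [^]\<^bsub>IN\<^esub> p" using imul_commute by simp
  then have "A [^]\<^bsub>IN\<^esub> (p + 1) \<otimes>\<^bsub>IN\<^esub> inv\<^bsub>IN\<^esub> (A [^]\<^bsub>IN\<^esub> p) = A"
    using KN.T.imul_inv_cancel[OF fA(1) KN.T.frac_nat_pow[OF fA(1)]] by simp
  ultimately show ?thesis by simp
qed

lemma kernel_Fp_basis: "Fp_basis (subgroup_of DGN (relative_factors p F K L N)) p {1..s} (S'.cls \<circ> rel_gen)"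
  unfolding kernel_eq
proof (rule S'.Fp_basisI[OF prime_p])
  show "finite {1..s}" by simp
  show "rel_gen \<in> {1..s} \<rightarrow> D'" using rel_gen_D' by blast
  show "A [^]\<^bsub>IN\<^esub> p \<in> KN.HH" if "A \<in> D'" for A using that unfolding D'_def KN.DD_iff by blast
  show "A \<in> \<Gamma>" if "A \<in> D'" for A by (rule D'_generated[OF that])
  fix a j assume H: "pow_prod IN rel_gen {1..s} a \<in> KN.HH" and j: "j \<in> {1..s}"
  have "KN.T.val (\<PP> j) (pow_prod IN rel_gen {1..s} a) = (\<Sum>i\<in>{1..s}. a i * KN.T.val (\<PP> j) (rel_gen i))"
    by (rule KN.T.val_pow_prod(2)[OF PP(1)[OF j]]) (use PP_frac(4) in auto)
  also have "\<dots> = (\<Sum>i\<in>{1..s}. if i = j then a j else 0)"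
    by (intro sum.cong refl) (use val_rel_gen[OF _ j] in auto)
  also have "\<dots> = a j" using j by simp
  finally show "int p dvd a j" using KN.val_HH[OF PP_TT(1)[OF j] H] by simp
qed

lemma rel_gen_infinite_order:
  assumes i: "i \<in> {1..s}" and k: "rel_gen i [^]\<^bsub>IN\<^esub> (k::int) = \<one>\<^bsub>IN\<^esub>" shows "k = 0"
proof -
  have "KN.T.val (\<PP> i) (rel_gen i [^]\<^bsub>IN\<^esub> k) = k" using KN.T.val_int_pow[OF PP(1)[OF i] PP_frac(4)[OF i]] val_rel_gen[OF i i] by simp
  then show ?thesis using k KN.T.val_O[OF PP(1)[OF i]] by simp
qed

end

lemma (in nf) prime_infinite_order:
  assumes "P \<in> prime_ideals E" "P [^]\<^bsub>\<I>\<^esub> (k::int) = \<one>\<^bsub>\<I>\<^esub>" shows "k = 0"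
  using val_int_pow[OF assms(1) prime_frac[OF assms(1)], of k] val_self[OF assms(1)] val_O[OF assms(1)] assms(2) by simp

text \<open>The direct product is internal: \<open>ext_bar\<close> is injective, and multiplication
  maps the product of its image with the kernel of the norm isomorphically onto the whole group. A
  totally ramified prime of L may also ramify in N. It then belongs to neither list and is invisible
  in the kernel, but it adds a dimension to the absolute part. Hence the assertions on the kernel
  hold in general, while those that count all totally ramified primes are stated for the case that
  each of them splits or stays inert.\<close>

theorem theorem3p5:
  fixes p s n :: nat
    and F K L N :: "complex set"
    and \<pp> \<PP> \<PP>' \<qq> \<QQ> :: "nat \<Rightarrow> complex set"
  assumes "Factorial_Ring.prime p" and "p \<ge> 3"
    and "number_field F" and "number_field K" and "number_field L" and "number_field N"
    and "F \<subseteq> K" and "F \<subseteq> L"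
    and "has_degree F K 2" and "has_degree F L p"
    and "N = compositum L K"
    and "has_degree K N p" and "has_degree L N 2"
    and "F = L \<inter> K"
    and split_enum: "bij_betw \<pp> {1..s} {P. totally_ramified F L P \<and> splits_in N P}"
    and split_dec: "\<And>i. i \<in> {1..s} \<Longrightarrow>
           \<PP> i \<in> prime_ideals N \<and> \<PP>' i \<in> prime_ideals N \<and> \<PP> i \<noteq> \<PP>' i \<and>
           extend_ideal N (\<pp> i) = \<PP> i \<otimes>\<^bsub>ideal_group N\<^esub> \<PP>' i"
    and inert_enum: "bij_betw \<qq> {1..n} {P. totally_ramified F L P \<and> inert_in N P}"
    and inert_dec: "\<And>j. j \<in> {1..n} \<Longrightarrow> extend_ideal N (\<qq> j) = \<QQ> j"
  shows
    "ext_bar K N \<in> mon (differential_group p F L) (differential_group p K N) \<and>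
     norm_bar F L N \<in> hom (differential_group p K N) (differential_group p F L) \<and>
     (\<lambda>(x, y). x \<otimes>\<^bsub>differential_group p K N\<^esub> y) \<in>
       iso (subgroup_of (differential_group p K N) (absolute_factors p F K L N) \<times>\<times>
            subgroup_of (differential_group p K N) (relative_factors p F K L N))
           (differential_group p K N) \<and>
     subgroup_of (differential_group p K N) (relative_factors p F K L N) \<cong>
       product_group {1..s} (\<lambda>i. cyclic_quotient (ideal_group N) p
         (\<PP> i \<otimes>\<^bsub>ideal_group N\<^esub> (\<PP>' i [^]\<^bsub>ideal_group N\<^esub> (p - 1)))) \<and>
     subgroup_of (differential_group p K N) (relative_factors p F K L N) \<cong> Fp_power p s \<and>
     has_Fp_dim p (subgroup_of (differential_group p K N) (relative_factors p F K L N)) s \<and>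
     ((\<forall>P. totally_ramified F L P \<longrightarrow> splits_in N P \<or> inert_in N P) \<longrightarrow>
       differential_group p F L \<cong>
         product_group {1..s} (\<lambda>i. cyclic_quotient (ideal_group L) p (\<pp> i)) \<times>\<times>
         product_group {1..n} (\<lambda>j. cyclic_quotient (ideal_group L) p (\<qq> j)) \<and>
       differential_group p F L \<cong> Fp_power p (s + n) \<and>
       has_Fp_dim p (differential_group p F L) (s + n) \<and>
       has_Fp_dim p (differential_group p K N) (n + 2 * s))"
proof -
  interpret nfF: nf F by (rule nf.intro) fact
  interpret nfK: nf K by (rule nf.intro) fact
  interpret nfL: nf L by (rule nf.intro) fact
  interpret nfN: nf N by (rule nf.intro) fact
  have "L \<union> K \<subseteq> N"
    unfolding \<open>N = compositum L K\<close> compositum_def by (auto intro: generate_field.incl)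
  then have LN: "L \<subseteq> N" and KN: "K \<subseteq> N" by auto
  have FK: "nf_ext_degree F K 2" and FL: "nf_ext_degree F L p" and KNp: "nf_ext_degree K N p"
    and LN2: "nf_ext_degree L N 2"
    by (intro nf_ext_degree.intro nf_ext_degree_axioms.intro nf_ext.intro nf_ext_axioms.intro nf.intro; fact)+
  obtain \<theta> where \<theta>: "\<theta> \<in> K" "\<theta> \<notin> F" "\<theta>\<^sup>2 \<in> F" by (rule nf_ext_degree.quadratic_generator[OF FK refl])
  \<comment> \<open>An element of K outside F is outside L, since F = L \<inter> K.\<close>
  have \<theta>L: "\<theta> \<in> N" "\<theta> \<notin> L" "\<theta>\<^sup>2 \<in> L" using \<theta> KN \<open>F = L \<inter> K\<close> by auto
  have quad: "nf_quadratic F K \<theta>" "nf_quadratic L N \<theta>"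
    using nf_ext_degree.quadratic_basis[OF FK refl \<theta>(1,2)] nf_ext_degree.quadratic_basis[OF LN2 refl \<theta>L(1,2)]
      nf_ext_degree.axioms(1)[OF FK] nf_ext_degree.axioms(1)[OF LN2] \<theta> \<theta>L
    by (simp_all add: nf_quadratic_def nf_quadratic_axioms_def)
  interpret split_family F K L N p \<theta> s \<pp> \<PP> \<PP>'
    by (intro split_family.intro tower.intro tower_axioms.intro split_family_axioms.intro nf_ext_prime.intro
        nf_ext_prime_axioms.intro FL KNp quad FK LN2 assms(1,2) split_enum split_dec[unfolded nfN.ideal_group_simps])
  let ?rel = "subgroup_of DGN (relative_factors p F K L N)"
  interpret R: Fp_basis ?rel p "{1..s}" "S'.cls \<circ> rel_gen" by (rule kernel_Fp_basis)
  have rel_gen_eq: "(\<lambda>i. cyclic_quotient IN p (\<PP> i \<otimes>\<^bsub>IN\<^esub> (\<PP>' i [^]\<^bsub>IN\<^esub> (p - 1)))) = (\<lambda>i. cyclic_quotient IN p (rel_gen i))"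
    by (simp add: rel_gen_def)
  have rel_iso: "?rel \<cong> Fp_power p s" and rel_dim: "has_Fp_dim p ?rel s"
    using R.iso_Fp_power R.has_dim by simp_all
  have prod_iso: "Fp_power p s \<cong> product_group {1..s} (\<lambda>i. cyclic_quotient IN p (rel_gen i))"
    by (rule product_cyclic_quotient_iso(1)[OF nfN.comm_group_ideals prime_p])
      (use PP_frac(4) rel_gen_infinite_order in auto)
  have mon: "ext_bar K N \<in> mon DGL DGN" unfolding mon_def using ext_bar_hom NS.e_inj by simp
  have iso: "(\<lambda>(x, y). x \<otimes>\<^bsub>DGN\<^esub> y) \<in> iso (subgroup_of DGN (absolute_factors p F K L N) \<times>\<times> ?rel) DGN"
    using NS.direct_product unfolding subgroup_of_def absolute_factors_def relative_factors_def .
  have dims: "DGL \<cong> product_group {1..s} (\<lambda>i. cyclic_quotient IL p (\<pp> i)) \<times>\<times>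
         product_group {1..n} (\<lambda>j. cyclic_quotient IL p (\<qq> j)) \<and>
       DGL \<cong> Fp_power p (s + n) \<and> has_Fp_dim p DGL (s + n) \<and> has_Fp_dim p DGN (n + 2 * s)"
    if all: "\<forall>P. totally_ramified F L P \<longrightarrow> splits_in N P \<or> inert_in N P"
  proof -
    \<comment> \<open>The side condition leaves no totally ramified prime outside the two
      lists.\<close>
    have TT: "FL.TT = {P. totally_ramified F L P \<and> splits_in N P} \<union> {P. totally_ramified F L P \<and> inert_in N P}"
      using all by blast
    have disj: "{P. totally_ramified F L P \<and> splits_in N P} \<inter> {P. totally_ramified F L P \<and> inert_in N P} = {}"
      using not_split_and_inert by blast
    have fin: "finite {P. totally_ramified F L P \<and> splits_in N P}" "finite {P. totally_ramified F L P \<and> inert_in N P}"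
      using bij_betw_finite[OF split_enum] bij_betw_finite[OF inert_enum] by simp_all
    have cards: "card {P. totally_ramified F L P \<and> splits_in N P} = s" "card {P. totally_ramified F L P \<and> inert_in N P} = n"
      using bij_betw_same_card[OF split_enum] bij_betw_same_card[OF inert_enum] by simp_all
    have finT: "finite FL.TT" and cardT: "card FL.TT = s + n"
      unfolding TT using card_Un_disjoint[OF fin disj] cards fin by simp_all
    interpret A: Fp_basis DGL p FL.TT "FL.S.cls \<circ> (\<lambda>P. P)" by (rule FL.totally_ramified_Fp_basis[OF finT])
    have isoL: "DGL \<cong> Fp_power p (s + n)" and dimL: "has_Fp_dim p DGL (s + n)"
      using A.iso_Fp_power A.has_dim cardT by simp_all
    interpret Bb: Fp_basis DGN p "FL.TT <+> {1..s}" "case_sum (ext_bar K N \<circ> (FL.S.cls \<circ> (\<lambda>P. P))) (S'.cls \<circ> rel_gen)"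
    proof (rule NS.Fp_basis_sum[OF A.Fp_basis_axioms _ DGN_pow])
      show "Fp_basis (DGN\<lparr>carrier := NS.ker\<rparr>) p {1..s} (S'.cls \<circ> rel_gen)"
        using kernel_Fp_basis unfolding subgroup_of_def relative_factors_def .
    qed
    \<comment> \<open>The absolute part contributes s + n classes, the kernel s more.\<close>
    have "card (FL.TT <+> {1..s}) = n + 2 * s" using card_Plus[OF finT, of "{1..s}"] cardT by simp
    then have dimN: "has_Fp_dim p DGN (n + 2 * s)" using Bb.has_dim by simp
    have qq: "\<qq> j \<in> prime_ideals L" if "j \<in> {1..n}" for j
      using bij_betw_apply[OF inert_enum that] FL.TT_D(1) by blast
    have 1: "Fp_power p s \<cong> product_group {1..s} (\<lambda>i. cyclic_quotient IL p (\<pp> i))"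
      by (rule product_cyclic_quotient_iso(1)[OF nfL.comm_group_ideals prime_p])
        (use nfL.prime_frac pp(2) nfL.prime_infinite_order[OF pp(2)] in auto)
    have 2: "Fp_power p n \<cong> product_group {1..n} (\<lambda>j. cyclic_quotient IL p (\<qq> j))"
      by (rule product_cyclic_quotient_iso(1)[OF nfL.comm_group_ideals prime_p])
        (use nfL.prime_frac qq nfL.prime_infinite_order[OF qq] in auto)
    have "DGL \<cong> Fp_power p s \<times>\<times> Fp_power p n" by (rule iso_trans[OF isoL Fp_power_add])
    then have "DGL \<cong> product_group {1..s} (\<lambda>i. cyclic_quotient IL p (\<pp> i)) \<times>\<times>
         product_group {1..n} (\<lambda>j. cyclic_quotient IL p (\<qq> j))"
      by (rule iso_trans[OF _ group.DirProd_iso_trans[OF Fp_power_group[OF prime_p] 1 2]])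
    then show ?thesis using isoL dimL dimN by blast
  qed
  show ?thesis unfolding rel_gen_eq using mon norm_bar_hom iso iso_trans[OF rel_iso prod_iso] rel_iso rel_dim dims by blast
qed

end
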